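(* Let $d\ge2$. For all linearly independent vectors $(\alpha,\gamma,\lambda),(\beta,\delta,\mu)\in\mathbb{C}^3$ and all $\mathbb{C}$-linearly independent $u,v\in\mathbb{C}[x,y]$ with $\deg u,\deg v\le1$, the degree $d$ foliation $\mathcal{F}$ on $\mathbb{P}^2$ defined by the saturated vector field $$(\alpha u^{d}+\beta v^{d})\partial_x+(\gamma u^{d}+\delta v^{d})\partial_y+(\lambda u^{d}+\mu v^{d})(x\partial_x+y\partial_y)$$ is Galois with extremal weighted branching type $\mathfrak{b}_{\mathcal{F}}^{w}=2(d)_1$ and genus $\mathfrak{g}_{\mathcal{F}}=0$.
   Context: It is part of the hypotheses that the displayed vector field is saturated (its coefficients are coprime) and defines a foliation of degree $d$ on $\mathbb{P}^2$ (over $\mathbb{C}$), the degree being the number of tangencies with a generic line. The Gauss map $\mathcal{G}:\mathbb{P}^2\dashrightarrow\check{\mathbb{P}}^2$ sends a non-singular point $p$ to the line tangent to $\mathcal{F}$ at $p$; it is dominant of topological degree $d$. $\mathcal{F}$ is Galois if the field extension $\mathcal{G}^*:\mathbb{C}(\check{\mathbb{P}}^2)\hookrightarrow\mathbb{C}(\mathbb{P}^2)$ is Galois. The genus $\mathfrak{g}_{\mathcal{F}}$ is the geometric genus of the curve $\mathcal{G}^{-1}(\ell)\subset\mathbb{P}^2$ for a generic line $\ell\subset\check{\mathbb{P}}^2$. Weighted branching type: let $\widetilde{\mathcal{G}}:\widetilde{\mathbb{P}}^2\to\check{\mathbb{P}}^2$ be a resolution of $\mathcal{G}$ by blow-ups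 and $\rho:N\to\check{\mathbb{P}}^2$ the finite morphism, with $N$ normal, of its Stein factorization. Let $\Delta_\rho\subset\check{\mathbb{P}}^2$ be the image of the set where $\rho$ is not a local biholomorphism. For each irreducible component $C$ of $\Delta_\rho$ let $\mathfrak{b}(C)=(\varrho_1\ge\dots\ge\varrho_{k})$ be the tuple of ramification indices of $\rho$ at the points over a generic point of $C$ (local form $(x,y)\mapsto(x,y^{\varrho_i})$), whose sum is $d$. Then $\mathfrak{b}_{\mathcal{F}}^{w}=\sum_C(\deg C)\,\mathfrak{b}(C)$, a formal $\mathbb{Z}$-linear combination of such tuples. The symbol $(d)_1$ denotes the one-entry tuple $(d)$; so $\mathfrak{b}_{\mathcal{F}}^{w}=2(d)_1$ means that every component has tuple $(d)$ (extremal type) and the total degree of $\Delta_\rho$ is $2$. *)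

theory Defs
  imports
    "HOL-Analysis.Analysis"
    "HOL-Computational_Algebra.Computational_Algebra"
    "HOL-Library.Function_Algebras"
    "HOL-Library.Poly_Mapping"
begin

section \<open>Ternary forms and the projective plane\<close>

text \<open>
  \<open>\<complex>[x,y]\<close> is the type \<open>complex poly poly\<close>, with \<open>x\<close> the inner and \<open>y\<close> the outer variable;
  \<open>\<complex>[X,Y,Z]\<close> is \<open>complex poly poly poly\<close>, with \<open>X\<close> innermost and \<open>Z\<close> outermost.  A point of the
  projective plane, or of its dual, is given by any nonzero vector of homogeneous coordinates;
  subsets of these planes are represented by their cones, i.e. by subsets of
  \<open>- {0} :: (complex ^ 3) set\<close>.  The vector \<open>l\<close> of the dual plane is the line \<open>\<Sum>i. l $ i * p $ i = 0\<close>.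
\<close>

type_synonym cpoly2 = "complex poly poly"
type_synonym cpoly3 = "complex poly poly poly"

definition varX :: cpoly2 where "varX = [:[:0, 1:]:]"
definition varY :: cpoly2 where "varY = [:0, 1:]"

definition total_degree_le :: "nat \<Rightarrow> cpoly2 \<Rightarrow> bool" where
  "total_degree_le n f \<longleftrightarrow>
     (\<forall>i j. coeff (coeff f j) i \<noteq> 0 \<longrightarrow> i + j \<le> n)"

definition homogeneous :: "nat \<Rightarrow> cpoly3 \<Rightarrow> bool" where
  "homogeneous n F \<longleftrightarrow>
     (\<forall>i j k. coeff (coeff (coeff F k) j) i \<noteq> 0 \<longrightarrow> i + j + k = n)"

definition homogenize :: "nat \<Rightarrow> cpoly2 \<Rightarrow> cpoly3" where
  "homogenize n f =
     (\<Sum>j\<le>n. \<Sum>i\<le>n - j. monom (monom (monom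
         (coeff (coeff f j) i) i) j) (n - i - j))"

text \<open>Evaluation at a point with coordinates in a \<open>\<complex>\<close>-algebra with structure map \<open>\<iota>\<close>.\<close>

definition eval3 :: "(complex \<Rightarrow> 'a::comm_ring_1) \<Rightarrow> cpoly3 \<Rightarrow> 'a ^ 3 \<Rightarrow> 'a" where
  "eval3 \<iota> F p =
     poly (map_poly (\<lambda>g. poly (map_poly (\<lambda>h. poly (map_poly \<iota> h) (p $ 1)) g) (p $ 2)) F) (p $ 3)"

abbreviation value_at :: "cpoly3 \<Rightarrow> complex ^ 3 \<Rightarrow> complex" where
  "value_at \<equiv> eval3 (\<lambda>c. c)"

definition proj_point :: "complex ^ 3 \<Rightarrow> (complex ^ 3) set" where
  "proj_point p = {c *s p | c. c \<noteq> 0}"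

definition zariski_closed :: "(complex ^ 3) set \<Rightarrow> bool" where
  "zariski_closed Z \<longleftrightarrow>
     (\<exists>\<F>. (\<forall>F\<in>\<F>. \<exists>n. homogeneous n F) \<and> Z = {q. q \<noteq> 0 \<and> (\<forall>F\<in>\<F>. value_at F q = 0)})"

definition zariski_irreducible :: "(complex ^ 3) set \<Rightarrow> bool" where
  "zariski_irreducible Z \<longleftrightarrow> zariski_closed Z \<and> Z \<noteq> {} \<and>
     (\<forall>Z1 Z2. zariski_closed Z1 \<and> zariski_closed Z2 \<and> Z \<subseteq> Z1 \<union> Z2 \<longrightarrow> Z \<subseteq> Z1 \<or> Z \<subseteq> Z2)"

definition irreducible_components :: "(complex ^ 3) set \<Rightarrow> (complex ^ 3) set set" where
  "irreducible_components D =
     {Z. zariski_irreducible Z \<and> Z \<subseteq> D \<and>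
         (\<forall>Z'. zariski_irreducible Z' \<and> Z \<subseteq> Z' \<and> Z' \<subseteq> D \<longrightarrow> Z' = Z)}"

definition curve_degree :: "(complex ^ 3) set \<Rightarrow> nat" where
  "curve_degree Z =
     (THE n. \<exists>F. irreducible F \<and> homogeneous n F \<and> Z = {q. q \<noteq> 0 \<and> value_at F q = 0})"

text \<open>\<open>\<Phi>\<close> holds at a generic point of \<open>Z\<close>, for \<open>Z\<close> irreducible.\<close>

definition generically_on :: "(complex ^ 3) set \<Rightarrow> (complex ^ 3 \<Rightarrow> bool) \<Rightarrow> bool" where
  "generically_on Z \<Phi> \<longleftrightarrow>
     (\<exists>n G. homogeneous n G \<and> (\<exists>q\<in>Z. value_at G q \<noteq> 0) \<and> (\<forall>q\<in>Z. value_at G q \<noteq> 0 \<longrightarrow> \<Phi> q))"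


section \<open>Foliations and their Gauss maps\<close>

text \<open>
  The line through \<open>(x,y)\<close> with direction \<open>(P,Q)\<close> has dual coordinates
  \<open>(Q, -P, y P - x Q)\<close>.  Homogenizing these in the smallest possible degree gives, for coprime \<open>P\<close>
  and \<open>Q\<close>, the coprime coefficients \<open>\<omega>\<close> of the homogeneous 1-form of the foliation of
  \<open>P \<partial>\<^sub>x + Q \<partial>\<^sub>y\<close>.  The Gauss map is then \<open>p \<mapsto> \<omega>(p)\<close>, and the singular points are the zeros of \<open>\<omega>\<close>.
\<close>

definition gauss_map :: "cpoly2 \<Rightarrow> cpoly2 \<Rightarrow> cpoly3 ^ 3" where
  "gauss_map P Q =
     (let R = varY * P - varX * Q;
          n = (LEAST n. total_degree_le n P \<and> total_degree_le n Q \<and> total_degree_le n R)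
      in vector [homogenize n Q, homogenize n (- P), homogenize n R])"

text \<open>
  The tangency points with a generic line are simple and nonsingular, so counting them without
  multiplicity gives the degree.
\<close>

definition foliation_degree :: "cpoly3 ^ 3 \<Rightarrow> nat \<Rightarrow> bool" where
  "foliation_degree \<omega> d \<longleftrightarrow>
     generically_on (- {0}) (\<lambda>l.
       (let tangencies = proj_point ` {p. p \<noteq> 0 \<and> (\<exists>c. c \<noteq> 0 \<and> (\<chi> i. value_at (\<omega> $ i) p) = c *s l)}
        in finite tangencies \<and> card tangencies = d))"


section \<open>Function fields and the Galois property\<close>

text \<open>All function fields of surfaces below live in the field \<open>K = \<complex>(x,y)\<close> of rational functions on the plane.\<close>

type_synonym ratfun = "cpoly2 fract"

definition const_ratfun :: "complex \<Rightarrow> ratfun" where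
  "const_ratfun c = Fraction_Field.Fract [:[:c:]:] 1"

definition generic_point_plane :: "ratfun ^ 3" where
  "generic_point_plane = vector [Fraction_Field.Fract varX 1, Fraction_Field.Fract varY 1, 1]"

text \<open>
  The homogeneous coordinates of the dual plane, pulled back by the Gauss map.  Only their ratios
  are intrinsic.
\<close>

definition gauss_coords :: "cpoly3 ^ 3 \<Rightarrow> ratfun ^ 3" where
  "gauss_coords \<omega> = (\<chi> i. eval3 const_ratfun (\<omega> $ i) generic_point_plane)"

text \<open>
  The field generated over \<open>\<complex>\<close> by the ratios of the coordinates of \<open>T\<close>: the function field of
  the closure of the point \<open>T\<close>.  For \<open>T = gauss_coords \<omega>\<close> it is the image of the pullback
  of the function field of the dual plane.
\<close>

definition ratio_field :: "(complex \<Rightarrow> 'a::field) \<Rightarrow> 'a ^ 3 \<Rightarrow> 'a set" where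
  "ratio_field \<iota> T =
     {eval3 \<iota> G T / eval3 \<iota> H T | n G H. homogeneous n G \<and> homogeneous n H \<and> eval3 \<iota> H T \<noteq> 0}"

definition finite_module :: "'a::field set \<Rightarrow> 'a set \<Rightarrow> bool" where
  "finite_module A S \<longleftrightarrow>
     (\<exists>B. finite B \<and> B \<subseteq> S \<and> S = {\<Sum>b\<in>B. c b * b | c. c ` B \<subseteq> A})"

definition field_automorphisms :: "'a::field set \<Rightarrow> ('a \<Rightarrow> 'a) set" where
  "field_automorphisms L =
     {\<sigma>. bij \<sigma> \<and> (\<forall>f g. \<sigma> (f + g) = \<sigma> f + \<sigma> g) \<and> (\<forall>f g. \<sigma> (f * g) = \<sigma> f * \<sigma> g) \<and> (\<forall>f\<in>L. \<sigma> f = f)}"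

definition galois_extension :: "'a::field set \<Rightarrow> bool" where
  "galois_extension L \<longleftrightarrow>
     finite_module L UNIV \<and> {f. \<forall>\<sigma>\<in>field_automorphisms L. \<sigma> f = f} = L"

definition galois_foliation :: "cpoly3 ^ 3 \<Rightarrow> bool" where
  "galois_foliation \<omega> \<longleftrightarrow> galois_extension (ratio_field const_ratfun (gauss_coords \<omega>))"


section \<open>Subrings of a field and their localizations\<close>

definition is_subring :: "'a::field set \<Rightarrow> bool" where
  "is_subring A \<longleftrightarrow> 1 \<in> A \<and> (\<forall>f\<in>A. \<forall>g\<in>A. f - g \<in> A \<and> f * g \<in> A)"

definition is_ideal :: "'a::field set \<Rightarrow> 'a set \<Rightarrow> bool" where
  "is_ideal A J \<longleftrightarrow>
     J \<subseteq> A \<and> 0 \<in> J \<and> (\<forall>f\<in>J. \<forall>g\<in>J. f + g \<in> J) \<and> (\<forall>a\<in>A. \<forall>f\<in>J. a * f \<in> J)"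

definition is_maximal_ideal :: "'a::field set \<Rightarrow> 'a set \<Rightarrow> bool" where
  "is_maximal_ideal A J \<longleftrightarrow>
     is_ideal A J \<and> J \<noteq> A \<and> (\<forall>J'. is_ideal A J' \<and> J \<subseteq> J' \<longrightarrow> J' = J \<or> J' = A)"

definition localize :: "'a::field set \<Rightarrow> 'a set \<Rightarrow> 'a set" where
  "localize A J = {f / g | f g. f \<in> A \<and> g \<in> A - J}"

definition closed_points :: "'a::field set \<Rightarrow> 'a set set" where
  "closed_points A = {localize A J | J. is_maximal_ideal A J}"

definition nonunits :: "'a::field set \<Rightarrow> 'a set" where
  "nonunits R = {f \<in> R. f = 0 \<or> inverse f \<notin> R}"

definition dominates :: "'a::field set \<Rightarrow> 'a set \<Rightarrow> bool" where
  "dominates S R \<longleftrightarrow> R \<subseteq> S \<and> nonunits R \<subseteq> nonunits S"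

definition ideal_gen :: "'a::field set \<Rightarrow> 'a set \<Rightarrow> 'a set" where
  "ideal_gen R X = is_ideal R hull X"

text \<open>Integrally closed in the whole field; all local rings below have fraction field \<open>K\<close>.\<close>

definition normal_ring :: "'a::field set \<Rightarrow> bool" where
  "normal_ring R \<longleftrightarrow>
     (\<forall>f. (\<exists>p. lead_coeff p = 1 \<and> range (coeff p) \<subseteq> R \<and> poly p f = 0) \<longrightarrow> f \<in> R)"


section \<open>Resolution and Stein factorization of the Gauss map\<close>

text \<open>
  A surface with a fixed identification of its function field with \<open>K\<close> is given by
  the set of the local rings, inside \<open>K\<close>, of its closed points.  A point \<open>S\<close> of such a surface
  is mapped to a point \<open>R\<close> of another one by the induced rational map, which is then
  regular at \<open>S\<close>, iff \<open>S\<close> dominates \<open>R\<close>.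
\<close>

definition local_ring_at :: "ratfun ^ 3 \<Rightarrow> complex ^ 3 \<Rightarrow> ratfun set" where
  "local_ring_at T q =
     {eval3 const_ratfun G T / eval3 const_ratfun H T | n G H.
        homogeneous n G \<and> homogeneous n H \<and> value_at H q \<noteq> 0 \<and> eval3 const_ratfun H T \<noteq> 0}"

text \<open>
  The closed points of the exceptional curve of the blow-up of the point with local ring \<open>R\<close>; the
  blow-up is covered by the spectra of the rings \<open>R[m/t]\<close> with \<open>t\<close> in the maximal ideal \<open>m\<close> of \<open>R\<close>.
\<close>

definition exceptional_points :: "'a::field set \<Rightarrow> 'a set set" where
  "exceptional_points R =
     {localize A J | t A J. t \<in> nonunits R \<and> t \<noteq> 0 \<and>
        A = is_subring hull (R \<union> {f / t | f. f \<in> nonunits R}) \<and>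
        is_maximal_ideal A J \<and> nonunits R \<subseteq> J}"

inductive iterated_blowup :: "ratfun set set \<Rightarrow> bool" where
  plane: "iterated_blowup (local_ring_at generic_point_plane ` (- {0}))"
| blowup: "iterated_blowup M \<Longrightarrow> R \<in> M \<Longrightarrow> iterated_blowup ((M - {R}) \<union> exceptional_points R)"

text \<open>Below, \<open>T\<close> are the homogeneous coordinates of the dual plane pulled back by the Gauss map.\<close>

definition lies_over :: "ratfun ^ 3 \<Rightarrow> ratfun set \<Rightarrow> complex ^ 3 \<Rightarrow> bool" where
  "lies_over T S q \<longleftrightarrow> q \<noteq> 0 \<and> dominates S (local_ring_at T q)"

definition resolution :: "ratfun ^ 3 \<Rightarrow> ratfun set set \<Rightarrow> bool" where
  "resolution T M \<longleftrightarrow> iterated_blowup M \<and> (\<forall>R\<in>M. \<exists>q. lies_over T R q)"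

text \<open>
  For \<open>h \<noteq> 0\<close>, the coordinate ring of the affine chart \<open>\<Sum>i. h $ i * q $ i \<noteq> 0\<close> of the dual
  plane, and the ring of regular functions on the preimage of that chart in \<open>M\<close>, i.e. the sections
  over it of the direct image of the structure sheaf of \<open>M\<close>.
\<close>

definition chart_ring :: "ratfun ^ 3 \<Rightarrow> complex ^ 3 \<Rightarrow> ratfun set" where
  "chart_ring T h =
     {eval3 const_ratfun G T / (\<Sum>i\<in>UNIV. const_ratfun (h $ i) * T $ i) ^ n | n G. homogeneous n G}"

definition direct_image_ring :: "ratfun ^ 3 \<Rightarrow> ratfun set set \<Rightarrow> complex ^ 3 \<Rightarrow> ratfun set" where
  "direct_image_ring T M h =
     {f. \<forall>R\<in>M. \<forall>q. lies_over T R q \<and> (\<Sum>i\<in>UNIV. h $ i * q $ i) \<noteq> 0 \<longrightarrow> f \<in> R}"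

text \<open>
  \<open>N\<close> is the relative spectrum of the direct image of the structure sheaf of \<open>M\<close>; it is
  finite over the dual plane and normal.
\<close>

definition stein_factorization :: "ratfun ^ 3 \<Rightarrow> ratfun set set \<Rightarrow> ratfun set set \<Rightarrow> bool" where
  "stein_factorization T M N \<longleftrightarrow>
     N = (\<Union>h\<in>- {0}. closed_points (direct_image_ring T M h)) \<and>
     (\<forall>h\<in>- {0}. finite_module (chart_ring T h) (direct_image_ring T M h)) \<and>
     (\<forall>S\<in>N. normal_ring S)"


section \<open>Weighted branching type\<close>

text \<open>
  A finite normal cover of the plane is a local biholomorphism at \<open>S\<close> iff some (equivalently,
  any) pair of local coordinates at the image of \<open>S\<close> pulls back to local coordinates at \<open>S\<close>.
\<close>

definition local_biholomorphism :: "ratfun ^ 3 \<Rightarrow> ratfun set \<Rightarrow> complex ^ 3 \<Rightarrow> bool" where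
  "local_biholomorphism T S q \<longleftrightarrow>
     (\<exists>s t. nonunits (local_ring_at T q) = ideal_gen (local_ring_at T q) {s, t} \<and>
            nonunits S = ideal_gen S {s, t})"

definition branch_locus :: "ratfun ^ 3 \<Rightarrow> ratfun set set \<Rightarrow> (complex ^ 3) set" where
  "branch_locus T N = {q. \<exists>S\<in>N. lies_over T S q \<and> \<not> local_biholomorphism T S q}"

definition curve_ideal_at :: "ratfun ^ 3 \<Rightarrow> (complex ^ 3) set \<Rightarrow> complex ^ 3 \<Rightarrow> ratfun set" where
  "curve_ideal_at T C q =
     {eval3 const_ratfun G T / eval3 const_ratfun H T | n G H.
        homogeneous n G \<and> homogeneous n H \<and> (\<forall>p\<in>C. value_at G p = 0) \<and>
        value_at H q \<noteq> 0 \<and> eval3 const_ratfun H T \<noteq> 0}"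

text \<open>
  Let \<open>(s,t)\<close> be local coordinates at \<open>q\<close> with \<open>C = {t = 0}\<close>, and \<open>(s,w)\<close> local coordinates at
  \<open>S\<close> with \<open>t = e w\<^sup>r\<close>, \<open>e\<close> a unit.  Replacing \<open>w\<close> by the analytic coordinate \<open>e\<^bsup>1/r\<^esup> w\<close> gives the
  local form \<open>(x,y) \<mapsto> (x,y\<^sup>r)\<close>.  Conversely the latter yields such an \<open>s\<close>, \<open>t\<close>, and an algebraic
  local equation \<open>w\<close> of the reduced preimage of \<open>C\<close>.
\<close>

definition ramification_index ::
  "ratfun ^ 3 \<Rightarrow> (complex ^ 3) set \<Rightarrow> complex ^ 3 \<Rightarrow> ratfun set \<Rightarrow> nat \<Rightarrow> bool" where
  "ramification_index T C q S r \<longleftrightarrow> r \<ge> 1 \<and>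
     (\<exists>s t w e. nonunits (local_ring_at T q) = ideal_gen (local_ring_at T q) {s, t} \<and>
        curve_ideal_at T C q = ideal_gen (local_ring_at T q) {t} \<and>
        nonunits S = ideal_gen S {s, w} \<and>
        e \<in> S - nonunits S \<and> t = e * w ^ r)"

definition branching_tuple :: "ratfun ^ 3 \<Rightarrow> ratfun set set \<Rightarrow> (complex ^ 3) set \<Rightarrow> nat list" where
  "branching_tuple T N C =
     (THE rs. sorted_wrt (\<ge>) rs \<and>
        generically_on C (\<lambda>q. \<exists>Ss. distinct Ss \<and> set Ss = {S \<in> N. lies_over T S q} \<and>
                                  list_all2 (ramification_index T C q) Ss rs))"

text \<open>By purity of the branch locus all its irreducible components are curves.\<close>

definition weighted_branching :: "ratfun ^ 3 \<Rightarrow> ratfun set set \<Rightarrow> nat list \<Rightarrow>\<^sub>0 int" where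
  "weighted_branching T N =
     (\<Sum>C\<in>irreducible_components (branch_locus T N).
        Poly_Mapping.single (branching_tuple T N C) (int (curve_degree C)))"

text \<open>
  The type is computed from any resolution.  A resolution exists by elimination of
  indeterminacies, and has a Stein factorization.
\<close>

definition weighted_branching_type :: "cpoly3 ^ 3 \<Rightarrow> (nat list \<Rightarrow>\<^sub>0 int) \<Rightarrow> bool" where
  "weighted_branching_type \<omega> b \<longleftrightarrow>
     (\<forall>M N. resolution (gauss_coords \<omega>) M \<and> stein_factorization (gauss_coords \<omega>) M N
            \<longrightarrow> weighted_branching (gauss_coords \<omega>) N = b)"


section \<open>Geometric genus\<close>

text \<open>
  \<open>E\<close> is a subfield of the ambient field containing \<open>\<iota> ` \<complex>\<close>, the function field of a curve.  The points of the
  smooth projective model of the curve are the valuation rings of \<open>E\<close> over \<open>\<complex>\<close>.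
\<close>

definition place_ring :: "(complex \<Rightarrow> 'a::field) \<Rightarrow> 'a set \<Rightarrow> 'a set \<Rightarrow> bool" where
  "place_ring \<iota> E V \<longleftrightarrow>
     is_subring V \<and> range \<iota> \<subseteq> V \<and> V \<subset> E \<and> (\<forall>f\<in>E. f \<in> V \<or> inverse f \<in> V)"

definition derivations :: "(complex \<Rightarrow> 'a::field) \<Rightarrow> 'a set \<Rightarrow> ('a \<Rightarrow> 'a) set" where
  "derivations \<iota> E =
     {D. (\<forall>f\<in>E. D f \<in> E) \<and> (\<forall>f. f \<notin> E \<longrightarrow> D f = 0) \<and>
         (\<forall>f\<in>E. \<forall>g\<in>E. D (f + g) = D f + D g \<and> D (f * g) = D f * g + f * D g) \<and>
         (\<forall>c. D (\<iota> c) = 0)}"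

text \<open>
  The Kaehler differentials of \<open>E\<close> over \<open>\<complex>\<close> are identified with functions on
  the derivations, \<open>f dg\<close> being \<open>D \<mapsto> f * D g\<close>; this is faithful as \<open>E\<close> is finitely generated of
  characteristic \<open>0\<close>.  The differentials \<open>\<Sum>i. f\<^sub>i dg\<^sub>i\<close> with \<open>f\<^sub>i\<close> and \<open>g\<^sub>i\<close> in a place ring \<open>V\<close> of \<open>E\<close>
  are those regular at that place.
\<close>

definition differentials :: "(complex \<Rightarrow> 'a::field) \<Rightarrow> 'a set \<Rightarrow> 'a set \<Rightarrow> (('a \<Rightarrow> 'a) \<Rightarrow> 'a) set" where
  "differentials \<iota> E V =
     {(\<lambda>D. if D \<in> derivations \<iota> E then \<Sum>i<n. f i * D (g i) else 0) | (n::nat) f g.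
        \<forall>i<n. f i \<in> V \<and> g i \<in> V}"

definition regular_differentials :: "(complex \<Rightarrow> 'a::field) \<Rightarrow> 'a set \<Rightarrow> (('a \<Rightarrow> 'a) \<Rightarrow> 'a) set" where
  "regular_differentials \<iota> E =
     {\<eta> \<in> differentials \<iota> E E. \<forall>V. place_ring \<iota> E V \<longrightarrow> \<eta> \<in> differentials \<iota> E V}"

text \<open>The dimension over \<open>\<complex>\<close> of the space of regular differentials is \<open>g\<close>.\<close>

definition function_field_genus :: "(complex \<Rightarrow> 'a::field) \<Rightarrow> 'a set \<Rightarrow> nat \<Rightarrow> bool" where
  "function_field_genus \<iota> E g \<longleftrightarrow>
     (let scale = (\<lambda>c \<eta> D. \<iota> c * \<eta> D)
      in \<exists>B. finite B \<and> card B = g \<and> \<not> module.dependent scale B \<and>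
             module.span scale B = regular_differentials \<iota> E)"

text \<open>
  Function fields of plane curves are realized inside the field of formal Laurent series: for a
  point \<open>\<xi>\<close> of the irreducible curve \<open>F = 0\<close> with coordinates there which is generic (no other
  curve contains it), the ratios \<open>G(\<xi>) / H(\<xi>)\<close> of forms make up a field isomorphic over
  \<open>\<complex>\<close> to the function field of the curve.  Expanding the coordinates at a smooth point of the
  curve gives such a \<open>\<xi>\<close>.
\<close>

definition generic_point_of :: "cpoly3 \<Rightarrow> (complex fls) ^ 3 \<Rightarrow> bool" where
  "generic_point_of F \<xi> \<longleftrightarrow>
     \<xi> \<noteq> 0 \<and> (\<forall>n H. homogeneous n H \<longrightarrow> (eval3 fls_const H \<xi> = 0 \<longleftrightarrow> F dvd H))"

definition geometric_genus :: "cpoly3 \<Rightarrow> nat \<Rightarrow> bool" where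
  "geometric_genus F g \<longleftrightarrow>
     irreducible F \<and> (\<exists>n. homogeneous n F) \<and>
     (\<forall>\<xi>. generic_point_of F \<xi> \<longrightarrow> function_field_genus fls_const (ratio_field fls_const \<xi>) g)"

text \<open>
  A line \<open>s\<close> of the dual plane is \<open>{l. \<Sum>i. s $ i * l $ i = 0}\<close>; for generic \<open>s\<close> its preimage under
  the Gauss map is the curve \<open>\<Sum>i. s $ i * \<omega> $ i = 0\<close>, which is irreducible.
\<close>

definition foliation_genus :: "cpoly3 ^ 3 \<Rightarrow> nat \<Rightarrow> bool" where
  "foliation_genus \<omega> g \<longleftrightarrow>
     generically_on (- {0}) (\<lambda>s. geometric_genus (\<Sum>i\<in>UNIV. [:[:[:s $ i:]:]:] * \<omega> $ i) g)"

end

theory Submission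
  imports Defs "HOL-Computational_Algebra.Field_as_Ring"
begin

text \<open>
  Write the foliation homogeneously: at \<open>p\<close> it has the direction \<open>W p = u\<^sup>d a + v\<^sup>d b\<close> with vectors
  \<open>a\<close>, \<open>b\<close> made of the given coefficients, and the Gauss map is \<open>p \<mapsto> W p \<times> p\<close>. Let \<open>\<theta> = v / u\<close>. The
  tangent line \<open>T\<close> at the generic point satisfies \<open>a \<bullet> T = - \<theta>\<^sup>d (b \<bullet> T)\<close>, and the point is recovered
  from \<open>T\<close> and \<open>\<theta>\<close> as the intersection of its tangent line with the line \<open>v = \<theta> u\<close> through the base
  point \<open>u = v = 0\<close>. So the function field \<open>K\<close> of the plane is generated over the field \<open>L\<close> of the dual
  plane by \<open>\<theta>\<close>, a \<open>d\<close>-th root of a quotient of two linear forms of the dual plane: \<open>K\<close> is a Kummer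
  extension of \<open>L\<close>, cyclic of degree \<open>d\<close>, and the cover can only be branched along the two lines \<open>a = 0\<close>
  and \<open>b = 0\<close>. This is \<open>pencil_foliation.kummer\<close>; the degree of the extension is \<open>d\<close> because a generic
  line is tangent to the foliation at points with \<open>d\<close> different values of \<open>\<theta>\<close>
  (\<open>forms_independent\<close>). Being a Kummer extension gives the Galois property.

  The branching type is read off from the integral closure of the dual plane in \<open>K\<close>. Whatever the resolution
  is, the rings of functions on the preimages of
  the affine charts of the dual plane are finite over the coordinate rings of the charts, and their local rings
  are normal; so a point of \<open>N\<close> over \<open>q\<close> is a localization of the integral closure of the local ring \<open>\<O>\<close> at
  \<open>q\<close>. By unique factorization of ternary forms, the integral closure is
  \<open>\<Lambda> = \<O> + \<rho> \<theta> \<O> + \<dots> + \<rho> \<theta>\<^bsup>d-1\<^esup> \<O>\<close> where \<open>\<rho> = b / l\<close> for a linear form \<open>l\<close> not vanishing at \<open>q\<close>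
  (\<open>finite_algebra_integral\<close>). If \<open>q\<close> is on neither line, the residue of \<open>\<theta>\<close> at a point over \<open>q\<close> is a simple
  root of \<open>X\<^sup>d - c\<close> with \<open>c \<noteq> 0\<close>, and the cover is unramified there (\<open>unramified\<close>). If \<open>q\<close> lies on \<open>a = 0\<close>,
  the components of nonzero weight are nilpotent modulo the maximal ideal of \<open>\<O>\<close>; then \<open>\<Lambda>\<close> is local and
  is the only point over \<open>q\<close> (\<open>points_over_branch_line\<close>), it is never unramified
  (\<open>not_local_biholomorphism\<close>; this includes the intersection of the two lines, where \<open>N\<close> may be singular),
  and away from the other line its ramification index is \<open>d\<close> as \<open>\<theta>\<^sup>d\<close> is an equation of
  \<open>a = 0\<close> (\<open>ramification_index_d\<close>, \<open>ramification_index_unique\<close>). Replacing \<open>\<theta>\<close> by its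
  inverse exchanges the two lines.

  The preimage of the line given by \<open>s\<close> is the curve \<open>det (s, W p, p) = 0\<close> of degree \<open>d + 1\<close>, which has a point
  of multiplicity \<open>d\<close> at the base point. For generic \<open>s\<close> it is irreducible (\<open>polar_irreducible\<close>), and the lines
  through the base point parametrize it by \<open>\<theta>\<close>; so its function field is \<open>\<complex>(\<tau>)\<close> (\<open>polar_genus\<close>), which has no
  regular differentials: being regular at the finite places, such a differential is \<open>p(\<tau>) d\<tau>\<close> with
  a polynomial \<open>p\<close>, and \<open>d\<tau>\<close> has a double pole at infinity. The irreducibility
  also shows that the coordinates of \<open>W p \<times> p\<close> have no common linear factor, so that homogenizing in the smallest
  possible degree yields forms of degree \<open>d + 1\<close> (\<open>not_smaller_degree\<close>).
\<close>

section \<open>Ring homomorphisms and evaluation of ternary forms\<close>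

text \<open>
  Evaluations, substitutions and inclusions of constants are all ring homomorphisms between different
  types, and an identity between two of them only has to be checked on constants and coordinates.
\<close>

definition unital_hom :: "('a::comm_ring_1 \<Rightarrow> 'b::comm_ring_1) \<Rightarrow> bool" where
  "unital_hom \<phi> \<longleftrightarrow> \<phi> 1 = 1 \<and> (\<forall>x y. \<phi> (x + y) = \<phi> x + \<phi> y \<and> \<phi> (x * y) = \<phi> x * \<phi> y)"

lemma hom_one: "unital_hom \<phi> \<Longrightarrow> \<phi> 1 = 1"
  and hom_add: "unital_hom \<phi> \<Longrightarrow> \<phi> (x + y) = \<phi> x + \<phi> y"
  and hom_mult: "unital_hom \<phi> \<Longrightarrow> \<phi> (x * y) = \<phi> x * \<phi> y"
  by (auto simp: unital_hom_def)

lemma hom_zero: assumes "unital_hom \<phi>" shows "\<phi> 0 = 0"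
  using hom_add[OF assms, of 0 0] by simp

lemma hom_minus: assumes "unital_hom \<phi>" shows "\<phi> (- x) = - \<phi> x"
  using hom_add[OF assms, of "-x" x] hom_zero[OF assms] by (simp add: eq_neg_iff_add_eq_0)

lemma hom_diff: assumes "unital_hom \<phi>" shows "\<phi> (x - y) = \<phi> x - \<phi> y"
  using hom_add[OF assms, of x "-y"] hom_minus[OF assms, of y] by simp

lemma hom_sum: assumes "unital_hom \<phi>" shows "\<phi> (sum f A) = (\<Sum>x\<in>A. \<phi> (f x))"
  by (induction A rule: infinite_finite_induct)
     (simp_all add: hom_zero[OF assms] hom_add[OF assms])

lemma hom_prod: assumes "unital_hom \<phi>" shows "\<phi> (prod f A) = (\<Prod>x\<in>A. \<phi> (f x))"
  by (induction A rule: infinite_finite_induct)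
     (simp_all add: hom_one[OF assms] hom_mult[OF assms])

lemma hom_power: assumes "unital_hom \<phi>" shows "\<phi> (x ^ n) = \<phi> x ^ n"
  by (induction n) (simp_all add: hom_one[OF assms] hom_mult[OF assms])

lemmas hom_simps = hom_one hom_zero hom_add hom_mult hom_minus hom_diff hom_sum hom_prod hom_power

lemma hom_id: "unital_hom (\<lambda>x. x)"
  by (simp add: unital_hom_def)

lemma hom_comp: "unital_hom \<phi> \<Longrightarrow> unital_hom \<psi> \<Longrightarrow> unital_hom (\<lambda>x. \<phi> (\<psi> x))"
  by (simp add: unital_hom_def)

lemma hom_const_poly: "unital_hom (\<lambda>c. [:c:])"
  by (simp add: unital_hom_def one_pCons)

lemma hom_poly_at: "unital_hom (\<lambda>p. poly p x)"
  by (simp add: unital_hom_def)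

lemma hom_map_poly:
  assumes "unital_hom \<phi>" shows "unital_hom (map_poly \<phi>)"
proof -
  note h = hom_simps[OF assms]
  have "map_poly \<phi> (p * q) = map_poly \<phi> p * map_poly \<phi> q" for p q
    by (rule poly_eqI) (simp add: coeff_map_poly h coeff_mult)
  moreover have "map_poly \<phi> (p + q) = map_poly \<phi> p + map_poly \<phi> q" for p q
    by (rule poly_eqI) (simp add: coeff_map_poly h)
  moreover have "map_poly \<phi> 1 = 1"
    by (rule poly_eqI) (simp add: coeff_map_poly h coeff_1)
  ultimately show ?thesis by (simp add: unital_hom_def)
qed

lemma hom_eval: "unital_hom \<phi> \<Longrightarrow> unital_hom (\<lambda>p. poly (map_poly \<phi> p) x)"
  by (rule hom_comp[OF hom_poly_at hom_map_poly])

lemma eval_pCons: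
  assumes "unital_hom \<phi>"
  shows "poly (map_poly \<phi> (pCons a p)) x = \<phi> a + x * poly (map_poly \<phi> p) x"
  by (simp add: map_poly_pCons hom_zero[OF assms])

lemma hom_poly_ext:
  assumes h: "unital_hom \<Phi>" "unital_hom \<Psi>"
    and "\<And>c. \<Phi> [:c:] = \<Psi> [:c:]" "\<Phi> [:0, 1:] = \<Psi> [:0, 1:]"
  shows "\<Phi> p = \<Psi> p"
proof (induction p)
  case 0 then show ?case using hom_zero[OF h(1)] hom_zero[OF h(2)] by simp
next
  case (pCons a p)
  have "pCons a p = [:a:] + [:0, 1:] * p" by simp
  moreover have "\<Phi> ([:a:] + [:0, 1:] * p) = \<Psi> ([:a:] + [:0, 1:] * p)"
    unfolding hom_add[OF h(1)] hom_add[OF h(2)] hom_mult[OF h(1)] hom_mult[OF h(2)] using pCons assms by simp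
  ultimately show ?case by simp
qed

abbreviation cst :: "complex \<Rightarrow> cpoly3" where "cst c \<equiv> [:[:[:c:]:]:]"

definition coord :: "cpoly3 ^ 3" where
  "coord = vector [[:[:[:0, 1:]:]:], [:[:0, 1:]:], [:0, 1:]]"

lemma coord_simps: "coord $ 1 = [:[:[:0, 1:]:]:]" "coord $ 2 = [:[:0, 1:]:]" "coord $ 3 = [:0, 1:]"
  by (simp_all add: coord_def)

lemma hom_cst: "unital_hom cst"
  by (simp add: unital_hom_def one_pCons)

lemma hom_eval3: "unital_hom \<iota> \<Longrightarrow> unital_hom (\<lambda>F. eval3 \<iota> F p)"
  unfolding eval3_def by (intro hom_eval)

lemma eval3_cst: assumes "unital_hom \<iota>" shows "eval3 \<iota> (cst c) p = \<iota> c"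
  by (simp add: eval3_def eval_pCons hom_eval assms)

lemma eval3_coord:
  assumes "unital_hom \<iota>" shows "eval3 \<iota> (coord $ i) p = p $ i"
proof -
  have "i = 1 \<or> i = 2 \<or> i = 3" using exhaust_3 by blast
  then show ?thesis
    by (auto simp: eval3_def coord_simps eval_pCons hom_eval assms hom_zero[OF assms] hom_one[OF assms]
        hom_one[OF hom_eval[OF assms]] hom_one[OF hom_eval[OF hom_eval[OF assms]]])
qed

lemma hom_cpoly3_ext:
  fixes \<Phi> \<Psi> :: "cpoly3 \<Rightarrow> 'a::comm_ring_1"
  assumes h: "unital_hom \<Phi>" "unital_hom \<Psi>"
    and c: "\<And>c. \<Phi> (cst c) = \<Psi> (cst c)" and x: "\<And>i. \<Phi> (coord $ i) = \<Psi> (coord $ i)"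
  shows "\<Phi> F = \<Psi> F"
proof -
  have 1: "\<Phi> [:[:h:]:] = \<Psi> [:[:h:]:]" for h
    by (rule hom_poly_ext[of "\<lambda>h. \<Phi> [:[:h:]:]" "\<lambda>h. \<Psi> [:[:h:]:]"])
       (use x[of 1] in \<open>auto simp: c coord_simps intro!: hom_comp[OF h(1)] hom_comp[OF h(2)]
          hom_comp[OF hom_const_poly] hom_const_poly\<close>)
  have 2: "\<Phi> [:g:] = \<Psi> [:g:]" for g
    by (rule hom_poly_ext[of "\<lambda>h. \<Phi> [:h:]" "\<lambda>h. \<Psi> [:h:]"])
       (use x[of 2] in \<open>auto simp: 1 coord_simps intro!: hom_comp[OF h(1)] hom_comp[OF h(2)]
          hom_const_poly\<close>)
  show ?thesis
    by (rule hom_poly_ext[OF h]) (use x[of 3] in \<open>auto simp: 2 coord_simps\<close>)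
qed

lemma hom_eval3_comp:
  assumes "unital_hom \<Phi>" "unital_hom \<iota>"
  shows "\<Phi> (eval3 \<iota> F p) = eval3 (\<lambda>c. \<Phi> (\<iota> c)) F (\<chi> i. \<Phi> (p $ i))"
  by (rule hom_cpoly3_ext[of "\<lambda>F. \<Phi> (eval3 \<iota> F p)"])
     (use assms in \<open>simp_all add: hom_comp[OF assms(1) hom_eval3[OF assms(2)]] hom_eval3
        hom_comp[OF assms] eval3_cst eval3_coord\<close>)

lemma eval3_cst_coord: "eval3 cst F coord = F"
  by (rule hom_cpoly3_ext[of "\<lambda>F. eval3 cst F coord" "\<lambda>F. F"])
     (simp_all add: hom_cst hom_eval3 eval3_cst eval3_coord hom_id)

lemma eval3_subst:
  assumes "unital_hom \<iota>"
  shows "eval3 \<iota> (eval3 cst F L) p = eval3 \<iota> F (\<chi> i. eval3 \<iota> (L $ i) p)"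
  using hom_eval3_comp[OF hom_eval3[OF assms, of p] hom_cst, of F L] by (simp add: eval3_cst assms)

lemma cpoly3_eq_0I:
  assumes "\<And>p. value_at F p = 0" shows "F = 0"
proof -
  have ev: "value_at F (vector [x, y, z]) =
      poly (map_poly (\<lambda>g. poly (map_poly (\<lambda>h. poly h x) g) y) F) z" for x y z
    by (simp add: eval3_def map_poly_idI)
  have h1: "unital_hom (\<lambda>h. poly h (x::complex))" for x by (rule hom_poly_at)
  have "map_poly (\<lambda>g. poly (map_poly (\<lambda>h. poly h x) g) y) F = 0" for x y
    using assms ev by (simp add: poly_all_0_iff_0[symmetric])
  then have 1: "poly (map_poly (\<lambda>h. poly h x) (coeff F k)) y = 0" for x y k
    by (metis (no_types, lifting) coeff_0 coeff_map_poly hom_zero[OF hom_eval[OF h1]])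
  then have "map_poly (\<lambda>h. poly h x) (coeff F k) = 0" for x k
    by (simp add: poly_all_0_iff_0[symmetric])
  then have "poly (coeff (coeff F k) j) x = 0" for x k j
    by (metis (no_types, lifting) coeff_0 coeff_map_poly poly_0)
  then have "coeff (coeff F k) j = 0" for k j
    by (simp add: poly_all_0_iff_0[symmetric])
  then show ?thesis by (simp add: poly_eq_iff)
qed

lemma cpoly3_eqI: "(\<And>p. value_at F p = value_at G p) \<Longrightarrow> F = G"
  using cpoly3_eq_0I[of "F - G"] hom_diff[OF hom_eval3[OF hom_id]] by fastforce


section \<open>The grading by degree\<close>

text \<open>The substitution of \<open>t X\<close>, \<open>t Y\<close>, \<open>t Z\<close> for the coordinates.\<close>

definition scaled :: "cpoly3 \<Rightarrow> cpoly3 poly" where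
  "scaled F = eval3 (\<lambda>c. [:cst c:]) F (\<chi> i. [:0, coord $ i:])"

lemma hom_cst_const: "unital_hom (\<lambda>c. [:cst c:])"
  by (rule hom_comp[OF hom_const_poly hom_cst])

lemma hom_scaled: "unital_hom scaled"
  unfolding scaled_def by (rule hom_eval3[OF hom_cst_const])

lemma poly_monom_induct:
  assumes "\<And>p q. P p \<Longrightarrow> P q \<Longrightarrow> P (p + q)" "\<And>c n. P (monom c n)"
  shows "P p"
proof -
  have "P (\<Sum>i\<le>n. monom (coeff p i) i)" for n
    by (induction n) (simp_all add: assms)
  then show ?thesis by (metis poly_as_sum_of_monoms)
qed

lemma cpoly3_monom_induct:
  assumes add: "\<And>F G. P F \<Longrightarrow> P G \<Longrightarrow> P (F + G)"
    and mon: "\<And>c i j k. P (monom (monom (monom c i) j) k)"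
  shows "P (F :: cpoly3)"
proof (rule poly_monom_induct)
  show "P (monom g k)" for g k
  proof (rule poly_monom_induct[where P = "\<lambda>g. P (monom g k)"])
    show "P (monom (monom h j) k)" for h j
      by (rule poly_monom_induct[where P = "\<lambda>h. P (monom (monom h j) k)"])
         (simp_all add: mon add add_monom[symmetric])
  qed (simp_all add: add add_monom[symmetric])
qed (simp add: add)

lemma monomial_eq: "monom (monom (monom c i) j) k = cst c * coord $ 1 ^ i * coord $ 2 ^ j * coord $ 3 ^ k"
proof -
  have p: "[:0, 1:] ^ n = monom (1::'a::comm_ring_1) n" for n
    by (simp add: monom_altdef)
  have q: "[:h:] ^ n = [:h ^ n:]" for h :: "'a::comm_ring_1" and n
    by (induction n) (simp_all add: one_pCons)
  show ?thesis
    by (simp add: coord_simps p q smult_monom)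
qed

lemma scaled_monomial:
  "scaled (monom (monom (monom c i) j) k) = monom (monom (monom (monom c i) j) k) (i + j + k)"
proof -
  have c: "scaled (coord $ i) = monom (coord $ i) 1" for i
    by (simp add: scaled_def eval3_coord hom_cst_const monom_altdef)
  have k: "scaled (cst c) = monom (cst c) 0"
    by (simp add: scaled_def eval3_cst hom_cst_const monom_0)
  show ?thesis
    unfolding monomial_eq hom_simps[OF hom_scaled] c k by (simp add: monom_power mult_monom add_ac)
qed

lemma coeff_scaled:
  "coeff (coeff (coeff (coeff (scaled F) m) k) j) i =
     (if i + j + k = m then coeff (coeff (coeff F k) j) i else 0)"
proof (induction F rule: cpoly3_monom_induct)
  case (1 F G) then show ?case by (simp add: hom_add[OF hom_scaled])
next
  case (2 c i' j' k') then show ?case by (auto simp: scaled_monomial)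
qed

text \<open>
  With this criterion every statement about degrees becomes one about polynomials in the single variable of
  scaling.
\<close>

lemma homogeneous_iff_scaled: "homogeneous n F \<longleftrightarrow> scaled F = monom F n"
proof -
  have "scaled F = monom F n \<longleftrightarrow> (\<forall>m k j i. (if i + j + k = m then coeff (coeff (coeff F k) j) i else 0)
      = (if n = m then coeff (coeff (coeff F k) j) i else 0))"
    by (simp only: poly_eq_iff coeff_scaled coeff_monom if_distrib[of "\<lambda>f. coeff f _"] coeff_0 cong: if_cong)
  also have "\<dots> \<longleftrightarrow> homogeneous n F"
    unfolding homogeneous_def by (metis (full_types))
  finally show ?thesis ..
qed

lemma homogeneous_0: "homogeneous n 0"
  by (simp add: homogeneous_def)

lemma homogeneous_add: "homogeneous n F \<Longrightarrow> homogeneous n G \<Longrightarrow> homogeneous n (F + G)"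
  by (simp add: homogeneous_iff_scaled hom_add[OF hom_scaled] add_monom)

lemma homogeneous_minus: "homogeneous n F \<Longrightarrow> homogeneous n (- F)"
  by (simp add: homogeneous_def)

lemma homogeneous_diff: "homogeneous n F \<Longrightarrow> homogeneous n G \<Longrightarrow> homogeneous n (F - G)"
  using homogeneous_add[of n F "- G"] homogeneous_minus by simp

lemma homogeneous_mult: "homogeneous n F \<Longrightarrow> homogeneous m G \<Longrightarrow> homogeneous (n + m) (F * G)"
  by (simp add: homogeneous_iff_scaled hom_mult[OF hom_scaled] mult_monom)

lemma homogeneous_sum: "(\<And>x. x \<in> A \<Longrightarrow> homogeneous n (f x)) \<Longrightarrow> homogeneous n (sum f A)"
  by (induction A rule: infinite_finite_induct) (simp_all add: homogeneous_0 homogeneous_add)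

lemma homogeneous_cst: "homogeneous 0 (cst c)"
  by (simp add: homogeneous_iff_scaled scaled_def eval3_cst hom_cst_const monom_0)

lemma homogeneous_1: "homogeneous 0 1"
  using homogeneous_cst[of 1] by (simp add: one_pCons)

lemma homogeneous_coord: "homogeneous 1 (coord $ i)"
  by (simp add: homogeneous_iff_scaled scaled_def eval3_coord hom_cst_const monom_altdef)

lemma homogeneous_power: "homogeneous n F \<Longrightarrow> homogeneous (k * n) (F ^ k)"
  by (induction k) (simp_all add: homogeneous_1 homogeneous_mult)

lemma homogeneous_unique: "homogeneous n F \<Longrightarrow> homogeneous m F \<Longrightarrow> F \<noteq> 0 \<Longrightarrow> n = m"
  by (simp add: homogeneous_iff_scaled monom_eq_iff') 

lemma eval3_scale:
  assumes "unital_hom \<iota>" "homogeneous n F"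
  shows "eval3 \<iota> F (c *s p) = c ^ n * eval3 \<iota> F p"
proof -
  have h: "unital_hom (\<lambda>G. poly (map_poly (\<lambda>G. eval3 \<iota> G p) G) c)"
    by (intro hom_eval hom_eval3 assms)
  have "poly (map_poly (\<lambda>G. eval3 \<iota> G p) (scaled F)) c = eval3 \<iota> F (c *s p)" for F
    unfolding scaled_def hom_eval3_comp[OF h hom_cst_const]
    by (simp add: eval_pCons hom_eval3 assms(1) eval3_cst eval3_coord hom_zero[OF hom_eval3[OF assms(1)]] vector_scalar_mult_def)
  then show ?thesis
    using assms(2) by (simp add: homogeneous_iff_scaled map_poly_monom hom_zero[OF hom_eval3[OF assms(1)]] poly_monom mult.commute flip: \<open>\<And>F. _ = eval3 \<iota> F (c *s p)\<close>)
qed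

text \<open>
  After scaling, a factorization of a form factors a monomial of the scaling variable, and the
  lowest and the highest terms of the factors of a monomial agree.
\<close>

lemma monom_factors:
  fixes p q :: "'a::idom poly"
  assumes "p * q = monom c n" "c \<noteq> 0"
  shows "p = monom (lead_coeff p) (degree p)"
proof -
  have nz: "p \<noteq> 0" "q \<noteq> 0" using assms by auto
  define k where "k = (LEAST k. coeff p k \<noteq> 0)"
  define l where "l = (LEAST k. coeff q k \<noteq> 0)"
  have k: "coeff p k \<noteq> 0" "\<And>i. i < k \<Longrightarrow> coeff p i = 0"
    unfolding k_def using LeastI[of "\<lambda>k. coeff p k \<noteq> 0" "degree p"] nz not_less_Least by auto
  have l: "coeff q l \<noteq> 0" "\<And>i. i < l \<Longrightarrow> coeff q i = 0"
    unfolding l_def using LeastI[of "\<lambda>k. coeff q k \<noteq> 0" "degree q"] nz not_less_Least by auto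
  have "coeff (p * q) (k + l) = (\<Sum>i\<le>k+l. if i = k then coeff p k * coeff q l else 0)"
    unfolding coeff_mult
    by (rule sum.cong[OF refl], case_tac "x < k"; case_tac "x = k") (auto simp: k l)
  then have "coeff (p * q) (k + l) \<noteq> 0" using k l by simp
  then have "k + l = n" using assms by (auto split: if_splits)
  moreover have "degree p + degree q = n"
    using assms nz by (metis degree_mult_eq degree_monom_eq)
  moreover have "k \<le> degree p" "l \<le> degree q" using k(1) l(1) le_degree by blast+
  ultimately have "k = degree p" by simp
  then show ?thesis
    using k by (intro poly_eqI) (metis coeff_eq_0 coeff_monom linorder_neqE_nat)
qed

lemma homogeneous_factor:
  assumes "homogeneous n (F * G)" "F * G \<noteq> 0"
  shows "\<exists>m. homogeneous m F"
proof -
  have "scaled F * scaled G = monom (F * G) n"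
    using assms(1) by (simp add: homogeneous_iff_scaled hom_mult[OF hom_scaled])
  then obtain A m where m: "scaled F = monom A m" using monom_factors assms(2) by metis
  have h: "unital_hom (\<lambda>G. poly G (1::cpoly3))" by (rule hom_poly_at)
  have "poly (scaled F) 1 = F"
    unfolding scaled_def hom_eval3_comp[OF h hom_cst_const] by (simp add: eval3_cst_coord vec_lambda_eta)
  then have "A = F" using m by (simp add: poly_monom)
  then show ?thesis using m homogeneous_iff_scaled by blast
qed

lemma homogeneous_factors:
  assumes "homogeneous n (F * G)" "F * G \<noteq> 0"
  obtains m k where "homogeneous m F" "homogeneous k G" "n = m + k"
proof -
  obtain m k where "homogeneous m F" "homogeneous k G"
    using homogeneous_factor assms mult.commute by metis
  then show ?thesis using that homogeneous_mult homogeneous_unique assms by blast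
qed

lemma unit_homogeneous: assumes "is_unit (G :: cpoly3)" shows "homogeneous 0 G"
proof -
  obtain H where H: "1 = G * H" using assms by (rule dvdE)
  have "homogeneous 0 (G * H)" "G * H \<noteq> 0" using homogeneous_1 H by simp_all
  then obtain m k where "homogeneous m G" "0 = m + k" by (rule homogeneous_factors)
  then show ?thesis by simp
qed

section \<open>Vectors and linear forms\<close>

definition dotp :: "'a::comm_ring_1 ^ 3 \<Rightarrow> 'a ^ 3 \<Rightarrow> 'a" where
  "dotp a p = (\<Sum>i\<in>UNIV. a $ i * p $ i)"

definition crossp :: "'a::comm_ring_1 ^ 3 \<Rightarrow> 'a ^ 3 \<Rightarrow> 'a ^ 3" where
  "crossp a b = vector [a $ 2 * b $ 3 - a $ 3 * b $ 2, a $ 3 * b $ 1 - a $ 1 * b $ 3,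
                        a $ 1 * b $ 2 - a $ 2 * b $ 1]"

definition vmap :: "('a \<Rightarrow> 'b) \<Rightarrow> 'a ^ 3 \<Rightarrow> 'b ^ 3" where
  "vmap f v = (\<chi> i. f (v $ i))"

lemma vmap_nth [simp]: "vmap f v $ i = f (v $ i)"
  by (simp add: vmap_def)

lemma dotp_3: "dotp a p = a $ 1 * p $ 1 + a $ 2 * p $ 2 + a $ 3 * p $ 3"
  by (simp add: dotp_def sum_3)

lemma crossp_nth [simp]:
  "crossp a b $ 1 = a $ 2 * b $ 3 - a $ 3 * b $ 2"
  "crossp a b $ 2 = a $ 3 * b $ 1 - a $ 1 * b $ 3"
  "crossp a b $ 3 = a $ 1 * b $ 2 - a $ 2 * b $ 1"
  by (simp_all add: crossp_def)

lemma vec3_eq_iff: "(v :: 'a ^ 3) = w \<longleftrightarrow> v $ 1 = w $ 1 \<and> v $ 2 = w $ 2 \<and> v $ 3 = w $ 3"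
  by (simp add: vec_eq_iff forall_3)

lemmas vec3_simps = dotp_3 vec3_eq_iff vector_scalar_mult_def

lemma dotp_commute: "dotp a p = dotp p a"
  by (simp add: dotp_def mult.commute)

lemma dotp_add: "dotp a (p + q) = dotp a p + dotp a q" "dotp (p + q) a = dotp p a + dotp q a"
  by (simp_all add: dotp_3 algebra_simps)

lemma dotp_diff: "dotp a (p - q) = dotp a p - dotp a q" "dotp (p - q) a = dotp p a - dotp q a"
  by (simp_all add: dotp_3 algebra_simps)

lemma dotp_scale: "dotp a (c *s p) = c * dotp a p" "dotp (c *s a) p = c * dotp a p"
  by (simp_all add: vec3_simps algebra_simps)

lemma dotp_0 [simp]: "dotp 0 p = 0" "dotp p 0 = 0"
  by (simp_all add: dotp_3)

lemma dotp_hom: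
  assumes "unital_hom \<phi>" shows "\<phi> (dotp a p) = dotp (vmap \<phi> a) (vmap \<phi> p)"
  by (simp add: dotp_3 hom_add[OF assms] hom_mult[OF assms])

definition independent2 :: "'a::comm_ring_1 ^ 3 \<Rightarrow> 'a ^ 3 \<Rightarrow> bool" where
  "independent2 a b \<longleftrightarrow> crossp a b \<noteq> 0"

lemma independent2_iff:
  fixes a b :: "'a::field ^ 3"
  shows "independent2 a b \<longleftrightarrow> (\<forall>x y. x *s a + y *s b = 0 \<longrightarrow> x = 0 \<and> y = 0)"
proof (intro iffI allI impI)
  fix x y assume ab: "independent2 a b" and 0: "x *s a + y *s b = 0"
  have *: "x * a $ i + y * b $ i = 0" for i
    using 0 by (simp add: vec_eq_iff)
  have "x * (a $ i * b $ j - a $ j * b $ i) = 0" "y * (a $ i * b $ j - a $ j * b $ i) = 0" for i j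
    using *[of i] *[of j] by algebra+
  moreover obtain i j where "a $ i * b $ j - a $ j * b $ i \<noteq> 0"
    using ab by (auto simp: independent2_def vec3_eq_iff)
  ultimately show "x = 0 \<and> y = 0" by (metis mult_eq_0_iff)
next
  assume *: "\<forall>x y. x *s a + y *s b = 0 \<longrightarrow> x = 0 \<and> y = 0"
  show "independent2 a b"
  proof (rule ccontr)
    assume "\<not> independent2 a b"
    then have c: "a $ 2 * b $ 3 = a $ 3 * b $ 2" "a $ 3 * b $ 1 = a $ 1 * b $ 3" "a $ 1 * b $ 2 = a $ 2 * b $ 1"
      by (auto simp: independent2_def vec3_eq_iff)
    then have "b $ i *s a + (- a $ i) *s b = 0" for i
      using exhaust_3[of i] by (auto simp: vec3_simps algebra_simps)
    then have "a $ i = 0" for i using * by (metis neg_equal_0_iff_equal)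
    then have "1 *s a + 0 *s b = 0" by (simp add: vec3_simps)
    then show False using * by (metis zero_neq_one)
  qed
qed

lemma independent2_sym: "independent2 a b \<longleftrightarrow> independent2 b a"
  by (auto simp: independent2_def vec3_eq_iff algebra_simps)

lemma independent2_nz: assumes "independent2 a b" shows "a \<noteq> 0" "b \<noteq> 0"
  using assms by (auto simp: independent2_def vec3_eq_iff)

lemma common_zero:
  fixes a b p :: "'a::field ^ 3"
  assumes "independent2 a b" "dotp a p = 0" "dotp b p = 0"
  obtains c where "p = c *s crossp a b"
proof -
  have *: "p $ i * crossp a b $ j = p $ j * crossp a b $ i" for i j
  proof -
    have "p $ 1 * crossp a b $ 2 = p $ 2 * crossp a b $ 1" "p $ 1 * crossp a b $ 3 = p $ 3 * crossp a b $ 1"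
      "p $ 2 * crossp a b $ 3 = p $ 3 * crossp a b $ 2"
      using assms(2,3) unfolding dotp_3 crossp_nth by algebra+
    then show ?thesis using exhaust_3[of i] exhaust_3[of j] by metis
  qed
  obtain j where j: "crossp a b $ j \<noteq> 0"
    using assms(1) by (auto simp: independent2_def vec_eq_iff)
  have "p = (p $ j / crossp a b $ j) *s crossp a b"
    using * j by (simp add: vec_eq_iff vector_scalar_mult_def field_simps)
  then show ?thesis using that by blast
qed

lemma dotp_crossp: "dotp a (crossp a b) = 0" "dotp b (crossp a b) = 0"
  by (simp_all add: dotp_3 algebra_simps)

lemma dotp_eq_1: fixes a :: "'a::field ^ 3" assumes "a \<noteq> 0" obtains e where "dotp a e = 1"
proof -
  obtain k where k: "a $ k \<noteq> 0" using assms by (auto simp: vec_eq_iff)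
  have "dotp a (axis k (1 / a $ k)) = 1"
    using k exhaust_3[of k] by (auto simp: dotp_3 axis_def)
  then show ?thesis using that by blast
qed

lemma independent2_separating:
  fixes a b :: "'a::field ^ 3"
  assumes "independent2 a b" obtains q where "dotp a q = 0" "dotp b q = 1"
proof -
  obtain e where e: "dotp (crossp a b) e = 1"
    using dotp_eq_1 assms unfolding independent2_def by blast
  have "dotp a (crossp e a) = 0" "dotp b (crossp e a) = 1"
    using e by (simp_all add: dotp_3 algebra_simps)
  then show ?thesis using that by blast
qed

definition lin :: "complex ^ 3 \<Rightarrow> cpoly3" where
  "lin a = (\<Sum>i\<in>UNIV. cst (a $ i) * coord $ i)"

lemma eval3_lin:
  assumes "unital_hom \<iota>" shows "eval3 \<iota> (lin a) p = dotp (vmap \<iota> a) p"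
  unfolding lin_def dotp_def hom_sum[OF hom_eval3[OF assms]] hom_mult[OF hom_eval3[OF assms]]
  by (simp add: eval3_cst eval3_coord assms)

lemma vmap_id [simp]: "vmap (\<lambda>x. x) a = a"
  by (simp add: vmap_def vec_lambda_eta)

lemma value_lin: "value_at (lin a) p = dotp a p"
  by (simp add: eval3_lin hom_id)

lemma homogeneous_lin: "homogeneous 1 (lin a)"
  unfolding lin_def using homogeneous_mult[OF homogeneous_cst homogeneous_coord]
  by (intro homogeneous_sum) simp

lemma lin_eq_0_iff: "lin a = 0 \<longleftrightarrow> a = 0"
proof
  assume "lin a = 0"
  then have "dotp a e = 0" for e using value_lin[of a e] by (simp add: eval3_def)
  then show "a = 0" by (metis dotp_eq_1 zero_neq_one)
qed (simp add: lin_def)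

text \<open>
  Polynomials preserve congruences modulo an ideal. The ring \<open>A\<close> is a subset, not the whole type, because this is
  applied both to divisibility in the ring of polynomials and to the maximal ideals of the local rings of the plane,
  which are subrings of the function field.
\<close>

lemma poly_congruence:
  fixes I A :: "'a::comm_ring_1 set"
  assumes \<phi>: "unital_hom \<phi>" and \<psi>: "unital_hom \<psi>"
    and A: "0 \<in> A" "\<And>f g. f \<in> A \<Longrightarrow> g \<in> A \<Longrightarrow> f + g \<in> A \<and> f * g \<in> A"
    and I: "0 \<in> I" "\<And>f g. f \<in> I \<Longrightarrow> g \<in> I \<Longrightarrow> f + g \<in> I" "\<And>f g. f \<in> A \<Longrightarrow> g \<in> I \<Longrightarrow> f * g \<in> I"
    and c: "\<And>c. \<phi> c \<in> A \<and> \<psi> c \<in> A \<and> \<phi> c - \<psi> c \<in> I"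
    and x: "x \<in> A" "y \<in> A" "x - y \<in> I"
  shows "poly (map_poly \<phi> p) x \<in> A \<and> poly (map_poly \<psi> p) y \<in> A \<and>
         poly (map_poly \<phi> p) x - poly (map_poly \<psi> p) y \<in> I"
proof (induction p)
  case 0 then show ?case by (simp add: A I)
next
  case (pCons a p)
  let ?X = "poly (map_poly \<phi> p) x" and ?Y = "poly (map_poly \<psi> p) y"
  have "(\<phi> a + x * ?X) - (\<psi> a + y * ?Y) = (\<phi> a - \<psi> a) + (x * (?X - ?Y) + ?Y * (x - y))"
    by (simp add: algebra_simps)
  also have "\<dots> \<in> I" using pCons.IH x c I(2,3) by meson
  finally show ?case using pCons.IH x c A by (simp add: eval_pCons \<phi> \<psi>)
qed

lemma eval3_congruence:
  fixes I A :: "'a::comm_ring_1 set" and p q :: "'a ^ 3"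
  assumes \<iota>: "unital_hom \<iota>"
    and A: "0 \<in> A" "\<And>f g. f \<in> A \<Longrightarrow> g \<in> A \<Longrightarrow> f + g \<in> A \<and> f * g \<in> A"
    and I: "0 \<in> I" "\<And>f g. f \<in> I \<Longrightarrow> g \<in> I \<Longrightarrow> f + g \<in> I" "\<And>f g. f \<in> A \<Longrightarrow> g \<in> I \<Longrightarrow> f * g \<in> I"
    and c: "\<And>c. \<iota> c \<in> A" and x: "\<And>i. p $ i \<in> A" "\<And>i. q $ i \<in> A" "\<And>i. p $ i - q $ i \<in> I"
  shows "eval3 \<iota> F p \<in> A" "eval3 \<iota> F p - eval3 \<iota> F q \<in> I"
proof -
  note * = poly_congruence[where I = I and A = A, OF _ _ A I]
  have "eval3 \<iota> F p \<in> A \<and> eval3 \<iota> F q \<in> A \<and> eval3 \<iota> F p - eval3 \<iota> F q \<in> I"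
    unfolding eval3_def by (intro * hom_eval \<iota> x conjI) (use * c x I \<iota> hom_eval in auto)
  then show "eval3 \<iota> F p \<in> A" "eval3 \<iota> F p - eval3 \<iota> F q \<in> I" by auto
qed

text \<open>
  Projecting the space onto the plane \<open>a = 0\<close> identifies the ring of polynomials modulo the form
  \<open>lin a\<close> with a subring of the ring of polynomials. Hence \<open>lin a\<close> is prime and divides what vanishes on the plane.
\<close>

lemma lin_dvd_kernel:
  assumes "a \<noteq> 0"
  obtains \<Phi> :: "cpoly3 \<Rightarrow> cpoly3" where "unital_hom \<Phi>" "\<And>F. lin a dvd F \<longleftrightarrow> \<Phi> F = 0"
    "\<And>F. \<Phi> F = 0 \<longleftrightarrow> (\<forall>p. dotp a p = 0 \<longrightarrow> value_at F p = 0)"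
proof -
  obtain e where e: "dotp a e = 1" using dotp_eq_1 assms by blast
  define L where "L = (\<chi> i. coord $ i - lin a * cst (e $ i))"
  define \<Phi> where "\<Phi> F = eval3 cst F L" for F
  have h: "unital_hom \<Phi>" unfolding \<Phi>_def by (rule hom_eval3[OF hom_cst])
  have "lin a dvd eval3 cst F coord - eval3 cst F L" for F
    using eval3_congruence(2)[OF hom_cst, of UNIV "{f. lin a dvd f}" coord L F]
    by (simp add: L_def del: mult_pCons_right)
  then have c: "lin a dvd F - \<Phi> F" for F by (simp add: \<Phi>_def eval3_cst_coord)
  have v: "value_at (\<Phi> F) p = value_at F (p - dotp a p *s e)" for F p
  proof -
    have "(\<chi> i. value_at (L $ i) p) = p - dotp a p *s e"
      by (simp add: L_def vec_eq_iff hom_diff[OF hom_eval3[OF hom_id]] hom_mult[OF hom_eval3[OF hom_id]]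
          eval3_coord[OF hom_id] eval3_cst[OF hom_id] value_lin vector_scalar_mult_def del: mult_pCons_right)
    then show ?thesis unfolding \<Phi>_def eval3_subst[OF hom_id] by simp
  qed
  have d: "dotp a (p - dotp a p *s e) = 0" for p
    using e by (simp add: dotp_diff dotp_scale)
  have 1: "\<Phi> F = 0 \<longleftrightarrow> (\<forall>p. dotp a p = 0 \<longrightarrow> value_at F p = 0)" for F
  proof
    assume "\<Phi> F = 0"
    then show "\<forall>p. dotp a p = 0 \<longrightarrow> value_at F p = 0"
      using v[of F] by (metis diff_zero hom_zero[OF hom_eval3[OF hom_id]] vector_smult_lzero)
  next
    assume "\<forall>p. dotp a p = 0 \<longrightarrow> value_at F p = 0"
    then show "\<Phi> F = 0" using v d by (intro cpoly3_eq_0I) simp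
  qed
  have 2: "lin a dvd F \<longleftrightarrow> \<Phi> F = 0" for F
  proof
    assume "lin a dvd F"
    then obtain k where "F = lin a * k" ..
    then have "value_at F p = 0" if "dotp a p = 0" for p
      using that by (simp add: hom_mult[OF hom_eval3[OF hom_id]] value_lin)
    then show "\<Phi> F = 0" using 1 by blast
  qed (use c[of F] in auto)
  show ?thesis using that h 1 2 by blast
qed

lemma lin_dvd_iff:
  assumes "a \<noteq> 0"
  shows "lin a dvd F \<longleftrightarrow> (\<forall>p. dotp a p = 0 \<longrightarrow> value_at F p = 0)"
  by (rule lin_dvd_kernel[OF assms]) blast

lemma lin_prime:
  assumes "a \<noteq> 0" shows "prime_elem (lin a)"
proof (rule lin_dvd_kernel[OF assms])
  fix \<Phi> :: "cpoly3 \<Rightarrow> cpoly3"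
  assume h: "unital_hom \<Phi>" and d: "\<And>F. lin a dvd F \<longleftrightarrow> \<Phi> F = 0"
  show ?thesis
    using assms by (auto simp: prime_elem_def d lin_eq_0_iff hom_mult[OF h] hom_one[OF h])
qed

lemma lin_dvd_lin_iff:
  assumes "a \<noteq> 0" "b \<noteq> 0" shows "lin a dvd lin b \<longleftrightarrow> \<not> independent2 a b"
proof
  assume "lin a dvd lin b"
  then have "dotp b p = 0" if "dotp a p = 0" for p using that assms by (simp add: lin_dvd_iff value_lin)
  then show "\<not> independent2 a b" by (metis independent2_separating zero_neq_one)
next
  assume "\<not> independent2 a b"
  then have c: "b $ i * a $ j = a $ i * b $ j" for i j
    using exhaust_3[of i] exhaust_3[of j]
    by (auto simp: independent2_def vec3_eq_iff algebra_simps)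
  obtain i where i: "a $ i \<noteq> 0" using assms by (auto simp: vec_eq_iff)
  have "a $ i * dotp b p = b $ i * dotp a p" for p
    using c[of i] by (simp add: dotp_def sum_distrib_left mult.assoc[symmetric])
  then show "lin a dvd lin b" using i assms by (simp add: lin_dvd_iff value_lin) (metis mult_eq_0_iff)
qed

lemma value_simps:
  "value_at (F + G) p = value_at F p + value_at G p"
  "value_at (F * G) p = value_at F p * value_at G p"
  "value_at (F - G) p = value_at F p - value_at G p"
  "value_at (- F) p = - value_at F p"
  "value_at (F ^ n) p = value_at F p ^ n"
  "value_at 0 p = 0" "value_at 1 p = 1" "value_at (cst c) p = c" "value_at (coord $ i) p = p $ i"
  by (simp_all only: hom_simps[OF hom_eval3[OF hom_id]] eval3_cst[OF hom_id] eval3_coord[OF hom_id])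

lemma line_nonempty: assumes "a \<noteq> (0 :: complex ^ 3)" obtains p where "p \<noteq> 0" "dotp a p = 0"
proof -
  have "crossp a (axis 1 1) \<noteq> 0 \<or> crossp a (axis 2 1) \<noteq> 0"
    using assms by (simp add: vec3_eq_iff axis_def) blast
  moreover have "dotp a (crossp a u) = 0" for u by (rule dotp_crossp)
  ultimately show ?thesis using that by blast
qed

lemma lin_dvd_form_iff:
  assumes a: "a \<noteq> 0" and F: "homogeneous n F"
  shows "lin a dvd F \<longleftrightarrow> (\<forall>p. p \<noteq> 0 \<and> dotp a p = 0 \<longrightarrow> value_at F p = 0)"
proof -
  have "value_at F 0 = 0" if *: "\<forall>p. p \<noteq> 0 \<and> dotp a p = 0 \<longrightarrow> value_at F p = 0"
  proof -
    obtain p where "p \<noteq> 0" "dotp a p = 0" using line_nonempty[OF a] .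
    then have "value_at F p = 0" using * by blast
    then have "value_at F (0 *s p) = 0" unfolding eval3_scale[OF hom_id F] by simp
    then show ?thesis by (simp only: vector_smult_lzero)
  qed
  then show ?thesis unfolding lin_dvd_iff[OF a] by metis
qed

text \<open>
  A reduced fraction is regular at \<open>q\<close> unless such a prime divides its denominator; all proofs of regularity consist in
  excluding this prime.
\<close>

lemma vanishing_prime_factor:
  assumes "F \<noteq> 0" "value_at F q = 0"
  obtains \<pi> where "prime_elem \<pi>" "\<pi> dvd F" "value_at \<pi> q = 0"
proof -
  have "F \<noteq> 0 \<Longrightarrow> value_at F q = 0 \<Longrightarrow> \<exists>\<pi>. prime_elem \<pi> \<and> \<pi> dvd F \<and> value_at \<pi> q = 0"
  proof (induction F rule: prime_divisors_induct)
    case (factor \<pi> F)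
    then show ?case by (metis dvd_def dvd_mult dvd_triv_left mult_eq_0_iff prime_imp_prime_elem value_simps(2))
  next
    case (unit F)
    then obtain G where "F * G = 1" by (metis dvdE)
    then show ?case using unit value_simps(2,7) by (metis mult_zero_left zero_neq_one)
  qed simp
  then show ?thesis using assms that by blast
qed

section \<open>Kummer extensions\<close>

text \<open>
  The independence of the powers of \<open>\<theta>\<close> expresses that the degree is \<open>d\<close>; the whole theory then only uses the
  coefficients of the expansions, called components of weight \<open>i\<close> when multiplied by \<open>\<theta>\<^sup>i\<close>.
\<close>

locale kummer_extension =
  fixes L :: "'a::field set" and \<theta> \<zeta> :: 'a and d :: nat
  assumes one_L: "1 \<in> L"
    and diff_L: "f \<in> L \<Longrightarrow> g \<in> L \<Longrightarrow> f - g \<in> L"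
    and mult_L: "f \<in> L \<Longrightarrow> g \<in> L \<Longrightarrow> f * g \<in> L"
    and inverse_L: "f \<in> L \<Longrightarrow> inverse f \<in> L"
    and d_ge_2: "d \<ge> 2" and d_nz: "(of_nat d :: 'a) \<noteq> 0"
    and \<theta>_nz: "\<theta> \<noteq> 0" and \<theta>_power: "\<theta> ^ d \<in> L"
    and \<zeta>_L: "\<zeta> \<in> L" and \<zeta>_power: "\<zeta> ^ d = 1"
    and \<zeta>_primitive: "0 < i \<Longrightarrow> i < d \<Longrightarrow> \<zeta> ^ i \<noteq> 1"
    and independent: "(\<And>i. i < d \<Longrightarrow> c i \<in> L) \<Longrightarrow> (\<Sum>i<d. c i * \<theta> ^ i) = 0 \<Longrightarrow> i < d \<Longrightarrow> c i = 0"
begin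

lemma zero_L: "0 \<in> L" using diff_L[OF one_L one_L] by simp

lemma minus_L: "f \<in> L \<Longrightarrow> - f \<in> L" using diff_L[OF zero_L] by fastforce

lemma add_L: "f \<in> L \<Longrightarrow> g \<in> L \<Longrightarrow> f + g \<in> L"
  using diff_L[of f "- g"] minus_L by simp

lemma power_L: "f \<in> L \<Longrightarrow> f ^ n \<in> L"
  by (induction n) (simp_all add: one_L mult_L)

lemma \<zeta>_nz: "\<zeta> \<noteq> 0"
  using \<zeta>_power d_ge_2 by (metis one_neq_zero power_0_left not_numeral_le_zero)

text \<open>
  The elements with an expansion in powers of \<open>\<theta>\<close>. They are kept apart from the whole field, as
  the fact that they form a field is used in proving that they are everything.
\<close>

definition M :: "'a set" where
  "M = {\<Sum>i<d. c i * \<theta> ^ i | c. \<forall>i<d. c i \<in> L}"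

definition cf :: "'a \<Rightarrow> nat \<Rightarrow> 'a" where
  "cf f = (SOME c. (\<forall>i<d. c i \<in> L) \<and> f = (\<Sum>i<d. c i * \<theta> ^ i))"

lemma cf:
  assumes "f \<in> M"
  shows cf_L: "i < d \<Longrightarrow> cf f i \<in> L" and cf_expand: "f = (\<Sum>i<d. cf f i * \<theta> ^ i)"
proof -
  have "\<exists>c. (\<forall>i<d. c i \<in> L) \<and> f = (\<Sum>i<d. c i * \<theta> ^ i)"
    using assms by (auto simp: M_def)
  from someI_ex[OF this] show "i < d \<Longrightarrow> cf f i \<in> L" "f = (\<Sum>i<d. cf f i * \<theta> ^ i)"
    unfolding cf_def by blast+
qed

lemma M_I: "(\<And>i. i < d \<Longrightarrow> c i \<in> L) \<Longrightarrow> (\<Sum>i<d. c i * \<theta> ^ i) \<in> M"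
  by (auto simp: M_def)

lemma cf_eqI:
  assumes c: "\<And>i. i < d \<Longrightarrow> c i \<in> L" and f: "f = (\<Sum>i<d. c i * \<theta> ^ i)" and i: "i < d"
  shows "cf f i = c i"
proof -
  have M: "f \<in> M" using c f M_I by blast
  have "(\<Sum>i<d. (cf f i - c i) * \<theta> ^ i) = 0"
    using cf_expand[OF M] f by (simp add: left_diff_distrib sum_subtractf)
  then have "cf f i - c i = 0"
    using independent[of "\<lambda>i. cf f i - c i"] c cf_L[OF M] diff_L i by blast
  then show ?thesis by simp
qed

lemma M_add: assumes "f \<in> M" "g \<in> M"
  shows "f + g \<in> M" and cf_add: "i < d \<Longrightarrow> cf (f + g) i = cf f i + cf g i"
proof -
  have *: "f + g = (\<Sum>i<d. (cf f i + cf g i) * \<theta> ^ i)"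
    using cf_expand[OF assms(1)] cf_expand[OF assms(2)] by (simp add: distrib_right sum.distrib)
  have c: "cf f i + cf g i \<in> L" if "i < d" for i using that assms cf_L add_L by blast
  show "f + g \<in> M" unfolding * by (rule M_I) (rule c)
  show "i < d \<Longrightarrow> cf (f + g) i = cf f i + cf g i" by (rule cf_eqI[OF c *])
qed

lemma M_scale: assumes "c \<in> L" "f \<in> M"
  shows "c * f \<in> M" and cf_scale: "i < d \<Longrightarrow> cf (c * f) i = c * cf f i"
proof -
  have "c * (\<Sum>i<d. cf f i * \<theta> ^ i) = (\<Sum>i<d. (c * cf f i) * \<theta> ^ i)"
    by (simp add: sum_distrib_left mult.assoc)
  then have *: "c * f = (\<Sum>i<d. (c * cf f i) * \<theta> ^ i)"
    using cf_expand[OF assms(2)] by simp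
  have c: "c * cf f i \<in> L" if "i < d" for i using that assms cf_L mult_L by blast
  show "c * f \<in> M" unfolding * by (rule M_I) (rule c)
  show "i < d \<Longrightarrow> cf (c * f) i = c * cf f i" by (rule cf_eqI[OF c *])
qed

lemma M_power: assumes "c \<in> L"
  shows "c * \<theta> ^ n \<in> M"
    and cf_power: "i < d \<Longrightarrow> cf (c * \<theta> ^ n) i = (if i = n mod d then c * (\<theta> ^ d) ^ (n div d) else 0)"
proof -
  let ?c = "\<lambda>i. if i = n mod d then c * (\<theta> ^ d) ^ (n div d) else 0"
  have c: "?c i \<in> L" for i using assms mult_L power_L \<theta>_power zero_L by simp
  have "(\<Sum>i<d. ?c i * \<theta> ^ i) = c * (\<theta> ^ d) ^ (n div d) * \<theta> ^ (n mod d)"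
    using d_ge_2 by (simp add: if_distrib[of "\<lambda>x. x * _"] cong: if_cong)
  also have "\<dots> = c * \<theta> ^ n"
    by (simp add: mult.assoc flip: power_mult power_add)
  finally have *: "c * \<theta> ^ n = (\<Sum>i<d. ?c i * \<theta> ^ i)" ..
  show "c * \<theta> ^ n \<in> M" unfolding * by (rule M_I) (rule c)
  show "i < d \<Longrightarrow> cf (c * \<theta> ^ n) i = ?c i" by (rule cf_eqI[OF c *])
qed

lemma L_M: assumes "c \<in> L" shows "c \<in> M" and cf_const: "i < d \<Longrightarrow> cf c i = (if i = 0 then c else 0)"
  using M_power[OF assms, of 0] cf_power[OF assms, of i 0] d_ge_2 by auto

lemma M_sum: assumes "\<And>x. x \<in> A \<Longrightarrow> f x \<in> M"
  shows "sum f A \<in> M" and cf_sum: "i < d \<Longrightarrow> cf (sum f A) i = (\<Sum>x\<in>A. cf (f x) i)"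
  using assms
  by (induction A rule: infinite_finite_induct) (simp_all add: L_M zero_L cf_const M_add cf_add)

lemma M_mult: assumes "f \<in> M" "g \<in> M"
  shows "f * g \<in> M"
    and mult_expand: "f * g = (\<Sum>i<d. \<Sum>j<d. (cf f i * cf g j) * \<theta> ^ (i + j))"
proof -
  have "f * g = (\<Sum>i<d. cf f i * \<theta> ^ i) * (\<Sum>j<d. cf g j * \<theta> ^ j)"
    using cf_expand assms by simp
  then show *: "f * g = (\<Sum>i<d. \<Sum>j<d. (cf f i * cf g j) * \<theta> ^ (i + j))"
    by (simp add: sum_product power_add mult_ac)
  show "f * g \<in> M" unfolding * using assms cf_L mult_L by (intro M_sum M_power) auto
qed

lemma \<theta>_M: "\<theta> \<in> M" using M_power[OF one_L, of 1] by simp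

text \<open>
  The automorphism multiplying \<open>\<theta>\<close> by \<open>\<zeta>\<close>. It is multiplicative because \<open>\<zeta> \<theta>\<close> has the same
  power \<open>\<theta>\<^sup>d\<close>, so that \<open>\<theta>\<^sup>n\<close> goes to \<open>\<zeta>\<^sup>n \<theta>\<^sup>n\<close> even when \<open>n \<ge> d\<close>.
\<close>

definition \<sigma> :: "'a \<Rightarrow> 'a" where "\<sigma> f = (\<Sum>i<d. (\<zeta> ^ i * cf f i) * \<theta> ^ i)"

lemma \<sigma>_M: assumes "f \<in> M"
  shows "\<sigma> f \<in> M" and cf_\<sigma>: "i < d \<Longrightarrow> cf (\<sigma> f) i = \<zeta> ^ i * cf f i"
proof -
  have c: "\<zeta> ^ i * cf f i \<in> L" if "i < d" for i using that assms cf_L mult_L power_L \<zeta>_L by blast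
  show "\<sigma> f \<in> M" unfolding \<sigma>_def by (rule M_I) (rule c)
  show "i < d \<Longrightarrow> cf (\<sigma> f) i = \<zeta> ^ i * cf f i" by (rule cf_eqI[OF c \<sigma>_def])
qed

lemma M_eqI: "f \<in> M \<Longrightarrow> g \<in> M \<Longrightarrow> (\<And>i. i < d \<Longrightarrow> cf f i = cf g i) \<Longrightarrow> f = g"
  using cf_expand[of f] cf_expand[of g] by (metis (mono_tags, lifting) lessThan_iff sum.cong)

lemma \<sigma>_add: "f \<in> M \<Longrightarrow> g \<in> M \<Longrightarrow> \<sigma> (f + g) = \<sigma> f + \<sigma> g"
  by (rule M_eqI) (simp_all add: \<sigma>_M M_add cf_\<sigma> cf_add distrib_left)

lemma \<sigma>_const: "c \<in> L \<Longrightarrow> \<sigma> c = c"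
  by (rule M_eqI) (simp_all add: \<sigma>_M L_M cf_\<sigma> cf_const)

lemma \<sigma>_sum: "(\<And>x. x \<in> A \<Longrightarrow> f x \<in> M) \<Longrightarrow> \<sigma> (sum f A) = (\<Sum>x\<in>A. \<sigma> (f x))"
  by (induction A rule: infinite_finite_induct)
     (simp_all add: \<sigma>_const zero_L \<sigma>_add M_sum)

lemma \<sigma>_power: "c \<in> L \<Longrightarrow> \<sigma> (c * \<theta> ^ n) = (c * \<zeta> ^ n) * \<theta> ^ n"
proof (rule M_eqI)
  fix i assume c: "c \<in> L" and i: "i < d"
  have "\<zeta> ^ n = \<zeta> ^ (n mod d)"
    using power_add[of \<zeta> "d * (n div d)" "n mod d"] by (simp add: power_mult \<zeta>_power)
  then show "cf (\<sigma> (c * \<theta> ^ n)) i = cf ((c * \<zeta> ^ n) * \<theta> ^ n) i"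
    using c i by (simp add: cf_\<sigma> M_power cf_power mult_L power_L \<zeta>_L)
qed (simp_all add: \<sigma>_M M_power mult_L power_L \<zeta>_L)

lemma \<sigma>_mult: assumes "f \<in> M" "g \<in> M" shows "\<sigma> (f * g) = \<sigma> f * \<sigma> g"
proof -
  have c: "cf f i * cf g j \<in> L" if "i < d" "j < d" for i j using that assms cf_L mult_L by blast
  have "\<sigma> (f * g) = (\<Sum>i<d. \<sigma> (\<Sum>j<d. (cf f i * cf g j) * \<theta> ^ (i + j)))"
    unfolding mult_expand[OF assms] by (rule \<sigma>_sum) (use c in \<open>auto intro!: M_sum M_power\<close>)
  also have "\<dots> = (\<Sum>i<d. \<Sum>j<d. \<sigma> ((cf f i * cf g j) * \<theta> ^ (i + j)))"
    by (intro sum.cong refl \<sigma>_sum) (use c in \<open>auto intro!: M_power\<close>)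
  also have "\<dots> = (\<Sum>i<d. \<Sum>j<d. (cf f i * cf g j * \<zeta> ^ (i + j)) * \<theta> ^ (i + j))"
    by (intro sum.cong refl \<sigma>_power) (use c in auto)
  also have "\<dots> = (\<Sum>i<d. (\<zeta> ^ i * cf f i) * \<theta> ^ i) * (\<Sum>j<d. (\<zeta> ^ j * cf g j) * \<theta> ^ j)"
    by (simp add: sum_product power_add mult_ac)
  finally show ?thesis by (simp add: \<sigma>_def)
qed

lemma iterate_\<sigma>_M: assumes "f \<in> M"
  shows "(\<sigma> ^^ k) f \<in> M" and cf_iterate_\<sigma>: "i < d \<Longrightarrow> cf ((\<sigma> ^^ k) f) i = \<zeta> ^ (i * k) * cf f i"
  by (induction k) (simp_all add: assms \<sigma>_M cf_\<sigma> power_add)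

lemma iterate_\<sigma>_period: "f \<in> M \<Longrightarrow> (\<sigma> ^^ d) f = f"
  by (rule M_eqI) (simp_all add: iterate_\<sigma>_M cf_iterate_\<sigma> mult.commute[of _ d] power_mult \<zeta>_power)

lemma \<sigma>_eq_0: "f \<in> M \<Longrightarrow> \<sigma> f = 0 \<Longrightarrow> f = 0"
  by (rule M_eqI) (use cf_\<sigma>[of f] \<zeta>_nz in \<open>auto simp: L_M zero_L cf_const\<close>)

lemma \<sigma>_fixed: assumes "f \<in> M" "\<sigma> f = f" shows "f \<in> L"
proof -
  have "cf f i = 0" if "0 < i" "i < d" for i
  proof -
    have "(\<zeta> ^ i - 1) * cf f i = 0"
      using cf_\<sigma>[OF assms(1) that(2)] assms(2) by (simp add: algebra_simps)
    then show ?thesis using \<zeta>_primitive that by auto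
  qed
  then have "(\<Sum>i<d. cf f i * \<theta> ^ i) = (\<Sum>i<d. if i = 0 then cf f 0 else 0)"
    by (intro sum.cong) auto
  then have "f = cf f 0"
    using cf_expand[OF assms(1)] d_ge_2 by simp
  then show ?thesis using cf_L[OF assms(1), of 0] d_ge_2 by simp
qed

text \<open>The product of the conjugates other than \<open>f\<close> itself, the cofactor of \<open>f\<close> in its norm.\<close>

definition conj_prod :: "'a \<Rightarrow> 'a" where "conj_prod f = (\<Prod>k\<in>{1..<d}. (\<sigma> ^^ k) f)"

lemma M_prod: "(\<And>x. x \<in> A \<Longrightarrow> f x \<in> M) \<Longrightarrow> prod f A \<in> M"
  and \<sigma>_prod: "(\<And>x. x \<in> A \<Longrightarrow> f x \<in> M) \<Longrightarrow> \<sigma> (prod f A) = (\<Prod>x\<in>A. \<sigma> (f x))"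
  by (induction A rule: infinite_finite_induct)
     (simp_all add: L_M one_L M_mult(1) \<sigma>_const \<sigma>_mult)

lemma conj_prod_M: "f \<in> M \<Longrightarrow> conj_prod f \<in> M"
  unfolding conj_prod_def by (intro M_prod iterate_\<sigma>_M)

lemma norm_L: assumes "f \<in> M" shows "f * conj_prod f \<in> L"
proof (rule \<sigma>_fixed)
  have n: "f * conj_prod f = (\<Prod>k<d. (\<sigma> ^^ k) f)"
  proof -
    have "{..<d} = insert 0 {1..<d}" using d_ge_2 by auto
    then show ?thesis by (simp add: conj_prod_def)
  qed
  show "f * conj_prod f \<in> M" using assms conj_prod_M M_mult by blast
  have "\<sigma> (\<Prod>k<d. (\<sigma> ^^ k) f) = (\<Prod>k<d. (\<sigma> ^^ Suc k) f)"
    by (simp add: \<sigma>_prod iterate_\<sigma>_M assms)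
  also have "\<dots> * f = (\<Prod>k<Suc d. (\<sigma> ^^ k) f)"
    by (subst prod.lessThan_Suc_shift) (simp add: mult.commute)
  also have "\<dots> = (\<Prod>k<d. (\<sigma> ^^ k) f) * f"
    by (simp add: iterate_\<sigma>_period[OF assms, simplified])
  finally show "\<sigma> (f * conj_prod f) = f * conj_prod f"
    by (cases "f = 0") (simp_all add: \<sigma>_const zero_L n)
qed

lemma iterate_\<sigma>_eq_0: "f \<in> M \<Longrightarrow> (\<sigma> ^^ k) f = 0 \<Longrightarrow> f = 0"
  by (induction k) (auto dest: \<sigma>_eq_0[rotated] simp: iterate_\<sigma>_M)

lemma conj_prod_nz: "f \<in> M \<Longrightarrow> f \<noteq> 0 \<Longrightarrow> conj_prod f \<noteq> 0"
  unfolding conj_prod_def using iterate_\<sigma>_eq_0 by auto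

text \<open>An inverse is the cofactor divided by the norm.\<close>

lemma M_inverse: assumes "f \<in> M" shows "inverse f \<in> M"
proof (cases "f = 0")
  case False
  then have "inverse f = inverse (f * conj_prod f) * conj_prod f"
    using conj_prod_nz[OF assms] by (simp add: field_simps)
  then show ?thesis using M_scale(1) inverse_L norm_L conj_prod_M assms by metis
qed (simp add: L_M zero_L)

text \<open>
  The weight components of an element are averages of its conjugates, so that they inherit what is
  stable under the Galois group.
\<close>

lemma weight_component:
  assumes f: "f \<in> M" and i: "i < d"
  shows "cf f i * \<theta> ^ i = inverse (of_nat d) * (\<Sum>k<d. \<zeta> ^ ((d - i) * k) * (\<sigma> ^^ k) f)"
proof -
  have gp: "(\<Sum>k<d. \<zeta> ^ (m * k)) = (if d dvd m then of_nat d else 0)" for m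
  proof -
    have "\<zeta> ^ m = \<zeta> ^ (m mod d)"
      using power_add[of \<zeta> "d * (m div d)" "m mod d"] by (simp add: power_mult \<zeta>_power)
    then have "\<not> d dvd m \<Longrightarrow> \<zeta> ^ m \<noteq> 1"
      using \<zeta>_primitive[of "m mod d"] d_ge_2 by (simp add: dvd_eq_mod_eq_0)
    moreover have "(1 - \<zeta> ^ m) * (\<Sum>k<d. (\<zeta> ^ m) ^ k) = 0"
      unfolding one_diff_power_eq[symmetric] by (simp add: \<zeta>_power mult.commute[of m] flip: power_mult) (simp add: power_mult \<zeta>_power)
    moreover have "d dvd m \<Longrightarrow> \<zeta> ^ m = 1" by (auto simp: power_mult \<zeta>_power)
    ultimately show ?thesis by (auto simp: power_mult)
  qed
  have dvd: "d dvd (d - i + j) \<longleftrightarrow> j = i" if "j < d" for j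
  proof
    assume "d dvd d - i + j"
    then obtain q where q: "d - i + j = d * q" ..
    have "0 < d - i + j" "d - i + j < 2 * d" using i that by auto
    then have "q = 1" using q by (cases q) (auto simp: less_Suc_eq numeral_2_eq_2)
    then show "j = i" using q i by simp
  qed (use i in simp)
  have "(\<sigma> ^^ k) f = (\<Sum>j<d. (\<zeta> ^ (j * k) * cf f j) * \<theta> ^ j)" for k
    using cf_expand[OF iterate_\<sigma>_M(1)[OF f, of k]] by (simp add: cf_iterate_\<sigma> f)
  then have "(\<Sum>k<d. \<zeta> ^ ((d - i) * k) * (\<sigma> ^^ k) f) = (\<Sum>k<d. \<Sum>j<d. \<zeta> ^ ((d - i + j) * k) * (cf f j * \<theta> ^ j))"
    by (simp add: sum_distrib_left power_add algebra_simps)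
  also have "\<dots> = (\<Sum>j<d. (\<Sum>k<d. \<zeta> ^ ((d - i + j) * k)) * (cf f j * \<theta> ^ j))"
    by (subst sum.swap) (simp add: sum_distrib_right)
  also have "\<dots> = (\<Sum>j<d. if j = i then of_nat d * (cf f i * \<theta> ^ i) else 0)"
    by (intro sum.cong) (auto simp: gp dvd)
  finally show ?thesis using i d_nz by simp
qed

text \<open>The single automorphism \<open>\<sigma>\<close> already has the fixed field \<open>L\<close>.\<close>

lemma galois:
  assumes UNIV: "M = UNIV" shows "galois_extension L"
  unfolding galois_extension_def
proof
  have U: "f \<in> M" for f using UNIV by simp
  let ?B = "(\<lambda>i. \<theta> ^ i) ` {..<d}"
  have inj: "inj_on (\<lambda>i. \<theta> ^ i) {..<d}"
  proof (rule inj_onI)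
    fix i j assume ij: "i \<in> {..<d}" "j \<in> {..<d}" "\<theta> ^ i = \<theta> ^ j"
    have "cf (1 * \<theta> ^ i) i = cf (1 * \<theta> ^ j) i" using ij by simp
    moreover have "cf (1 * \<theta> ^ i) i = 1" "cf (1 * \<theta> ^ j) i = (if i = j then 1 else 0)"
      using ij(1,2) cf_power[OF one_L, of i i] cf_power[OF one_L, of i j] by simp_all
    ultimately show "i = j" by (metis zero_neq_one)
  qed
  have "\<exists>c. f = (\<Sum>b\<in>?B. c b * b) \<and> c ` ?B \<subseteq> L" for f
  proof (intro exI conjI)
    let ?c = "\<lambda>b. cf f (the_inv_into {..<d} (\<lambda>i. \<theta> ^ i) b)"
    show "f = (\<Sum>b\<in>?B. ?c b * b)"
      using cf_expand[OF U, of f] by (simp add: sum.reindex[OF inj] the_inv_into_f_f[OF inj])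
    show "?c ` ?B \<subseteq> L" using cf_L[OF U] by (auto simp: the_inv_into_f_f[OF inj])
  qed
  then show "finite_module L UNIV"
    unfolding finite_module_def by (intro exI[of _ ?B]) auto
  have "bij \<sigma>"
  proof (rule bijI)
    show "inj \<sigma>" by (rule injI) (metis M_eqI U cf_\<sigma> mult_cancel_left power_not_zero \<zeta>_nz)
    have "f = \<sigma> ((\<sigma> ^^ (d - 1)) f)" for f
      using iterate_\<sigma>_period[OF U, of f] d_ge_2 by (cases d) simp_all
    then show "surj \<sigma>" by (metis surjI)
  qed
  then have "\<sigma> \<in> field_automorphisms L"
    by (simp add: field_automorphisms_def \<sigma>_add \<sigma>_mult \<sigma>_const U)
  then show "{f. \<forall>\<tau>\<in>field_automorphisms L. \<tau> f = f} = L"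
    using \<sigma>_fixed[OF U] by (auto simp: field_automorphisms_def)
qed

end

section \<open>Local rings of the plane in its function field\<close>

lemma const_ratfun_hom: "unital_hom const_ratfun"
  by (simp add: unital_hom_def const_ratfun_def One_fract_def one_pCons add_fract mult_fract)

lemma const_ratfun_eq_0 [simp]: "const_ratfun c = 0 \<longleftrightarrow> c = 0"
  by (simp add: const_ratfun_def Zero_fract_def eq_fract)

lemmas const_ratfun_simps = hom_simps[OF const_ratfun_hom]

lemma cramer:
  fixes a b c l :: "'a::comm_ring_1 ^ 3"
  shows "dotp (crossp a b) l *s c =
    dotp (crossp c b) l *s a + dotp (crossp a c) l *s b + dotp (crossp a b) c *s l"
  by (simp add: vec3_simps algebra_simps)

lemma covector_combination:
  fixes a b c q :: "'a::field ^ 3"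
  assumes ab: "independent2 a b" and 0: "dotp a q = 0" "dotp b q = 0" "dotp c q = 0" and q: "q \<noteq> 0"
  obtains x y where "c = x *s a + y *s b"
proof -
  obtain k where k: "q = k *s crossp a b" using common_zero[OF ab 0(1,2)] .
  then have "k \<noteq> 0" using q by (auto simp: vec3_simps)
  then have c: "dotp (crossp a b) c = 0" using 0(3) k by (simp add: dotp_scale dotp_commute)
  obtain l where l: "dotp (crossp a b) l = 1" using dotp_eq_1 ab unfolding independent2_def by blast
  have "c = dotp (crossp c b) l *s a + dotp (crossp a c) l *s b"
    using cramer[of a b l c] unfolding c l by (simp add: vec3_simps)
  then show ?thesis using that by blast
qed

lemma subring_closed:
  assumes "is_subring A"
  shows "1 \<in> A" "0 \<in> A" "f \<in> A \<Longrightarrow> g \<in> A \<Longrightarrow> f - g \<in> A" "f \<in> A \<Longrightarrow> g \<in> A \<Longrightarrow> f * g \<in> A"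
    "f \<in> A \<Longrightarrow> - f \<in> A" "f \<in> A \<Longrightarrow> g \<in> A \<Longrightarrow> f + g \<in> A" "f \<in> A \<Longrightarrow> f ^ n \<in> A"
proof -
  show 1: "1 \<in> A" and d: "\<And>f g. f \<in> A \<Longrightarrow> g \<in> A \<Longrightarrow> f - g \<in> A"
    and m: "\<And>f g. f \<in> A \<Longrightarrow> g \<in> A \<Longrightarrow> f * g \<in> A"
    using assms by (auto simp: is_subring_def)
  show 0: "0 \<in> A" using d[OF 1 1] by simp
  show n: "- f \<in> A" if "f \<in> A" for f using d[OF 0 that] by simp
  show "f \<in> A \<Longrightarrow> g \<in> A \<Longrightarrow> f + g \<in> A" using d[of f "- g"] n by simp
  show "f \<in> A \<Longrightarrow> f ^ n \<in> A" by (induction n) (simp_all add: 1 m)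
qed

lemma subring_sum: "is_subring A \<Longrightarrow> (\<And>x. x \<in> X \<Longrightarrow> f x \<in> A) \<Longrightarrow> sum f X \<in> A"
  by (induction X rule: infinite_finite_induct) (simp_all add: subring_closed)

lemma subring_prod: "is_subring A \<Longrightarrow> (\<And>x. x \<in> X \<Longrightarrow> f x \<in> A) \<Longrightarrow> prod f X \<in> A"
  by (induction X rule: infinite_finite_induct) (simp_all add: subring_closed)

lemma ideal_closed:
  assumes "is_ideal A J"
  shows "0 \<in> J" "f \<in> J \<Longrightarrow> f \<in> A" "f \<in> J \<Longrightarrow> g \<in> J \<Longrightarrow> f + g \<in> J" "a \<in> A \<Longrightarrow> f \<in> J \<Longrightarrow> a * f \<in> J"
    "f \<in> J \<Longrightarrow> a \<in> A \<Longrightarrow> f * a \<in> J"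
  using assms by (auto simp: is_ideal_def mult.commute)

lemma ideal_sum: "is_ideal A J \<Longrightarrow> (\<And>x. x \<in> X \<Longrightarrow> f x \<in> J) \<Longrightarrow> sum f X \<in> J"
  by (induction X rule: infinite_finite_induct) (simp_all add: ideal_closed)

lemma is_ideal_gen2:
  assumes R: "is_subring R" and st: "s \<in> R" "t \<in> R"
  shows "is_ideal R {\<alpha> * s + \<beta> * t | \<alpha> \<beta>. \<alpha> \<in> R \<and> \<beta> \<in> R}" (is "is_ideal R ?I")
  unfolding is_ideal_def
proof (intro conjI ballI)
  note c = subring_closed[OF R]
  show "?I \<subseteq> R" using st by (auto intro!: c)
  show "0 \<in> ?I" using c(2) by force
  fix f assume "f \<in> ?I"
  then obtain \<alpha> \<beta> where f: "f = \<alpha> * s + \<beta> * t" "\<alpha> \<in> R" "\<beta> \<in> R" by blast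
  show "f + g \<in> ?I" if "g \<in> ?I" for g
  proof -
    from that obtain \<alpha>' \<beta>' where g: "g = \<alpha>' * s + \<beta>' * t" "\<alpha>' \<in> R" "\<beta>' \<in> R" by blast
    have "f + g = (\<alpha> + \<alpha>') * s + (\<beta> + \<beta>') * t" using f g by (simp add: algebra_simps)
    then show ?thesis using f g c(6) by blast
  qed
  show "a * f \<in> ?I" if "a \<in> R" for a
  proof -
    have "a * f = (a * \<alpha>) * s + (a * \<beta>) * t" using f by (simp add: algebra_simps)
    then show ?thesis using f that c(4) by blast
  qed
qed

lemma ideal_gen2:
  assumes R: "is_subring R" and st: "s \<in> R" "t \<in> R"
  shows "ideal_gen R {s, t} = {\<alpha> * s + \<beta> * t | \<alpha> \<beta>. \<alpha> \<in> R \<and> \<beta> \<in> R}" (is "_ = ?I")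
  unfolding ideal_gen_def
proof (rule hull_unique)
  have "s = 1 * s + 0 * t" "t = 0 * s + 1 * t" by simp_all
  then show "{s, t} \<subseteq> ?I" using subring_closed(1,2)[OF R] by blast
  show "is_ideal R ?I" by (rule is_ideal_gen2[OF assms])
  show "?I \<subseteq> J" if "{s, t} \<subseteq> J" "is_ideal R J" for J
    using that ideal_closed[OF that(2)] by auto
qed

lemma ideal_gen1:
  assumes R: "is_subring R" and t: "t \<in> R"
  shows "ideal_gen R {t} = {\<alpha> * t | \<alpha>. \<alpha> \<in> R}"
proof -
  have "ideal_gen R {t, t} = {\<alpha> * t | \<alpha>. \<alpha> \<in> R}"
    unfolding ideal_gen2[OF R t t]
    by (auto simp flip: distrib_right) (use subring_closed[OF R] in \<open>metis add_0 mult_zero_left subring_closed(6)[OF R]\<close>)+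
  then show ?thesis by simp
qed

text \<open>
  A point with coordinates in the function field which lies on no curve: a generic point of the plane, whose
  ratios of coordinates are algebraically independent.
\<close>

locale dominant_point =
  fixes T :: "ratfun ^ 3"
  assumes generic: "homogeneous n G \<Longrightarrow> eval3 const_ratfun G T = 0 \<Longrightarrow> G = 0"
begin

abbreviation ev :: "cpoly3 \<Rightarrow> ratfun" where "ev G \<equiv> eval3 const_ratfun G T"

abbreviation \<O> :: "complex ^ 3 \<Rightarrow> ratfun set" where "\<O> q \<equiv> local_ring_at T q"

abbreviation \<mm> :: "complex ^ 3 \<Rightarrow> ratfun set" where "\<mm> q \<equiv> nonunits (local_ring_at T q)"

abbreviation L :: "ratfun set" where "L \<equiv> ratio_field const_ratfun T"

lemmas ev_simps = hom_simps[OF hom_eval3[OF const_ratfun_hom, of T]]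

lemma ev_eq_0_iff: "homogeneous n G \<Longrightarrow> ev G = 0 \<longleftrightarrow> G = 0"
  using generic ev_simps(2) by metis

lemma ev_eq_iff: "homogeneous n F \<Longrightarrow> homogeneous n G \<Longrightarrow> ev F = ev G \<longleftrightarrow> F = G"
  using ev_eq_0_iff[of n "F - G"] by (simp add: homogeneous_diff ev_simps)

lemma value_nz: "value_at H q \<noteq> 0 \<Longrightarrow> H \<noteq> 0"
  by (auto simp: value_simps)

lemma LI:
  assumes "homogeneous n G" "homogeneous n H" shows "ev G / ev H \<in> L"
proof (cases "ev H = 0")
  case True
  then have "ev G / ev H = ev 0 / ev 1" by (simp add: ev_simps)
  moreover have "ev 1 \<noteq> 0" by (simp add: ev_simps)
  ultimately show ?thesis unfolding ratio_field_def using homogeneous_0 homogeneous_1 by blast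
next
  case False
  then show ?thesis unfolding ratio_field_def using assms by blast
qed

lemma LE:
  assumes "f \<in> L"
  obtains n G H where "homogeneous n G" "homogeneous n H" "H \<noteq> 0" "f = ev G / ev H"
  using assms ev_eq_0_iff unfolding ratio_field_def by blast

lemma \<O>I: "homogeneous n G \<Longrightarrow> homogeneous n H \<Longrightarrow> value_at H q \<noteq> 0 \<Longrightarrow> ev G / ev H \<in> \<O> q"
  unfolding local_ring_at_def using ev_eq_0_iff value_nz by blast

lemma \<O>E:
  assumes "f \<in> \<O> q"
  obtains n G H where "homogeneous n G" "homogeneous n H" "value_at H q \<noteq> 0" "ev H \<noteq> 0" "f = ev G / ev H"
  using assms unfolding local_ring_at_def by blast

lemma \<O>_L: "f \<in> \<O> q \<Longrightarrow> f \<in> L"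
  by (erule \<O>E) (use LI in blast)

lemma const_\<O>: "const_ratfun c \<in> \<O> q"
  using \<O>I[OF homogeneous_cst homogeneous_1, of q c]
  by (simp add: eval3_cst[OF const_ratfun_hom] ev_simps value_simps)

lemma subring_L: "is_subring L"
  unfolding is_subring_def
proof (intro conjI ballI)
  show "1 \<in> L" using LI[OF homogeneous_1 homogeneous_1] by (simp add: ev_simps)
  fix f g assume "f \<in> L" "g \<in> L"
  then obtain n G H m G' H' where f: "homogeneous n G" "homogeneous n H" "H \<noteq> 0" "f = ev G / ev H"
    and g: "homogeneous m G'" "homogeneous m H'" "H' \<noteq> 0" "g = ev G' / ev H'"
    by (metis LE)
  have "ev H \<noteq> 0" "ev H' \<noteq> 0" using f g ev_eq_0_iff by auto
  then have "f - g = ev (G * H' - G' * H) / ev (H * H')" "f * g = ev (G * G') / ev (H * H')"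
    using f g by (simp_all add: ev_simps diff_frac_eq)
  moreover have "homogeneous (n + m) (G' * H)" using f g homogeneous_mult add.commute by metis
  ultimately show "f - g \<in> L" "f * g \<in> L"
    using f g by (auto intro!: LI homogeneous_diff homogeneous_mult)
qed

lemma inverse_L: "f \<in> L \<Longrightarrow> inverse f \<in> L"
  by (erule LE) (simp add: LI)

lemma subring_\<O>: "is_subring (\<O> q)"
  unfolding is_subring_def
proof (intro conjI ballI)
  show "1 \<in> \<O> q" using const_\<O>[of 1] by (simp add: const_ratfun_simps)
  fix f g assume "f \<in> \<O> q" "g \<in> \<O> q"
  then obtain n G H m G' H' where f: "homogeneous n G" "homogeneous n H" "value_at H q \<noteq> 0" "ev H \<noteq> 0" "f = ev G / ev H"
    and g: "homogeneous m G'" "homogeneous m H'" "value_at H' q \<noteq> 0" "ev H' \<noteq> 0" "g = ev G' / ev H'"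
    by (metis \<O>E)
  have "f - g = ev (G * H' - G' * H) / ev (H * H')" "f * g = ev (G * G') / ev (H * H')"
    using f g by (simp_all add: ev_simps diff_frac_eq)
  moreover have "homogeneous (n + m) (G' * H)" using f g homogeneous_mult add.commute by metis
  ultimately show "f - g \<in> \<O> q" "f * g \<in> \<O> q"
    using f g by (auto intro!: \<O>I homogeneous_diff homogeneous_mult simp: value_simps)
qed

lemmas \<O>_closed = subring_closed[OF subring_\<O>]

lemma \<O>_unit_iff:
  assumes f: "homogeneous n G" "homogeneous n H" "value_at H q \<noteq> 0"
  shows "ev G / ev H \<in> \<mm> q \<longleftrightarrow> value_at G q = 0"
proof
  assume 0: "value_at G q = 0"
  have "inverse (ev G / ev H) \<notin> \<O> q" if nz: "ev G / ev H \<noteq> 0"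
  proof
    assume "inverse (ev G / ev H) \<in> \<O> q"
    then obtain m G' H' where g: "homogeneous m G'" "homogeneous m H'" "value_at H' q \<noteq> 0" "ev H' \<noteq> 0"
      "ev H / ev G = ev G' / ev H'" by (auto elim: \<O>E)
    have "ev (H * H') = ev (G * G')" using g nz by (simp add: ev_simps field_simps)
    then have "H * H' = G * G'"
      using f g by (subst (asm) ev_eq_iff[of "n + m"]) (auto intro: homogeneous_mult)
    then have "value_at H q * value_at H' q = 0" using 0 value_simps(2) by (metis mult_zero_left)
    then show False using f g by simp
  qed
  then show "ev G / ev H \<in> \<mm> q" using \<O>I[OF f] by (auto simp: nonunits_def)
next
  assume m: "ev G / ev H \<in> \<mm> q"
  show "value_at G q = 0"
  proof (rule ccontr)
    assume nz: "value_at G q \<noteq> 0"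
    have "inverse (ev G / ev H) \<in> \<O> q" using \<O>I[OF f(2,1) nz] by simp
    moreover have "ev G / ev H \<noteq> 0" using nz f ev_eq_0_iff value_nz by auto
    ultimately show False using m by (auto simp: nonunits_def)
  qed
qed

lemma \<mm>_\<O>: "f \<in> \<mm> q \<Longrightarrow> f \<in> \<O> q"
  by (simp add: nonunits_def)

lemma \<mm>E:
  assumes "f \<in> \<mm> q"
  obtains n G H where "homogeneous n G" "homogeneous n H" "value_at H q \<noteq> 0" "ev H \<noteq> 0" "f = ev G / ev H" "value_at G q = 0"
  using assms by (metis \<O>E \<O>_unit_iff \<mm>_\<O>)

lemma const_\<mm>: "const_ratfun c \<in> \<mm> q \<longleftrightarrow> c = 0"
  using \<O>_unit_iff[OF homogeneous_cst homogeneous_1, of q c]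
  by (simp add: eval3_cst[OF const_ratfun_hom] ev_simps value_simps)

lemma ideal_\<mm>: "is_ideal (\<O> q) (\<mm> q)"
  unfolding is_ideal_def
proof (intro conjI ballI)
  show "\<mm> q \<subseteq> \<O> q" using \<mm>_\<O> by blast
  show "0 \<in> \<mm> q" using const_\<mm>[of 0 q] by (simp add: const_ratfun_simps)
  fix f assume "f \<in> \<mm> q"
  then obtain n G H where f: "homogeneous n G" "homogeneous n H" "value_at H q \<noteq> 0" "ev H \<noteq> 0" "f = ev G / ev H" "value_at G q = 0"
    by (rule \<mm>E)
  show "f + g \<in> \<mm> q" if "g \<in> \<mm> q" for g
  proof -
    from that obtain m G' H' where g: "homogeneous m G'" "homogeneous m H'" "value_at H' q \<noteq> 0" "ev H' \<noteq> 0" "g = ev G' / ev H'" "value_at G' q = 0"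
      by (rule \<mm>E)
    have "f + g = ev (G * H' + G' * H) / ev (H * H')" using f g by (simp add: ev_simps add_frac_eq)
    moreover have "homogeneous (n + m) (G' * H)" using f g homogeneous_mult add.commute by metis
    ultimately show ?thesis
      using f g by (subst \<open>f + g = _\<close>, subst \<O>_unit_iff[of "n + m"]) (auto intro!: homogeneous_add homogeneous_mult simp: value_simps)
  qed
  show "g * f \<in> \<mm> q" if "g \<in> \<O> q" for g
  proof -
    from that obtain m G' H' where g: "homogeneous m G'" "homogeneous m H'" "value_at H' q \<noteq> 0" "ev H' \<noteq> 0" "g = ev G' / ev H'"
      by (rule \<O>E)
    have *: "g * f = ev (G' * G) / ev (H' * H)" using f g by (simp add: ev_simps)
    show ?thesis unfolding *
      using f g by (subst \<O>_unit_iff[of "m + n"]) (auto intro!: homogeneous_mult simp: value_simps)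
  qed
qed

lemmas \<mm>_closed = ideal_closed[OF ideal_\<mm>]

lemma one_\<mm>: "1 \<notin> \<mm> q"
  using const_\<mm>[of 1 q] by (simp add: const_ratfun_simps)

lemma \<O>_inverse: "f \<in> \<O> q \<Longrightarrow> f \<notin> \<mm> q \<Longrightarrow> inverse f \<in> \<O> q"
  by (simp add: nonunits_def)

lemma \<mm>_prime: assumes "f \<in> \<O> q" "g \<in> \<O> q" "f * g \<in> \<mm> q" shows "f \<in> \<mm> q \<or> g \<in> \<mm> q"
proof (rule ccontr)
  assume *: "\<not> (f \<in> \<mm> q \<or> g \<in> \<mm> q)"
  then have "inverse f * inverse g * (f * g) \<in> \<mm> q"
    using assms \<O>_inverse \<O>_closed(4) \<mm>_closed(4) by meson
  moreover have "f \<noteq> 0" "g \<noteq> 0" using * \<mm>_closed(1) by auto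
  ultimately show False using one_\<mm>[of q] by (simp add: field_simps)
qed

lemma residue: assumes "f \<in> \<O> q" obtains c where "f - const_ratfun c \<in> \<mm> q"
proof -
  obtain n G H where f: "homogeneous n G" "homogeneous n H" "value_at H q \<noteq> 0" "ev H \<noteq> 0" "f = ev G / ev H"
    using assms by (rule \<O>E)
  define c where "c = value_at G q / value_at H q"
  have *: "f - const_ratfun c = ev (G - cst c * H) / ev H"
    using f by (simp add: ev_simps eval3_cst[OF const_ratfun_hom] diff_divide_distrib del: mult_pCons_left)
  have "homogeneous n (cst c * H)" using homogeneous_mult[OF homogeneous_cst f(2)] by simp
  then have "f - const_ratfun c \<in> \<mm> q" unfolding *
    using f by (subst \<O>_unit_iff[of n]) (auto intro: homogeneous_diff simp: value_simps c_def simp del: mult_pCons_left)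
  then show ?thesis using that by blast
qed

definition dlin :: "complex ^ 3 \<Rightarrow> ratfun" where "dlin a = ev (lin a)"

lemma dlin_dotp: "dlin a = dotp (vmap const_ratfun a) T"
  by (simp add: dlin_def eval3_lin const_ratfun_hom)

lemma dlin_nz: "a \<noteq> 0 \<Longrightarrow> dlin a \<noteq> 0"
  unfolding dlin_def using ev_eq_0_iff[OF homogeneous_lin] lin_eq_0_iff by blast

lemma dlin_\<O>: "dotp l q \<noteq> 0 \<Longrightarrow> dlin a / dlin l \<in> \<O> q"
  unfolding dlin_def by (rule \<O>I[OF homogeneous_lin homogeneous_lin]) (simp add: value_lin)

lemma dlin_\<mm>: "dotp l q \<noteq> 0 \<Longrightarrow> dlin a / dlin l \<in> \<mm> q \<longleftrightarrow> dotp a q = 0"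
  unfolding dlin_def by (subst \<O>_unit_iff[OF homogeneous_lin homogeneous_lin]) (simp_all add: value_lin)

lemma dlin_L: "dlin a / dlin l \<in> L"
  unfolding dlin_def by (rule LI[OF homogeneous_lin homogeneous_lin])

lemma dotp_nz: "dotp l q \<noteq> 0 \<Longrightarrow> l \<noteq> 0"
  by auto

text \<open>
  Dividing by a power of \<open>l\<close> turns a form into a polynomial in the affine coordinates \<open>T / l\<close>. These are congruent to
  the coordinates of \<open>q\<close> modulo the two functions, so the polynomial is congruent to its value at \<open>q\<close>.
\<close>

lemma \<mm>_generators:
  assumes ab: "independent2 a b" and 0: "dotp a q = 0" "dotp b q = 0" and l: "dotp l q \<noteq> 0"
  shows "\<mm> q = ideal_gen (\<O> q) {dlin a / dlin l, dlin b / dlin l}"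
proof -
  define s t where "s = dlin a / dlin l" and "t = dlin b / dlin l"
  have st: "s \<in> \<O> q" "t \<in> \<O> q" and stm: "s \<in> \<mm> q" "t \<in> \<mm> q"
    using l 0 by (auto simp: s_def t_def dlin_\<O> dlin_\<mm>)
  note I = ideal_gen2[OF subring_\<O> st] is_ideal_gen2[OF subring_\<O> st]
  have I': "is_ideal (\<O> q) (ideal_gen (\<O> q) {s, t})" using I by simp
  note Ic = ideal_closed[OF I']
  have q: "q \<noteq> 0" using l by auto
  have nz: "dlin l \<noteq> 0" using dlin_nz[OF dotp_nz[OF l]] .
  define \<tau> where "\<tau> = (\<chi> i. T $ i / dlin l)"
  define q' where "q' = (\<chi> i. q $ i / dotp l q)"
  have T: "T = dlin l *s \<tau>" and q'': "q' = (1 / dotp l q) *s q"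
    using nz by (simp_all add: \<tau>_def q'_def vec_eq_iff)
  have Ti: "T $ i = dlin (axis i 1)" for i
    using exhaust_3[of i] by (auto simp: dlin_dotp dotp_3 axis_def const_ratfun_simps)
  have diff: "\<tau> $ i - const_ratfun (q' $ i) \<in> ideal_gen (\<O> q) {s, t}" for i
  proof -
    define c where "c = axis i 1 - (q' $ i) *s l"
    have "dotp (axis i 1) q = q $ i"
      using exhaust_3[of i] by (auto simp: dotp_3 axis_def)
    then have "dotp c q = 0" using l by (simp add: c_def dotp_diff dotp_scale q'_def)
    then obtain x y where xy: "c = x *s a + y *s b" using covector_combination[OF ab 0 _ q] by blast
    have "\<tau> $ i - const_ratfun (q' $ i) = dlin c / dlin l"
    proof -
      have "dlin c = dlin (axis i 1) - const_ratfun (q' $ i) * dlin l"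
        by (simp add: c_def dlin_dotp dotp_3 const_ratfun_simps algebra_simps)
      then show ?thesis using nz by (simp add: \<tau>_def Ti diff_divide_distrib)
    qed
    also have "\<dots> = const_ratfun x * s + const_ratfun y * t"
    proof -
      have "dlin c = const_ratfun x * dlin a + const_ratfun y * dlin b"
        by (simp add: xy dlin_dotp dotp_3 const_ratfun_simps algebra_simps)
      then show ?thesis by (simp add: s_def t_def add_divide_distrib)
    qed
    also have "\<dots> \<in> ideal_gen (\<O> q) {s, t}" unfolding I(1) using const_\<O> by blast
    finally show ?thesis .
  qed
  have "\<mm> q \<subseteq> ideal_gen (\<O> q) {s, t}"
  proof
    fix f assume "f \<in> \<mm> q"
    then obtain n G H where f: "homogeneous n G" "homogeneous n H" "value_at H q \<noteq> 0" "ev H \<noteq> 0" "f = ev G / ev H" "value_at G q = 0"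
      by (rule \<mm>E)
    have e: "ev F = dlin l ^ n * eval3 const_ratfun F \<tau>" if "homogeneous n F" for F
      using eval3_scale[OF const_ratfun_hom that, of "dlin l" \<tau>] T by simp
    have "eval3 const_ratfun G \<tau> - eval3 const_ratfun G (vmap const_ratfun q') \<in> ideal_gen (\<O> q) {s, t}"
      using diff Ti l dlin_\<O>[OF l]
      by (intro eval3_congruence(2)[OF const_ratfun_hom, of "\<O> q"])
        (auto simp: \<O>_closed Ic const_\<O> \<tau>_def)
    moreover have "eval3 const_ratfun G (vmap const_ratfun q') = const_ratfun (value_at G q')"
      using hom_eval3_comp[OF const_ratfun_hom hom_id] by (simp add: vmap_def)
    moreover have "value_at G q' = 0" unfolding q'' eval3_scale[OF hom_id f(1)] using f by simp
    ultimately have G: "eval3 const_ratfun G \<tau> \<in> ideal_gen (\<O> q) {s, t}"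
      by (simp add: const_ratfun_simps)
    have hn: "homogeneous n (lin l ^ n)" using homogeneous_power[OF homogeneous_lin, of n l] by simp
    have "f = (dlin l ^ n / ev H) * eval3 const_ratfun G \<tau>" using f(5) e[OF f(1)] by simp
    moreover have "dlin l ^ n / ev H \<in> \<O> q"
      using \<O>I[OF hn f(2,3)] by (simp add: dlin_def ev_simps)
    ultimately show "f \<in> ideal_gen (\<O> q) {s, t}" using G Ic(4) by metis
  qed
  moreover have "ideal_gen (\<O> q) {s, t} \<subseteq> \<mm> q"
    unfolding ideal_gen_def by (rule hull_minimal) (use stm ideal_\<mm> in auto)
  ultimately show ?thesis by (simp add: s_def t_def)
qed

text \<open>Reduced fractions are still quotients of forms, since factors of forms are forms.\<close>

lemma L_coprime:
  assumes "f \<in> L" "f \<noteq> 0"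
  obtains n G H where "homogeneous n G" "homogeneous n H" "G \<noteq> 0" "H \<noteq> 0" "coprime G H" "f = ev G / ev H"
proof -
  obtain n G H where f: "homogeneous n G" "homogeneous n H" "H \<noteq> 0" "f = ev G / ev H"
    using assms(1) by (rule LE)
  have G: "G \<noteq> 0" using assms(2) f by (auto simp: ev_simps)
  define D where "D = gcd G H"
  have D: "D \<noteq> 0" using G by (simp add: D_def)
  obtain G' H' where c: "G = G' * D" "H = H' * D" "coprime G' H'"
    using gcd_coprime_exists[of G H] D unfolding D_def by auto
  obtain m k where m: "homogeneous m G'" "homogeneous k D" "n = m + k"
    using homogeneous_factors[of n G' D] f c G by auto
  obtain m' k' where m': "homogeneous m' H'" "homogeneous k' D" "n = m' + k'"
    using homogeneous_factors[of n H' D] f c by auto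
  have "k = k'" using homogeneous_unique m m' D by blast
  then have "homogeneous m H'" using m m' by simp
  moreover have "f = ev G' / ev H'" using f(4) c D m ev_eq_0_iff by (simp add: ev_simps)
  moreover have "G' \<noteq> 0" "H' \<noteq> 0" using c G f by auto
  ultimately show ?thesis using that m c by blast
qed

text \<open>
  The plane is factorial, hence completely integrally closed: a prime factor through \<open>q\<close> of the
  denominator of \<open>g\<close> would divide \<open>D\<close> arbitrarily often.
\<close>

lemma completely_integrally_closed:
  assumes g: "g \<in> L" and D: "D \<in> \<O> q" "D \<noteq> 0" and *: "\<And>m. D * g ^ m \<in> \<O> q"
  shows "g \<in> \<O> q"
proof (cases "g = 0")
  case False
  obtain n G H where G: "homogeneous n G" "homogeneous n H" "G \<noteq> 0" "H \<noteq> 0" "coprime G H" "g = ev G / ev H"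
    using L_coprime[OF g False] .
  obtain k A B where A: "homogeneous k A" "homogeneous k B" "value_at B q \<noteq> 0" "ev B \<noteq> 0" "D = ev A / ev B"
    using D(1) by (rule \<O>E)
  have A0: "A \<noteq> 0" using D A by (auto simp: ev_simps)
  have "value_at H q \<noteq> 0"
  proof
    assume "value_at H q = 0"
    then obtain \<pi> where \<pi>: "prime_elem \<pi>" "\<pi> dvd H" "value_at \<pi> q = 0"
      using vanishing_prime_factor G(4) by blast
    have "\<not> \<pi> dvd G" using \<pi> G(5) by (meson coprime_common_divisor prime_elem_not_unit)
    have "\<pi> ^ m dvd A" for m
    proof -
      obtain j E F where E: "homogeneous j E" "homogeneous j F" "value_at F q \<noteq> 0" "ev F \<noteq> 0" "D * g ^ m = ev E / ev F"
        using *[of m] by (rule \<O>E)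
      have "ev H \<noteq> 0" using G ev_eq_0_iff by blast
      then have "ev (A * (G ^ m * F)) = ev (E * (B * H ^ m))"
        using E A G by (simp add: ev_simps field_simps)
      moreover have "homogeneous (k + (m * n + j)) (A * (G ^ m * F))"
        using A G E by (intro homogeneous_mult homogeneous_power)
      moreover have "homogeneous (j + (k + m * n)) (E * (B * H ^ m))"
        using A G E by (intro homogeneous_mult homogeneous_power)
      ultimately have eq: "A * (G ^ m * F) = E * (B * H ^ m)"
        using ev_eq_iff[of "k + (m * n + j)"] by (simp add: ac_simps)
      have "\<pi> ^ m dvd H ^ m" using \<pi> dvd_power_same by blast
      then have "\<pi> ^ m dvd A * (G ^ m * F)" unfolding eq by simp
      moreover have "\<not> \<pi> dvd F" using \<pi> E by (auto simp: value_simps elim!: dvdE)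
      then have "coprime (\<pi> ^ m) (G ^ m * F)"
        using \<open>\<not> \<pi> dvd G\<close> \<pi>(1) by (simp add: prime_elem_imp_coprime)
      ultimately show ?thesis by (simp add: coprime_dvd_mult_left_iff)
    qed
    then have "infinite {m. \<pi> ^ m dvd A}" by simp
    then show False using finite_divisor_powers[OF A0] \<pi>(1) prime_elem_not_unit by blast
  qed
  then show ?thesis using G \<O>I by blast
qed (simp add: \<O>_closed)

text \<open>
  Since \<open>a\<close> and \<open>b\<close> are distinct primes and \<open>i < d\<close>, the \<open>d\<close>-th power of the denominator of \<open>f\<close>
  cannot be cancelled by \<open>a\<^sup>i\<close>, while \<open>b\<^sup>i\<close> can only be cancelled by the numerator of \<open>f\<close>.
\<close>

lemma kummer_divisibility:
  assumes ab: "independent2 a b" and f: "f \<in> L" and i: "0 < i" "i < d" and l: "dotp l q \<noteq> 0"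
    and *: "f ^ d * (dlin a / dlin b) ^ i \<in> \<O> q"
  obtains g where "g \<in> \<O> q" "f = (dlin b / dlin l) * g"
proof (cases "f = 0")
  case True then show ?thesis using that[of 0] \<O>_closed(2) by simp
next
  case False
  note ab0 = independent2_nz[OF ab]
  obtain n G H where G: "homogeneous n G" "homogeneous n H" "G \<noteq> 0" "H \<noteq> 0" "coprime G H" "f = ev G / ev H"
    using L_coprime[OF f False] .
  obtain j E F where E: "homogeneous j E" "homogeneous j F" "value_at F q \<noteq> 0" "ev F \<noteq> 0"
      "f ^ d * (dlin a / dlin b) ^ i = ev E / ev F"
    using * by (rule \<O>E)
  have nz: "ev H \<noteq> 0" "dlin b \<noteq> 0" "dlin l \<noteq> 0" using G ev_eq_0_iff dlin_nz ab0 dotp_nz[OF l] by blast+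
  have "ev (G ^ d * (lin a ^ i * F)) = ev (E * (H ^ d * lin b ^ i))"
    using E(4,5) G(6) nz by (simp add: ev_simps dlin_def field_simps)
  moreover have "homogeneous (d * n + (i * 1 + j)) (G ^ d * (lin a ^ i * F))"
    using G E by (intro homogeneous_mult homogeneous_power homogeneous_lin)
  moreover have "homogeneous (j + (d * n + i * 1)) (E * (H ^ d * lin b ^ i))"
    using G E by (intro homogeneous_mult homogeneous_power homogeneous_lin)
  ultimately have eq: "G ^ d * (lin a ^ i * F) = E * (H ^ d * lin b ^ i)"
    using ev_eq_iff[of "d * n + (i * 1 + j)"] by (simp add: ac_simps)
  have Fdvd: "\<not> \<pi> dvd F" if "value_at \<pi> q = 0" for \<pi>
    using that E by (auto simp: value_simps elim!: dvdE)
  have H: "value_at H q \<noteq> 0"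
  proof
    assume "value_at H q = 0"
    then obtain \<pi> where \<pi>: "prime_elem \<pi>" "\<pi> dvd H" "value_at \<pi> q = 0"
      using vanishing_prime_factor G(4) by blast
    have "\<not> \<pi> dvd G" using \<pi> G(5) by (meson coprime_common_divisor prime_elem_not_unit)
    then have "coprime (\<pi> ^ d) (G ^ d * F)"
      using Fdvd \<pi> by (simp add: prime_elem_imp_coprime)
    moreover have "\<pi> ^ d dvd lin a ^ i * (G ^ d * F)"
    proof -
      have "\<pi> ^ d dvd H ^ d" using \<pi> dvd_power_same by blast
      then have "\<pi> ^ d dvd G ^ d * (lin a ^ i * F)" unfolding eq by simp
      then show ?thesis by (simp add: ac_simps)
    qed
    ultimately have d: "\<pi> ^ d dvd lin a ^ i" by (simp add: coprime_dvd_mult_left_iff)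
    then have "\<pi> dvd lin a ^ i" using i by (meson dvd_power dvd_trans less_nat_zero_code less_trans)
    then have "\<pi> dvd lin a" using \<pi>(1) prime_elem_dvd_power by blast
    then have "lin a dvd \<pi>"
      using \<pi>(1) lin_prime[OF ab0(1)] prime_elem_imp_irreducible irreducibleD' prime_elem_not_unit by blast
    then have "lin a ^ d dvd lin a ^ i" using d dvd_power_same dvd_trans by blast
    then show False
      using i lin_prime[OF ab0(1)] by (auto simp: dvd_power_iff prime_elem_def)
  qed
  show ?thesis
  proof (cases "dotp b q = 0")
    case False
    have "f = (dlin b / dlin l) * ((dlin l / dlin b) * f)" using nz by simp
    moreover have "(dlin l / dlin b) * f \<in> \<O> q" 
      unfolding G(6) by (intro \<O>_closed(4) dlin_\<O>[OF False] \<O>I[OF G(1,2) H])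
    ultimately show ?thesis using that by blast
  next
    case True
    have pb: "prime_elem (lin b)" using lin_prime ab0 by blast
    have "lin b dvd G ^ d * (lin a ^ i * F)" unfolding eq using i by (simp add: dvd_power)
    moreover have "\<not> lin b dvd F" using Fdvd True by (simp add: value_lin)
    moreover have "\<not> lin b dvd lin a" using ab ab0 by (simp add: lin_dvd_lin_iff independent2_sym)
    ultimately have "lin b dvd G" using pb prime_elem_dvd_mult_iff prime_elem_dvd_power by metis
    then obtain G' where G': "G = lin b * G'" ..
    obtain m where m: "homogeneous m G'" "n = 1 + m"
      using homogeneous_factors[of n "lin b" G'] G G' homogeneous_unique[OF _ homogeneous_lin] by (metis mult_eq_0_iff)
    have "f = (dlin b / dlin l) * (ev (G' * lin l) / ev H)"
      using G(6) G' nz by (simp add: ev_simps dlin_def)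
    moreover have "ev (G' * lin l) / ev H \<in> \<O> q"
      using m G(2) H homogeneous_mult[OF m(1) homogeneous_lin, of l] by (intro \<O>I[of n]) (simp_all add: add.commute)
    ultimately show ?thesis using that by blast
  qed
qed

lemma curve_ideal_line:
  assumes a: "a \<noteq> 0" and C: "C = {q. q \<noteq> 0 \<and> dotp a q = 0}" and l: "dotp l q \<noteq> 0"
  shows "curve_ideal_at T C q = ideal_gen (\<O> q) {dlin a / dlin l}"
proof -
  have nz: "dlin l \<noteq> 0" using dlin_nz[OF dotp_nz[OF l]] .
  have "f \<in> curve_ideal_at T C q \<longleftrightarrow> (\<exists>\<alpha>\<in>\<O> q. f = \<alpha> * (dlin a / dlin l))" for f
  proof
    assume "f \<in> curve_ideal_at T C q"
    then obtain n G H where f: "f = ev G / ev H" "homogeneous n G" "homogeneous n H" "\<forall>p\<in>C. value_at G p = 0"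
        "value_at H q \<noteq> 0" "ev H \<noteq> 0"
      unfolding curve_ideal_at_def by blast
    then have "lin a dvd G" unfolding lin_dvd_form_iff[OF a f(2)] by (auto simp: C)
    then obtain G' where G': "G = lin a * G'" ..
    have "ev (G' * lin l) / ev H \<in> \<O> q"
    proof (cases "G = 0")
      case True
      then have "G' = 0" using G' a lin_eq_0_iff by auto
      then show ?thesis by (simp add: ev_simps \<O>_closed)
    next
      case False
      then obtain m where m: "homogeneous m G'" "n = 1 + m"
        using homogeneous_factors[of n "lin a" G'] f(2) G' homogeneous_unique[OF _ homogeneous_lin] by (metis mult_eq_0_iff)
      then show ?thesis
        using f homogeneous_mult[OF m(1) homogeneous_lin, of l] by (intro \<O>I[of n]) (simp_all add: add.commute)
    qed
    moreover have "f = (ev (G' * lin l) / ev H) * (dlin a / dlin l)"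
      using f G' nz by (simp add: ev_simps dlin_def)
    ultimately show "\<exists>\<alpha>\<in>\<O> q. f = \<alpha> * (dlin a / dlin l)" by blast
  next
    assume "\<exists>\<alpha>\<in>\<O> q. f = \<alpha> * (dlin a / dlin l)"
    then obtain \<alpha> where "\<alpha> \<in> \<O> q" and f: "f = \<alpha> * (dlin a / dlin l)" by blast
    then obtain n G H where \<alpha>: "homogeneous n G" "homogeneous n H" "value_at H q \<noteq> 0" "ev H \<noteq> 0" "\<alpha> = ev G / ev H"
      by (auto elim: \<O>E)
    have "f = ev (G * lin a) / ev (H * lin l)" using f \<alpha> by (simp add: ev_simps dlin_def)
    moreover have "\<forall>p\<in>C. value_at (G * lin a) p = 0" by (simp add: C value_simps value_lin)
    moreover have "homogeneous (n + 1) (G * lin a)" "homogeneous (n + 1) (H * lin l)"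
      using \<alpha> homogeneous_mult homogeneous_lin by blast+
    moreover have "value_at (H * lin l) q \<noteq> 0" using \<alpha> l by (simp add: value_simps value_lin)
    moreover have "ev (H * lin l) \<noteq> 0" using \<alpha> nz by (simp add: ev_simps dlin_def)
    ultimately show "f \<in> curve_ideal_at T C q" unfolding curve_ideal_at_def by blast
  qed
  then show ?thesis unfolding ideal_gen1[OF subring_\<O> dlin_\<O>[OF l]] by blast
qed

end

section \<open>The affine plane as a chart\<close>

lemma hom_Fract: "unital_hom (\<lambda>f. Fraction_Field.Fract f (1::'a::idom))"
  by (simp add: unital_hom_def One_fract_def add_fract mult_fract)

text \<open>Setting the outermost variable \<open>Z\<close> to \<open>1\<close> is evaluation of the polynomial at \<open>1\<close>.\<close>

lemma eval3_generic_point_plane: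
  "eval3 const_ratfun F generic_point_plane = Fraction_Field.Fract (poly F 1) 1"
proof (rule hom_cpoly3_ext[of "\<lambda>F. eval3 const_ratfun F generic_point_plane" "\<lambda>F. Fraction_Field.Fract (poly F 1) 1"])
  show "unital_hom (\<lambda>F. eval3 const_ratfun F generic_point_plane)"
    by (rule hom_eval3[OF const_ratfun_hom])
  show "unital_hom (\<lambda>F. Fraction_Field.Fract (poly F (1::cpoly2)) 1)"
    by (rule hom_comp[OF hom_Fract hom_poly_at])
  show "eval3 const_ratfun (cst c) generic_point_plane = Fraction_Field.Fract (poly (cst c) 1) 1" for c
    by (simp add: eval3_cst const_ratfun_hom const_ratfun_def)
  show "eval3 const_ratfun (coord $ i) generic_point_plane = Fraction_Field.Fract (poly (coord $ i) 1) 1" for i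
    using exhaust_3[of i]
    by (auto simp: eval3_coord const_ratfun_hom generic_point_plane_def coord_simps varX_def varY_def One_fract_def)
qed

lemma coeff_dehomogenized:
  assumes "homogeneous n F"
  shows "coeff (coeff (poly F 1) j) i = (if i + j \<le> n then coeff (coeff (coeff F (n - i - j)) j) i else 0)"
proof -
  define K where "K = max n (degree F)"
  have "poly F 1 = (\<Sum>k\<le>degree F. coeff F k)" by (simp add: poly_altdef)
  also have "\<dots> = (\<Sum>k\<le>K. coeff F k)"
    by (rule sum.mono_neutral_left) (auto simp: K_def coeff_eq_0)
  finally have "coeff (coeff (poly F 1) j) i = (\<Sum>k\<le>K. coeff (coeff (coeff F k) j) i)"
    by (simp add: coeff_sum)
  also have "\<dots> = (\<Sum>k\<le>K. if k = n - i - j then (if i + j \<le> n then coeff (coeff (coeff F (n - i - j)) j) i else 0) else 0)"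
  proof (intro sum.cong refl)
    fix k
    have "i + j + k = n" if "coeff (coeff (coeff F k) j) i \<noteq> 0"
      using assms that unfolding homogeneous_def by blast
    then show "coeff (coeff (coeff F k) j) i =
      (if k = n - i - j then (if i + j \<le> n then coeff (coeff (coeff F (n - i - j)) j) i else 0) else 0)" by force
  qed
  also have "\<dots> = (if i + j \<le> n then coeff (coeff (coeff F (n - i - j)) j) i else 0)"
  proof -
    have "n - i - j \<in> {..K}" by (simp add: K_def)
    then show ?thesis by (simp only: sum.delta[OF finite_atMost] if_True)
  qed
  finally show ?thesis .
qed

lemma dehomogenized_eq_0: assumes "homogeneous n F" "poly F 1 = 0" shows "F = 0"
proof (intro poly_eqI)
  fix k j i
  show "coeff (coeff (coeff F k) j) i = coeff (coeff (coeff 0 k) j) i"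
  proof (cases "i + j + k = n")
    case True
    then have "k = n - i - j" "i + j \<le> n" by auto
    then show ?thesis using coeff_dehomogenized[OF assms(1), of j i] assms(2) by simp
  next
    case False then show ?thesis using assms(1) by (auto simp: homogeneous_def)
  qed
qed

interpretation plane: dominant_point generic_point_plane
proof
  fix n G assume "homogeneous n G" "eval3 const_ratfun G generic_point_plane = 0"
  then show "G = 0" using dehomogenized_eq_0
    by (simp add: eval3_generic_point_plane Zero_fract_def eq_fract)
qed


section \<open>Localizations at maximal ideals\<close>

lemma maximal_ideal_prime:
  assumes A: "is_subring A" and J: "is_maximal_ideal A J" and fg: "f \<in> A" "g \<in> A" "f * g \<in> J"
  shows "f \<in> J \<or> g \<in> J"
proof (rule ccontr)
  assume *: "\<not> (f \<in> J \<or> g \<in> J)"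
  note c = subring_closed[OF A]
  have I: "is_ideal A J" using J by (simp add: is_maximal_ideal_def)
  note Ic = ideal_closed[OF I]
  define J' where "J' = {a * f + j | a j. a \<in> A \<and> j \<in> J}"
  have "is_ideal A J'"
    unfolding is_ideal_def
  proof (intro conjI ballI)
    show "J' \<subseteq> A" using fg(1) c(4,6) Ic(2) by (auto simp: J'_def)
    show "0 \<in> J'" unfolding J'_def using c(2) Ic(1) by force
    fix x assume "x \<in> J'"
    then obtain a j where x: "x = a * f + j" "a \<in> A" "j \<in> J" by (auto simp: J'_def)
    show "x + y \<in> J'" if "y \<in> J'" for y
    proof -
      from that obtain a' j' where y: "y = a' * f + j'" "a' \<in> A" "j' \<in> J" by (auto simp: J'_def)
      have "x + y = (a + a') * f + (j + j')" using x y by (simp add: algebra_simps)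
      then show ?thesis unfolding J'_def using x y c(6) Ic(3) by blast
    qed
    show "b * x \<in> J'" if "b \<in> A" for b
    proof -
      have "b * x = (b * a) * f + b * j" using x by (simp add: algebra_simps)
      then show ?thesis unfolding J'_def using x that c(4) Ic(4) by blast
    qed
  qed
  moreover have "J \<subseteq> J'"
  proof
    fix j assume "j \<in> J"
    moreover have "j = 0 * f + j" by simp
    ultimately show "j \<in> J'" unfolding J'_def using c(2) by blast
  qed
  moreover have "f \<in> J'"
  proof -
    have "f = 1 * f + 0" by simp
    then show ?thesis unfolding J'_def using c(1) Ic(1) by blast
  qed
  ultimately have "J' = A" using J * unfolding is_maximal_ideal_def by blast
  then obtain a j where aj: "1 = a * f + j" "a \<in> A" "j \<in> J" using c(1) unfolding J'_def by blast
  then have "g = a * (f * g) + j * g" by (metis distrib_right mult.assoc mult_1)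
  then have "g \<in> J" using aj fg Ic(3,4,5) by metis
  then show False using * by blast
qed

lemma localization:
  assumes A: "is_subring A" and J: "is_maximal_ideal A J"
  shows localize_subring: "is_subring (localize A J)"
    and localize_subset: "A \<subseteq> localize A J"
    and localize_inverse: "g \<in> A \<Longrightarrow> g \<notin> J \<Longrightarrow> inverse g \<in> localize A J"
    and localize_nonunits: "f \<in> A \<Longrightarrow> g \<in> A \<Longrightarrow> g \<notin> J \<Longrightarrow> f / g \<in> nonunits (localize A J) \<longleftrightarrow> f \<in> J"
    and localize_ideal: "is_ideal (localize A J) (nonunits (localize A J))"
    and localize_one: "1 \<notin> nonunits (localize A J)"
proof -
  note c = subring_closed[OF A] and prime = maximal_ideal_prime[OF A J]
  have I: "is_ideal A J" and JA: "J \<noteq> A" using J by (simp_all add: is_maximal_ideal_def)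
  note Ic = ideal_closed[OF I]
  have one: "1 \<notin> J" using Ic(2) Ic(4)[of _ 1] JA by auto
  have nz: "g \<noteq> 0" if "g \<notin> J" for g using that Ic(1) by blast
  have S: "f / g \<in> localize A J" if "f \<in> A" "g \<in> A" "g \<notin> J" for f g
    using that by (auto simp: localize_def)
  have E: "\<exists>f g. x = f / g \<and> f \<in> A \<and> g \<in> A \<and> g \<notin> J" if "x \<in> localize A J" for x
    using that by (auto simp: localize_def)
  have m: "g * g' \<in> A \<and> g * g' \<notin> J" if "g \<in> A" "g' \<in> A" "g \<notin> J" "g' \<notin> J" for g g'
    using that prime c(4) by blast
  show sub: "is_subring (localize A J)"
    unfolding is_subring_def
  proof (intro conjI ballI)
    show "1 \<in> localize A J" using S[OF c(1) c(1) one] by simp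
    fix x y assume "x \<in> localize A J" "y \<in> localize A J"
    then obtain f g f' g' where x: "x = f / g" "f \<in> A" "g \<in> A" "g \<notin> J" and y: "y = f' / g'" "f' \<in> A" "g' \<in> A" "g' \<notin> J"
      using E by metis
    have "x - y = (f * g' - f' * g) / (g * g')" "x * y = (f * f') / (g * g')"
      using x y nz by (simp_all add: diff_frac_eq)
    then show "x - y \<in> localize A J" "x * y \<in> localize A J"
      using x y m by (auto intro!: S c)
  qed
  show "A \<subseteq> localize A J" using S[OF _ c(1) one] by force
  show "inverse g \<in> localize A J" if "g \<in> A" "g \<notin> J" for g
    using S[OF c(1) that] by (simp add: field_simps)
  have non: "f / g \<in> nonunits (localize A J) \<longleftrightarrow> f \<in> J" if fg: "f \<in> A" "g \<in> A" "g \<notin> J" for f g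
  proof
    assume n: "f / g \<in> nonunits (localize A J)"
    show "f \<in> J"
    proof (rule ccontr)
      assume f: "f \<notin> J"
      have "inverse (f / g) \<in> localize A J" using S[OF fg(2,1) f] by simp
      moreover have "f / g \<noteq> 0" using f fg nz by simp
      ultimately show False using n by (auto simp: nonunits_def)
    qed
  next
    assume f: "f \<in> J"
    have "inverse (f / g) \<notin> localize A J" if "f \<noteq> 0"
    proof
      assume "inverse (f / g) \<in> localize A J"
      then obtain h k where hk: "g / f = h / k" "h \<in> A" "k \<in> A" "k \<notin> J" using E by fastforce
      then have "g * k = h * f" using that nz by (simp add: field_simps)
      then have "g * k \<in> J" using Ic(4)[OF hk(2) f] by simp
      then show False using prime hk fg by blast
    qed
    then show "f / g \<in> nonunits (localize A J)" using S fg by (auto simp: nonunits_def)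
  qed
  then show "f \<in> A \<Longrightarrow> g \<in> A \<Longrightarrow> g \<notin> J \<Longrightarrow> f / g \<in> nonunits (localize A J) \<longleftrightarrow> f \<in> J" for f g .
  show "1 \<notin> nonunits (localize A J)" using non[OF c(1) c(1) one] one by simp
  have E': "\<exists>f g. x = f / g \<and> f \<in> J \<and> g \<in> A \<and> g \<notin> J" if x: "x \<in> nonunits (localize A J)" for x
  proof -
    have "x \<in> localize A J" using x by (simp add: nonunits_def)
    then obtain f g where "x = f / g" "f \<in> A" "g \<in> A" "g \<notin> J" using E by blast
    then show ?thesis using non x by blast
  qed
  show "is_ideal (localize A J) (nonunits (localize A J))"
    unfolding is_ideal_def
  proof (intro conjI ballI)
    show "nonunits (localize A J) \<subseteq> localize A J" by (auto simp: nonunits_def)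
    then show "0 \<in> nonunits (localize A J)" using non[OF Ic(2)[OF Ic(1)] c(1) one] Ic(1) by simp
    fix x assume "x \<in> nonunits (localize A J)"
    then obtain f g where x: "x = f / g" "f \<in> J" "g \<in> A" "g \<notin> J" using E' by blast
    show "x + y \<in> nonunits (localize A J)" if "y \<in> nonunits (localize A J)" for y
    proof -
      from that obtain f' g' where y: "y = f' / g'" "f' \<in> J" "g' \<in> A" "g' \<notin> J" using E' by blast
      have e: "x + y = (f * g' + f' * g) / (g * g')" using x y nz by (simp add: add_frac_eq)
      have "f * g' + f' * g \<in> J" using x y by (intro Ic(3,5))
      then show ?thesis unfolding e using non m x y Ic(2) by blast
    qed
    show "a * x \<in> nonunits (localize A J)" if "a \<in> localize A J" for a
    proof -
      from that obtain h k where a: "a = h / k" "h \<in> A" "k \<in> A" "k \<notin> J" using E by blast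
      have e: "a * x = (h * f) / (k * g)" using a x by simp
      have "h * f \<in> J" using a x by (intro Ic(4))
      then show ?thesis unfolding e using non m x a Ic(2) by blast
    qed
  qed
qed

lemma is_subring_hull: "is_subring (is_subring hull X)"
  by (rule hull_in) (auto simp: is_subring_def)

text \<open>Hence the functions that are regular at given points of a resolution form a ring.\<close>

lemma iterated_blowup_subring:
  assumes "iterated_blowup M" "R \<in> M" shows "is_subring R"
  using assms
proof (induction arbitrary: R)
  case plane
  then show ?case using plane.subring_\<O> by auto
next
  case (blowup M R')
  then consider "R \<in> M" | "R \<in> exceptional_points R'" by auto
  then show ?case
  proof cases
    case 2
    then obtain A J where "R = localize A J" "A = is_subring hull (R' \<union> {f / t | f. f \<in> nonunits R'}) \<or> True"
        "is_subring A" "is_maximal_ideal A J"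
      unfolding exceptional_points_def using is_subring_hull by blast
    then show ?thesis using localize_subring by blast
  qed (use blowup in blast)
qed

lemma subring_nonunit_power:
  assumes "is_subring S" "f \<in> S" "f ^ n \<in> nonunits S" shows "f \<in> nonunits S"
proof (rule ccontr)
  assume "f \<notin> nonunits S"
  then have f: "f \<noteq> 0" "inverse f \<in> S" using assms by (auto simp: nonunits_def)
  then have "inverse (f ^ n) \<in> S" using subring_closed(7)[OF assms(1)] by (metis power_inverse)
  then show False using assms(3) f by (auto simp: nonunits_def)
qed

lemma normal_ring_root:
  assumes "normal_ring S" "is_subring S" "n > 0" "f ^ n \<in> S" shows "f \<in> S"
proof -
  note c = subring_closed[OF assms(2)]
  define p where "p = monom 1 n + [:- (f ^ n):]"
  have "coeff p i \<in> S" for i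
    using assms(4) c by (auto simp: p_def coeff_pCons split: nat.splits)
  moreover have "lead_coeff p = 1"
  proof -
    have "degree p = n" unfolding p_def using assms(3)
      by (subst degree_add_eq_left) (auto simp: degree_monom_eq)
    then show ?thesis using assms(3) by (simp add: p_def coeff_pCons split: nat.splits)
  qed
  moreover have "poly p f = 0" by (simp add: p_def poly_monom)
  ultimately show ?thesis using assms(1) unfolding normal_ring_def by blast
qed

section \<open>The local rings of a Kummer cover of the plane\<close>

lemma cis_primitive:
  assumes "0 < i" "i < d" shows "cis (2 * pi / real d) ^ i \<noteq> 1"
proof
  assume "cis (2 * pi / real d) ^ i = 1"
  then have "cis (2 * pi * real i / real d) = cis (2 * pi * real 0 / real d)"
    using Complex.DeMoivre[of "2 * pi / real d" i] by (simp add: algebra_simps)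
  moreover have "inj_on (\<lambda>k. cis (2 * pi * real k / real d)) {..<d}"
    using Complex.bij_betw_roots_unity[of d] assms by (simp add: bij_betw_def)
  ultimately show False using inj_onD[of _ "{..<d}" i 0] assms by fastforce
qed

text \<open>
  The cover of the plane with generic point \<open>T\<close> by the root \<open>\<theta>\<close> of \<open>a / b\<close>, where the vectors \<open>a\<close> and \<open>b\<close> stand for
  linear forms. In \<open>kummer_cover\<close> below, the function field of the cover is in addition the whole ambient field.
\<close>

locale kummer_point = dominant_point T for T +
  fixes a b :: "complex ^ 3" and \<theta> :: ratfun and d :: nat
  assumes d2: "d \<ge> 2" and ab: "independent2 a b" and \<theta>d: "\<theta> ^ d = dlin a / dlin b"
    and weights_independent:
      "(\<And>i. i < d \<Longrightarrow> c i \<in> L) \<Longrightarrow> (\<Sum>i<d. c i * \<theta> ^ i) = 0 \<Longrightarrow> i < d \<Longrightarrow> c i = 0"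
begin

abbreviation \<zeta> :: ratfun where "\<zeta> \<equiv> const_ratfun (cis (2 * pi / real d))"

lemma a_nz: "dlin a \<noteq> 0" and b_nz: "dlin b \<noteq> 0"
  using independent2_nz[OF ab] dlin_nz by auto

sublocale K: kummer_extension L \<theta> \<zeta> d
proof
  note c = subring_closed[OF subring_L]
  show "1 \<in> L" "f \<in> L \<Longrightarrow> g \<in> L \<Longrightarrow> f - g \<in> L" "f \<in> L \<Longrightarrow> g \<in> L \<Longrightarrow> f * g \<in> L" "f \<in> L \<Longrightarrow> inverse f \<in> L" for f g
    using c inverse_L by auto
  show "2 \<le> d" by (rule d2)
  have "of_nat n = const_ratfun (of_nat n)" for n by (induction n) (simp_all add: const_ratfun_simps)
  then show "(of_nat d :: ratfun) \<noteq> 0" using d2 by simp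
  have "\<theta> ^ d \<noteq> 0" using a_nz b_nz by (simp add: \<theta>d)
  then show "\<theta> \<noteq> 0" using d2 by (metis power_0_left not_numeral_le_zero)
  show "\<theta> ^ d \<in> L" by (simp add: \<theta>d dlin_L)
  show "\<zeta> \<in> L" using const_\<O> \<O>_L by blast
  have "cis (2 * pi / real d) ^ d = 1" using Complex.DeMoivre[of "2 * pi / real d" d] d2 by simp
  then show "\<zeta> ^ d = 1" by (simp only: const_ratfun_simps(1) flip: const_ratfun_simps(9))
  show "\<zeta> ^ i \<noteq> 1" if "0 < i" "i < d" for i
  proof
    assume "\<zeta> ^ i = 1"
    then have "const_ratfun (cis (2 * pi / real d) ^ i - 1) = 0" by (simp add: const_ratfun_simps)
    then show False using cis_primitive[OF that] by simp
  qed
qed (rule weights_independent)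

end

locale kummer_cover = kummer_point +
  assumes weights_span: "\<exists>c. (\<forall>i<d. c i \<in> L) \<and> f = (\<Sum>i<d. c i * \<theta> ^ i)"
begin

lemma U: "f \<in> K.M"
  using weights_span[of f] by (auto simp: K.M_def)

lemma galois: "galois_extension L"
  by (rule K.galois) (use U in auto)

abbreviation cf :: "ratfun \<Rightarrow> nat \<Rightarrow> ratfun" where "cf \<equiv> K.cf"

lemmas cf_simps = K.cf_add[OF U U] K.cf_scale[OF _ U] K.cf_sum[OF U] K.cf_const K.cf_\<sigma>[OF U]
lemmas cf_L = K.cf_L[OF U]
lemmas expand = K.cf_expand[OF U]

lemma d_pos: "0 < d" using d2 by simp

context
  fixes q l :: "complex ^ 3"
  assumes l: "dotp l q \<noteq> 0"
begin

text \<open>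
  The integral closure of the local ring at \<open>q\<close> is the direct sum of the module of weight \<open>0\<close>
  and, for \<open>0 < i < d\<close>, of the modules generated by \<open>\<rho> \<theta>\<^sup>i\<close>.
\<close>

definition \<rho> :: ratfun where "\<rho> = dlin b / dlin l"

definition W :: "nat \<Rightarrow> ratfun set" where
  "W i = (if i = 0 then \<O> q else (\<lambda>g. \<rho> * g) ` \<O> q)"

definition \<Lambda> :: "ratfun set" where "\<Lambda> = {f. \<forall>i<d. cf f i \<in> W i}"

lemma l_nz: "dlin l \<noteq> 0" using dlin_nz[OF dotp_nz[OF l]] .

lemma \<rho>_\<O>: "\<rho> \<in> \<O> q" and \<rho>_nz: "\<rho> \<noteq> 0"
  unfolding \<rho>_def using dlin_\<O>[OF l] b_nz l_nz by auto

lemma \<rho>_\<theta>: "\<rho> * \<theta> ^ d = dlin a / dlin l"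
  using b_nz by (simp add: \<rho>_def \<theta>d)

lemma W_\<O>: "f \<in> W i \<Longrightarrow> f \<in> \<O> q"
  by (auto simp: W_def \<rho>_\<O> \<O>_closed split: if_splits)

lemma \<rho>_W: "g \<in> \<O> q \<Longrightarrow> \<rho> * g \<in> W i"
  by (auto simp: W_def \<rho>_\<O> \<O>_closed)

lemma W_E: "f \<in> W i \<Longrightarrow> 0 < i \<Longrightarrow> \<exists>g\<in>\<O> q. f = \<rho> * g"
  by (auto simp: W_def)

lemma W_closed: "0 \<in> W i" "f \<in> W i \<Longrightarrow> g \<in> W i \<Longrightarrow> f + g \<in> W i" "c \<in> \<O> q \<Longrightarrow> f \<in> W i \<Longrightarrow> c * f \<in> W i"
proof -
  show "0 \<in> W i" using \<rho>_W[OF \<O>_closed(2)] by simp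
  show "f \<in> W i \<Longrightarrow> g \<in> W i \<Longrightarrow> f + g \<in> W i"
    by (auto simp: W_def \<O>_closed simp flip: distrib_left split: if_splits)
  show "c \<in> \<O> q \<Longrightarrow> f \<in> W i \<Longrightarrow> c * f \<in> W i"
    by (auto simp: W_def \<O>_closed mult.left_commute[of c] split: if_splits)
qed

lemma W_sum: "(\<And>x. x \<in> X \<Longrightarrow> f x \<in> W i) \<Longrightarrow> sum f X \<in> W i"
  by (induction X rule: infinite_finite_induct) (simp_all add: W_closed)

lemma \<Lambda>_I: "(\<And>i. i < d \<Longrightarrow> cf f i \<in> W i) \<Longrightarrow> f \<in> \<Lambda>" and \<Lambda>_W: "f \<in> \<Lambda> \<Longrightarrow> i < d \<Longrightarrow> cf f i \<in> W i"
  by (auto simp: \<Lambda>_def)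

lemma \<Lambda>_scale: "c \<in> \<O> q \<Longrightarrow> f \<in> \<Lambda> \<Longrightarrow> c * f \<in> \<Lambda>"
  by (rule \<Lambda>_I) (simp add: cf_simps \<O>_L W_closed \<Lambda>_W)

lemma \<Lambda>_add: "f \<in> \<Lambda> \<Longrightarrow> g \<in> \<Lambda> \<Longrightarrow> f + g \<in> \<Lambda>"
  by (rule \<Lambda>_I) (simp add: cf_simps W_closed \<Lambda>_W)

lemma \<O>_\<Lambda>: "c \<in> \<O> q \<Longrightarrow> c \<in> \<Lambda>"
  by (rule \<Lambda>_I) (simp add: cf_simps \<O>_L W_closed, simp add: W_def)

lemma \<Lambda>_L: "f \<in> \<Lambda> \<Longrightarrow> f \<in> L \<Longrightarrow> f \<in> \<O> q"
  using \<Lambda>_W[of f 0] d_pos by (simp add: cf_simps W_def)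

lemma \<Lambda>_sum: "(\<And>x. x \<in> X \<Longrightarrow> f x \<in> \<Lambda>) \<Longrightarrow> sum f X \<in> \<Lambda>"
  by (rule \<Lambda>_I) (simp add: cf_simps W_sum \<Lambda>_W)

text \<open>The product of the components of weights \<open>i\<close> and \<open>j\<close>; for \<open>i + j \<ge> d\<close> one factor \<open>\<rho>\<close>
  turns \<open>\<theta>\<^sup>d\<close> into the regular function \<open>a / l\<close>.\<close>

lemma weight_product:
  assumes ij: "i < d" "j < d" and c: "c \<in> W i" and e: "e \<in> W j"
  obtains "i + j < d" "c * e \<in> W (i + j)" "\<And>k. k < d \<Longrightarrow> cf ((c * e) * \<theta> ^ (i + j)) k = (if k = i + j then c * e else 0)"
  | g where "0 < i" "0 < j" "d \<le> i + j" "g \<in> \<O> q"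
     "\<And>k. k < d \<Longrightarrow> cf ((c * e) * \<theta> ^ (i + j)) k = (if k = i + j - d then \<rho> * (dlin a / dlin l) * g else 0)"
proof -
  have ce: "c * e \<in> L" using c e W_\<O> \<O>_closed \<O>_L by meson
  note cf = K.cf_power[OF ce, of _ "i + j"]
  show ?thesis
  proof (cases "i + j < d")
    case True
    have "c * e \<in> W (i + j)"
    proof (cases "i = 0")
      case True then show ?thesis using c e W_closed(3)[of c e j] by (simp add: W_def)
    next
      case False
      then obtain g where "g \<in> \<O> q" "c = \<rho> * g" using W_E c by blast
      then show ?thesis using \<rho>_W[of "g * e" "i + j"] e W_\<O> \<O>_closed(4) by (simp add: mult.assoc)
    qed
    then show ?thesis using that(1) True cf by simp
  next
    case False
    then have pos: "0 < i" "0 < j" using ij by auto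
    then obtain g h where g: "g \<in> \<O> q" "c = \<rho> * g" and h: "h \<in> \<O> q" "e = \<rho> * h" using W_E c e by blast
    have "(i + j) div d = 1" "(i + j) mod d = i + j - d"
      using False ij by (auto simp: div_nat_eqI le_mod_geq)
    moreover have "c * e * \<theta> ^ d = \<rho> * (\<rho> * \<theta> ^ d) * (g * h)" using g h by (simp add: mult_ac)
    ultimately have "cf ((c * e) * \<theta> ^ (i + j)) k = (if k = i + j - d then \<rho> * (dlin a / dlin l) * (g * h) else 0)" if "k < d" for k
      using cf[OF that] by (simp only: \<rho>_\<theta> power_one_right)
    then show ?thesis using that(2)[of "g * h"] pos False g h \<O>_closed(4) by simp
  qed
qed

lemma \<Lambda>_mult: assumes "f \<in> \<Lambda>" "g \<in> \<Lambda>" shows "f * g \<in> \<Lambda>"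
  unfolding K.mult_expand[OF U U, of f g]
proof (intro \<Lambda>_sum)
  fix i j assume "i \<in> {..<d}" "j \<in> {..<d}"
  then have ij: "i < d" "j < d" by auto
  show "cf f i * cf g j * \<theta> ^ (i + j) \<in> \<Lambda>"
  proof (rule weight_product[OF ij \<Lambda>_W[OF assms(1) ij(1)] \<Lambda>_W[OF assms(2) ij(2)]])
    fix h assume "h \<in> \<O> q"
      and c: "\<And>k. k < d \<Longrightarrow> cf (cf f i * cf g j * \<theta> ^ (i + j)) k = (if k = i + j - d then \<rho> * (dlin a / dlin l) * h else 0)"
    then show ?thesis
      using \<rho>_W[of "(dlin a / dlin l) * h"] dlin_\<O>[OF l] \<O>_closed(4)
      by (intro \<Lambda>_I) (simp only: c mult.assoc W_closed split: if_split, blast)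
  qed (auto intro!: \<Lambda>_I simp: W_closed)
qed

lemma \<Lambda>_subring: "is_subring \<Lambda>"
  unfolding is_subring_def
proof (intro conjI ballI)
  show "1 \<in> \<Lambda>" using \<O>_\<Lambda>[OF \<O>_closed(1)] .
  fix f g assume fg: "f \<in> \<Lambda>" "g \<in> \<Lambda>"
  then show "f * g \<in> \<Lambda>" by (rule \<Lambda>_mult)
  have "(-1) * g \<in> \<Lambda>" using \<Lambda>_scale[OF \<O>_closed(5)[OF \<O>_closed(1)] fg(2)] .
  then show "f - g \<in> \<Lambda>" using \<Lambda>_add[OF fg(1)] by fastforce
qed

lemmas \<Lambda>_closed = subring_closed[OF \<Lambda>_subring]

lemma \<zeta>_\<O>: "\<zeta> ^ n \<in> \<O> q"
  using const_\<O> \<O>_closed(7) by blast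

lemma \<sigma>_\<Lambda>: "f \<in> \<Lambda> \<Longrightarrow> K.\<sigma> f \<in> \<Lambda>"
  by (rule \<Lambda>_I) (simp add: cf_simps W_closed \<Lambda>_W \<zeta>_\<O>)

subsection \<open>Almost integral elements\<close>

text \<open>
  An element whose powers have a common denominator is integral. This is applied
  to the elements of a finite algebra over the local ring; it avoids characteristic polynomials.
\<close>

definition almost_integral :: "ratfun \<Rightarrow> bool" where
  "almost_integral f \<longleftrightarrow> (\<exists>D\<in>\<O> q. D \<noteq> 0 \<and> (\<forall>n. D * f ^ n \<in> \<Lambda>))"

lemma almost_integral_add:
  assumes "almost_integral f" "almost_integral g" shows "almost_integral (f + g)"
proof -
  obtain D where D: "D \<in> \<O> q" "D \<noteq> 0" "\<And>n. D * f ^ n \<in> \<Lambda>" using assms(1) by (auto simp: almost_integral_def)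
  obtain E where E: "E \<in> \<O> q" "E \<noteq> 0" "\<And>n. E * g ^ n \<in> \<Lambda>" using assms(2) by (auto simp: almost_integral_def)
  have "(D * E) * (f + g) ^ n \<in> \<Lambda>" for n
  proof -
    have "(D * E) * (f + g) ^ n = (\<Sum>k\<le>n. of_nat (n choose k) * ((D * f ^ k) * (E * g ^ (n - k))))"
      unfolding binomial_ring by (simp add: sum_distrib_left mult_ac)
    also have "\<dots> \<in> \<Lambda>"
    proof -
      have "of_nat m \<in> \<O> q" for m by (induction m) (simp_all add: \<O>_closed)
      then show ?thesis by (intro \<Lambda>_sum \<Lambda>_scale \<Lambda>_mult[OF D(3) E(3)])
    qed
    finally show ?thesis .
  qed
  then show ?thesis unfolding almost_integral_def using D E \<O>_closed(4) by (intro bexI[of _ "D * E"]) auto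
qed

lemma almost_integral_const: assumes "c \<in> \<O> q" "almost_integral f" shows "almost_integral (c * f)"
proof -
  obtain D where D: "D \<in> \<O> q" "D \<noteq> 0" "\<And>n. D * f ^ n \<in> \<Lambda>" using assms(2) by (auto simp: almost_integral_def)
  have "D * (c * f) ^ n = c ^ n * (D * f ^ n)" for n by (simp add: power_mult_distrib mult_ac)
  then show ?thesis unfolding almost_integral_def using D assms(1) \<O>_closed(7) \<Lambda>_scale by metis
qed

lemma almost_integral_sum: "(\<And>x. x \<in> X \<Longrightarrow> almost_integral (f x)) \<Longrightarrow> almost_integral (sum f X)"
proof (induction X rule: infinite_finite_induct)
  case (insert x X) then show ?case by (simp add: almost_integral_add)
next
  have 0: "almost_integral 0"
    unfolding almost_integral_def
    by (intro bexI[of _ 1]) (auto simp: \<O>_closed \<Lambda>_closed)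
  case (infinite X) then show ?case using 0 by simp
next
  case empty
  show ?case
    unfolding almost_integral_def
    by (intro bexI[of _ 1]) (auto simp: \<O>_closed \<Lambda>_closed)
qed

lemma almost_integral_\<sigma>: assumes "almost_integral f" shows "almost_integral (K.\<sigma> f)"
proof -
  obtain D where D: "D \<in> \<O> q" "D \<noteq> 0" "\<And>n. D * f ^ n \<in> \<Lambda>" using assms by (auto simp: almost_integral_def)
  have p: "K.\<sigma> (f ^ n) = K.\<sigma> f ^ n" for n
    by (induction n) (simp_all add: K.\<sigma>_const K.one_L K.\<sigma>_mult U)
  have "D * K.\<sigma> f ^ n = K.\<sigma> (D * f ^ n)" for n
    using D \<O>_L by (simp add: K.\<sigma>_mult U K.\<sigma>_const p)
  then show ?thesis unfolding almost_integral_def using D \<sigma>_\<Lambda> by metis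
qed

lemma almost_integral_weight:
  assumes "almost_integral f" "i < d" shows "almost_integral (cf f i * \<theta> ^ i)"
  unfolding K.weight_component[OF U assms(2)]
proof (intro almost_integral_const almost_integral_sum)
  have "of_nat n = const_ratfun (of_nat n)" for n by (induction n) (simp_all add: const_ratfun_simps)
  moreover have "inverse (const_ratfun (of_nat d)) = const_ratfun (inverse (of_nat d))"
    using d_pos const_ratfun_simps(4)[of "of_nat d" "inverse (of_nat d)"]
    by (intro inverse_unique) (simp add: const_ratfun_simps(1))
  ultimately show "inverse (of_nat d) \<in> \<O> q" using const_\<O> by simp
  show "\<zeta> ^ n \<in> \<O> q" for n by (rule \<zeta>_\<O>)
  show "almost_integral ((K.\<sigma> ^^ k) f)" for k
    by (induction k) (simp_all add: assms almost_integral_\<sigma>)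
qed

lemma almost_integral_\<Lambda>: assumes "almost_integral f" shows "f \<in> \<Lambda>"
proof (rule \<Lambda>_I)
  fix i assume i: "i < d"
  define g where "g = cf f i"
  have gL: "g \<in> L" using cf_L[OF i] by (simp add: g_def)
  obtain D where D: "D \<in> \<O> q" "D \<noteq> 0" "\<And>n. D * (g * \<theta> ^ i) ^ n \<in> \<Lambda>"
    using almost_integral_weight[OF assms i] by (auto simp: almost_integral_def g_def)
  have "g \<in> W i"
  proof (cases "i = 0")
    case True
    have "D * g ^ n \<in> \<O> q" for n
      using D(3)[of n] True \<Lambda>_L K.mult_L[OF \<O>_L[OF D(1)] K.power_L[OF gL]] by simp
    then show ?thesis using completely_integrally_closed[OF gL D(1,2)] True by (simp add: W_def)
  next
    case False
    have t: "g ^ d * (\<theta> ^ d) ^ i \<in> L"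
      by (rule K.mult_L[OF K.power_L[OF gL] K.power_L[OF K.\<theta>_power]])
    have "D * (g ^ d * (\<theta> ^ d) ^ i) ^ m \<in> \<O> q" for m
    proof (rule \<Lambda>_L)
      have "D * (g ^ d * (\<theta> ^ d) ^ i) ^ m = D * (g * \<theta> ^ i) ^ (d * m)"
      proof -
        have "(g ^ d * (\<theta> ^ d) ^ i) ^ m = ((g * \<theta> ^ i) ^ d) ^ m"
          by (simp add: power_mult_distrib mult.commute[of i] flip: power_mult)
        then show ?thesis by (simp only: power_mult)
      qed
      then show "D * (g ^ d * (\<theta> ^ d) ^ i) ^ m \<in> \<Lambda>" using D(3) by metis
      show "D * (g ^ d * (\<theta> ^ d) ^ i) ^ m \<in> L"
        by (rule K.mult_L[OF \<O>_L[OF D(1)] K.power_L[OF t]])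
    qed
    then have "g ^ d * (\<theta> ^ d) ^ i \<in> \<O> q"
      by (rule completely_integrally_closed[OF t D(1,2)])
    then obtain h where "h \<in> \<O> q" "g = \<rho> * h"
      using kummer_divisibility[OF ab gL _ i l] False unfolding \<theta>d \<rho>_def by auto
    then show ?thesis using \<rho>_W by simp
  qed
  then show "cf f i \<in> W i" by (simp add: g_def)
qed

text \<open>A denominator of a coefficient is multiplied by \<open>\<rho>\<close>, since this is needed in nonzero weights.\<close>

lemma common_denominator:
  assumes "finite X" obtains D where "D \<in> \<O> q" "D \<noteq> 0" "\<And>f. f \<in> X \<Longrightarrow> D * f \<in> \<Lambda>"
proof -
  have L: "\<exists>D\<in>\<O> q. D \<noteq> 0 \<and> (\<forall>i. D * f \<in> W i)" if "f \<in> L" for f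
  proof -
    from that obtain n G H where f: "homogeneous n G" "homogeneous n H" "H \<noteq> 0" "f = ev G / ev H" by (rule LE)
    have hn: "homogeneous n (lin l ^ n)" using homogeneous_power[OF homogeneous_lin, of n l] by simp
    have v: "value_at (lin l ^ n) q \<noteq> 0" using l by (simp add: value_simps value_lin)
    have *: "ev F / ev (lin l ^ n) \<in> \<O> q" if "homogeneous n F" for F using \<O>I[OF that hn v] .
    have nz: "ev H \<noteq> 0" "ev (lin l ^ n) \<noteq> 0" using f ev_eq_0_iff hn value_nz[OF v] by blast+
    show ?thesis
    proof (intro bexI[of _ "\<rho> * (ev H / ev (lin l ^ n))"] conjI allI)
      show "\<rho> * (ev H / ev (lin l ^ n)) \<in> \<O> q" using * f \<rho>_\<O> \<O>_closed by blast
      show "\<rho> * (ev H / ev (lin l ^ n)) \<noteq> 0" using nz \<rho>_nz by simp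
      have "\<rho> * (ev H / ev (lin l ^ n)) * f = \<rho> * (ev G / ev (lin l ^ n))" using f(4) nz by simp
      then show "\<rho> * (ev H / ev (lin l ^ n)) * f \<in> W i" for i using \<rho>_W[OF *[OF f(1)]] by metis
    qed
  qed
  have 1: "\<exists>D\<in>\<O> q. D \<noteq> 0 \<and> D * f \<in> \<Lambda>" for f
  proof -
    have "\<exists>D. \<forall>i. i < d \<longrightarrow> D i \<in> \<O> q \<and> D i \<noteq> 0 \<and> (\<forall>k. D i * cf f i \<in> W k)"
      using L[OF cf_L] by (intro choice) blast
    then obtain D where D: "\<And>i. i < d \<Longrightarrow> D i \<in> \<O> q \<and> D i \<noteq> 0 \<and> (\<forall>k. D i * cf f i \<in> W k)" by blast
    define E where "E = (\<Prod>i<d. D i)"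
    have E: "E \<in> \<O> q" unfolding E_def by (rule subring_prod[OF subring_\<O>]) (use D in auto)
    have "E * f \<in> \<Lambda>"
    proof (rule \<Lambda>_I)
      fix i assume i: "i < d"
      have "E = (\<Prod>j\<in>{..<d} - {i}. D j) * D i" unfolding E_def using i by (simp add: prod.remove mult.commute)
      moreover have "(\<Prod>j\<in>{..<d} - {i}. D j) \<in> \<O> q" by (rule subring_prod[OF subring_\<O>]) (use D in auto)
      moreover have "cf (E * f) i = E * cf f i" using K.cf_scale[OF \<O>_L[OF E] U i] .
      ultimately show "cf (E * f) i \<in> W i"
        using D[OF i] W_closed(3)[of "\<Prod>j\<in>{..<d} - {i}. D j" "D i * cf f i" i] by (metis mult.assoc)
    qed
    moreover have "E \<noteq> 0" unfolding E_def using D by simp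
    ultimately show ?thesis using E by blast
  qed
  have "\<exists>D\<in>\<O> q. D \<noteq> 0 \<and> (\<forall>f\<in>X. D * f \<in> \<Lambda>)"
    using assms
  proof induction
    case empty show ?case by (intro bexI[of _ 1]) (simp_all add: \<O>_closed)
  next
    case (insert f X)
    then obtain D where D: "D \<in> \<O> q" "D \<noteq> 0" "\<forall>f\<in>X. D * f \<in> \<Lambda>" by blast
    obtain E where E: "E \<in> \<O> q" "E \<noteq> 0" "E * f \<in> \<Lambda>" using 1 by blast
    show ?case
    proof (intro bexI[of _ "D * E"] conjI ballI)
      fix g assume "g \<in> insert f X"
      then show "D * E * g \<in> \<Lambda>"
        using D E \<Lambda>_scale[of D "E * f"] \<Lambda>_scale[of E "D * g"] by (auto simp: mult_ac)
    qed (use D E \<O>_closed in auto)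
  qed
  then show ?thesis using that by blast
qed

text \<open>Finitely many generators have a common denominator, which then serves for all powers of all elements.\<close>

lemma finite_algebra_integral:
  assumes B: "is_subring B" and A: "A \<subseteq> \<O> q" and fin: "finite_module A B"
  shows "B \<subseteq> \<Lambda>"
proof
  fix f assume f: "f \<in> B"
  obtain X where X: "finite X" "B = {\<Sum>b\<in>X. c b * b | c. c ` X \<subseteq> A}"
    using fin unfolding finite_module_def by blast
  obtain D where D: "D \<in> \<O> q" "D \<noteq> 0" "\<And>f. f \<in> X \<Longrightarrow> D * f \<in> \<Lambda>" using common_denominator[OF X(1)] by blast
  have "D * g \<in> \<Lambda>" if "g \<in> B" for g
  proof -
    from that obtain c where c: "g = (\<Sum>b\<in>X. c b * b)" "c ` X \<subseteq> A" using X by blast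
    have "D * g = (\<Sum>b\<in>X. c b * (D * b))" unfolding c by (simp add: sum_distrib_left mult_ac)
    also have "\<dots> \<in> \<Lambda>" using c A by (intro \<Lambda>_sum \<Lambda>_scale D(3)) auto
    finally show ?thesis .
  qed
  then have "almost_integral f"
    unfolding almost_integral_def using D subring_closed(7)[OF B f] by blast
  then show "f \<in> \<Lambda>" by (rule almost_integral_\<Lambda>)
qed

end

end

context kummer_cover
begin

section \<open>Total ramification over the branch lines\<close>

context
  fixes q l :: "complex ^ 3"
  assumes l: "dotp l q \<noteq> 0" and aq: "dotp a q = 0"
begin

text \<open>Modulo \<open>a / l\<close>, products of components of nonzero weights have no component of weight \<open>0\<close>.\<close>

lemma cf_0_mult:
  assumes "f \<in> \<Lambda> q l" "g \<in> \<Lambda> q l"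
  shows "\<exists>h\<in>\<O> q. cf (f * g) 0 = cf f 0 * cf g 0 + (dlin a / dlin l) * h"
proof -
  define I where "I = {\<alpha> * (dlin a / dlin l) | \<alpha>. \<alpha> \<in> \<O> q}"
  have "I = {\<alpha> * (dlin a / dlin l) + \<beta> * 0 | \<alpha> \<beta>. \<alpha> \<in> \<O> q \<and> \<beta> \<in> \<O> q}"
    unfolding I_def using \<O>_closed(2) by auto
  then have I: "is_ideal (\<O> q) I"
    using is_ideal_gen2[OF subring_\<O> dlin_\<O>[OF l] \<O>_closed(2)] by simp
  let ?t = "\<lambda>i j. (cf f i * cf g j) * \<theta> ^ (i + j)" and ?e = "\<lambda>i j. if j = 0 then if i = 0 then cf f 0 * cf g 0 else 0 else 0"
  have t: "cf (?t i j) 0 - ?e i j \<in> I" if ij: "i < d" "j < d" for i j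
  proof (rule weight_product[OF l ij \<Lambda>_W[OF l assms(1) ij(1)] \<Lambda>_W[OF l assms(2) ij(2)]])
    fix h assume h: "0 < i" "h \<in> \<O> q"
      and c: "\<And>k. k < d \<Longrightarrow> cf (?t i j) k = (if k = i + j - d then \<rho> l * (dlin a / dlin l) * h else 0)"
    have "\<rho> l * (dlin a / dlin l) * h = (\<rho> l * h) * (dlin a / dlin l)" by simp
    then have "\<rho> l * (dlin a / dlin l) * h \<in> I"
      unfolding I_def using \<rho>_\<O>[OF l] h \<O>_closed(4) by blast
    then show ?thesis using c[OF d_pos] h ideal_closed(1)[OF I] by simp
  next
    assume "\<And>k. k < d \<Longrightarrow> cf (?t i j) k = (if k = i + j then cf f i * cf g j else 0)"
    then show ?thesis using d_pos ideal_closed(1)[OF I] by auto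
  qed
  have "cf (f * g) 0 - cf f 0 * cf g 0 = (\<Sum>i<d. \<Sum>j<d. cf (?t i j) 0) - (\<Sum>i<d. \<Sum>j<d. ?e i j)"
    unfolding K.mult_expand[OF U U, of f g] using d_pos by (simp add: cf_simps)
  also have "\<dots> = (\<Sum>i<d. \<Sum>j<d. cf (?t i j) 0 - ?e i j)" by (simp only: sum_subtractf)
  also have "\<dots> \<in> I" using t by (intro ideal_sum[OF I]) auto
  finally obtain h where "h \<in> \<O> q" "cf (f * g) 0 - cf f 0 * cf g 0 = h * (dlin a / dlin l)"
    unfolding I_def by blast
  then show ?thesis by (intro bexI[of _ h]) (simp_all add: algebra_simps)
qed

lemma al_\<mm>: "dlin a / dlin l \<in> \<mm> q"
  using dlin_\<mm>[OF l] aq by simp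

lemma cf_0_\<O>: "f \<in> \<Lambda> q l \<Longrightarrow> cf f 0 \<in> \<O> q"
  using \<Lambda>_W[OF l, of f 0] d_pos by (simp add: W_def[OF l])

lemma cf_0_mult_\<mm>:
  assumes "f \<in> \<Lambda> q l" "g \<in> \<Lambda> q l"
  shows "cf (f * g) 0 \<in> \<mm> q \<longleftrightarrow> cf f 0 \<in> \<mm> q \<or> cf g 0 \<in> \<mm> q"
proof -
  obtain h where h: "h \<in> \<O> q" "cf (f * g) 0 = cf f 0 * cf g 0 + (dlin a / dlin l) * h"
    using cf_0_mult[OF assms] by blast
  have m: "(dlin a / dlin l) * h \<in> \<mm> q" "- ((dlin a / dlin l) * h) \<in> \<mm> q"
    using \<mm>_closed(5)[OF al_\<mm> h(1)] \<mm>_closed(5)[OF al_\<mm> \<O>_closed(5)[OF h(1)]] by simp_all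
  have "cf (f * g) 0 \<in> \<mm> q \<longleftrightarrow> cf f 0 * cf g 0 \<in> \<mm> q"
    using \<mm>_closed(3)[OF _ m(1), of "cf f 0 * cf g 0"] \<mm>_closed(3)[OF _ m(2), of "cf (f * g) 0"] h(2) by auto
  then show ?thesis
    using \<mm>_prime[OF cf_0_\<O>[OF assms(1)] cf_0_\<O>[OF assms(2)]] \<mm>_closed(4,5) cf_0_\<O> assms by blast
qed

text \<open>The norm reduces this to the local ring downstairs, the conjugates having the same component of weight \<open>0\<close>.\<close>

lemma \<Lambda>_unit: assumes f: "f \<in> \<Lambda> q l" "cf f 0 \<notin> \<mm> q" shows "inverse f \<in> \<Lambda> q l"
proof -
  have \<sigma>: "(K.\<sigma> ^^ k) f \<in> \<Lambda> q l \<and> cf ((K.\<sigma> ^^ k) f) 0 \<notin> \<mm> q" for k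
    by (induction k) (simp_all add: f \<sigma>_\<Lambda>[OF l] K.cf_\<sigma>[OF U] d_pos)
  have "(\<Prod>k\<in>X. (K.\<sigma> ^^ k) f) \<in> \<Lambda> q l \<and> cf (\<Prod>k\<in>X. (K.\<sigma> ^^ k) f) 0 \<notin> \<mm> q" for X
    by (induction X rule: infinite_finite_induct)
       (simp_all add: \<Lambda>_closed[OF l] cf_simps K.one_L d_pos one_\<mm> \<sigma> cf_0_mult_\<mm>)
  then have c: "K.conj_prod f \<in> \<Lambda> q l" "cf (K.conj_prod f) 0 \<notin> \<mm> q"
    unfolding K.conj_prod_def by blast+
  define h where "h = f * K.conj_prod f"
  have "h \<in> L" unfolding h_def by (rule K.norm_L[OF U])
  moreover have h\<Lambda>: "h \<in> \<Lambda> q l" unfolding h_def using f c \<Lambda>_closed[OF l] by blast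
  ultimately have "h \<in> \<O> q" "cf h 0 = h" using \<Lambda>_L[OF l] by (auto simp: cf_simps d_pos)
  moreover have "cf h 0 \<notin> \<mm> q" unfolding h_def cf_0_mult_\<mm>[OF f(1) c(1)] using f c by simp
  ultimately have "inverse h \<in> \<Lambda> q l" "h \<noteq> 0" using \<O>_inverse \<O>_\<Lambda>[OF l] \<mm>_closed(1) by metis+
  moreover from this have "inverse f = K.conj_prod f * inverse h"
    unfolding h_def by (simp add: field_simps)
  ultimately show ?thesis using c \<Lambda>_closed[OF l] by metis
qed

lemma nonunits_\<Lambda>: "f \<in> nonunits (\<Lambda> q l) \<longleftrightarrow> f \<in> \<Lambda> q l \<and> cf f 0 \<in> \<mm> q"
proof
  assume f: "f \<in> nonunits (\<Lambda> q l)"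
  show "f \<in> \<Lambda> q l \<and> cf f 0 \<in> \<mm> q"
  proof (cases "f = 0")
    case True then show ?thesis by (simp add: \<Lambda>_closed[OF l] cf_simps K.zero_L d_pos \<mm>_closed(1))
  next
    case False then show ?thesis using f \<Lambda>_unit by (auto simp: nonunits_def)
  qed
next
  assume f: "f \<in> \<Lambda> q l \<and> cf f 0 \<in> \<mm> q"
  have "inverse f \<notin> \<Lambda> q l" if "f \<noteq> 0"
  proof
    assume "inverse f \<in> \<Lambda> q l"
    then have "cf (f * inverse f) 0 \<in> \<mm> q" using f cf_0_mult_\<mm> by blast
    then show False using that by (simp add: cf_simps K.one_L d_pos one_\<mm>)
  qed
  then show "f \<in> nonunits (\<Lambda> q l)" using f by (auto simp: nonunits_def)
qed

lemma \<rho>_\<theta>_power: "0 < i \<Longrightarrow> i < d \<Longrightarrow> (\<rho> l * \<theta> ^ i) ^ d = \<rho> l ^ (d - i) * (dlin a / dlin l) ^ i"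
proof -
  assume i: "0 < i" "i < d"
  have "(\<rho> l * \<theta> ^ i) ^ d = \<rho> l ^ (d - i + i) * (\<theta> ^ d) ^ i"
    using i by (simp add: power_mult_distrib mult.commute[of i] flip: power_mult)
  also have "\<dots> = \<rho> l ^ (d - i) * (\<rho> l * \<theta> ^ d) ^ i"
    by (simp only: power_add power_mult_distrib mult.assoc)
  finally show ?thesis by (simp only: \<rho>_\<theta>[OF l])
qed

text \<open>
  The components of nonzero weights are nilpotent modulo the maximal ideal of the local ring at \<open>q\<close>.
  Hence only one point of a normal cover lies over \<open>q\<close>.
\<close>

lemma ramified_local_ring:
  assumes B: "is_subring B" and J: "is_maximal_ideal B J" and S: "S = localize B J" and B\<Lambda>: "B \<subseteq> \<Lambda> q l"
    and normal: "normal_ring S" and dom: "dominates S (\<O> q)"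
  shows "S = \<Lambda> q l"
proof -
  note loc = localization[OF B J, folded S]
  note c = subring_closed[OF loc(1)] and Ic = ideal_closed[OF loc(5)]
  have \<O>S: "\<O> q \<subseteq> S" and \<mm>S: "\<mm> q \<subseteq> nonunits S" using dom by (auto simp: dominates_def)
  have \<rho>S: "\<rho> l * \<theta> ^ i \<in> S" and \<rho>m: "\<rho> l * \<theta> ^ i \<in> nonunits S" if i: "0 < i" "i < d" for i
  proof -
    have "(\<rho> l * \<theta> ^ i) ^ d \<in> \<mm> q"
    proof -
      have "(dlin a / dlin l) ^ i = (dlin a / dlin l) ^ (i - 1) * (dlin a / dlin l)"
        using i by (simp add: power_eq_if)
      then have "\<rho> l ^ (d - i) * (dlin a / dlin l) ^ i = (\<rho> l ^ (d - i) * (dlin a / dlin l) ^ (i - 1)) * (dlin a / dlin l)"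
        by simp
      then show ?thesis
        unfolding \<rho>_\<theta>_power[OF i] using al_\<mm> \<rho>_\<O>[OF l] dlin_\<O>[OF l] \<O>_closed(4,7) \<mm>_closed(4) by metis
    qed
    then have p: "(\<rho> l * \<theta> ^ i) ^ d \<in> nonunits S" using \<mm>S by blast
    then have "(\<rho> l * \<theta> ^ i) ^ d \<in> S" by (simp add: nonunits_def)
    then show "\<rho> l * \<theta> ^ i \<in> S" using normal_ring_root[OF normal loc(1) d_pos] by blast
    then show "\<rho> l * \<theta> ^ i \<in> nonunits S" using subring_nonunit_power[OF loc(1)] p by blast
  qed
  have comp: "\<exists>g\<in>\<O> q. cf f i * \<theta> ^ i = g * (\<rho> l * \<theta> ^ i)" if f: "f \<in> \<Lambda> q l" and i: "0 < i" "i < d" for f i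
  proof -
    obtain g where "g \<in> \<O> q" "cf f i = \<rho> l * g" using W_E[OF l \<Lambda>_W[OF l f i(2)] i(1)] by blast
    then show ?thesis by (intro bexI[of _ g]) simp_all
  qed
  have \<Lambda>S: "\<Lambda> q l \<subseteq> S"
  proof
    fix f assume f: "f \<in> \<Lambda> q l"
    have "(\<Sum>i<d. cf f i * \<theta> ^ i) \<in> S"
    proof (rule subring_sum[OF loc(1)])
      fix i assume i: "i \<in> {..<d}"
      show "cf f i * \<theta> ^ i \<in> S"
      proof (cases "i = 0")
        case True then show ?thesis using \<O>S cf_0_\<O>[OF f] by auto
      next
        case False
        then show ?thesis using comp[OF f, of i] \<rho>S[of i] \<O>S c(4) i by (metis lessThan_iff neq0_conv subsetD)
      qed
    qed
    then show "f \<in> S" using expand[of f] by simp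
  qed
  have J0: "cf g 0 \<notin> \<mm> q" if g: "g \<in> B" "g \<notin> J" for g
  proof
    assume g0: "cf g 0 \<in> \<mm> q"
    have g\<Lambda>: "g \<in> \<Lambda> q l" using g B\<Lambda> by blast
    have "(\<Sum>i<d. cf g i * \<theta> ^ i) \<in> nonunits S"
    proof (rule ideal_sum[OF loc(5)])
      fix i assume i: "i \<in> {..<d}"
      show "cf g i * \<theta> ^ i \<in> nonunits S"
      proof (cases "i = 0")
        case True then show ?thesis using \<mm>S g0 by auto
      next
        case False
        then show ?thesis using comp[OF g\<Lambda>, of i] \<rho>m[of i] \<O>S Ic(4) i by (metis lessThan_iff neq0_conv subsetD)
      qed
    qed
    then have "g / 1 \<in> nonunits S" using expand[of g] by simp
    moreover have "1 \<notin> J" using loc(4)[of 1 1] loc(6) subring_closed(1)[OF B] J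
        ideal_closed[of B J] by (metis is_maximal_ideal_def mult.right_neutral subsetI subset_antisym)
    ultimately show False using loc(4)[OF g(1) subring_closed(1)[OF B]] g(2) by blast
  qed
  have "S \<subseteq> \<Lambda> q l"
  proof
    fix x assume "x \<in> S"
    then obtain f g where x: "x = f / g" "f \<in> B" "g \<in> B" "g \<notin> J" unfolding S localize_def by blast
    then have "inverse g \<in> \<Lambda> q l" using J0 \<Lambda>_unit B\<Lambda> by blast
    then show "x \<in> \<Lambda> q l" using x B\<Lambda> \<Lambda>_closed(4)[OF l, of f "inverse g"] by (auto simp: divide_inverse)
  qed
  then show ?thesis using \<Lambda>S by blast
qed

lemma \<rho>_\<theta>_\<Lambda>: "\<rho> l * \<theta> \<in> nonunits (\<Lambda> q l)" and cf_\<rho>_\<theta>: "k < d \<Longrightarrow> cf (\<rho> l * \<theta>) k = (if k = 1 then \<rho> l else 0)"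
proof -
  have \<rho>L: "\<rho> l \<in> L" using \<rho>_\<O>[OF l] \<O>_L by blast
  show c: "k < d \<Longrightarrow> cf (\<rho> l * \<theta>) k = (if k = 1 then \<rho> l else 0)" for k
    using K.cf_power[OF \<rho>L, of k 1] d2 by simp
  show "\<rho> l * \<theta> \<in> nonunits (\<Lambda> q l)"
    unfolding nonunits_\<Lambda> using \<rho>_W[OF l \<O>_closed(1)] d_pos
    by (auto intro!: \<Lambda>_I[OF l] simp: c W_closed[OF l] \<mm>_closed(1))
qed

text \<open>
  If the local coordinates at \<open>q\<close> generated the maximal ideal upstairs, the component of
  weight \<open>1\<close> would express the generator \<open>\<rho> \<theta>\<close> of its module by \<open>\<mm> \<rho> \<theta>\<close>.
\<close>

lemma not_local_biholomorphism: "\<not> local_biholomorphism T (\<Lambda> q l) q"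
proof
  assume "local_biholomorphism T (\<Lambda> q l) q"
  then obtain s t where st: "\<mm> q = ideal_gen (\<O> q) {s, t}" "nonunits (\<Lambda> q l) = ideal_gen (\<Lambda> q l) {s, t}"
    unfolding local_biholomorphism_def by blast
  have m: "s \<in> \<mm> q" "t \<in> \<mm> q" using hull_subset[of "{s, t}" "is_ideal (\<O> q)"] st(1) by (auto simp: ideal_gen_def)
  then have stO: "s \<in> \<O> q" "t \<in> \<O> q" using \<mm>_\<O> by auto
  then have "s \<in> \<Lambda> q l" "t \<in> \<Lambda> q l" using \<O>_\<Lambda>[OF l] by auto
  then obtain \<alpha> \<beta> where \<alpha>: "\<rho> l * \<theta> = \<alpha> * s + \<beta> * t" "\<alpha> \<in> \<Lambda> q l" "\<beta> \<in> \<Lambda> q l"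
    using \<rho>_\<theta>_\<Lambda> unfolding st(2) ideal_gen2[OF \<Lambda>_subring[OF l] \<open>s \<in> \<Lambda> q l\<close> \<open>t \<in> \<Lambda> q l\<close>] by blast
  have d1: "1 < d" using d2 by simp
  obtain g h where g: "g \<in> \<O> q" "cf \<alpha> 1 = \<rho> l * g" and h: "h \<in> \<O> q" "cf \<beta> 1 = \<rho> l * h"
    using W_E[OF l \<Lambda>_W[OF l _ d1]] \<alpha> by (metis zero_less_one)
  have "\<rho> l = cf (s * \<alpha> + t * \<beta>) 1" using cf_\<rho>_\<theta>[OF d1] \<alpha>(1) by (simp add: mult.commute)
  also have "\<dots> = s * cf \<alpha> 1 + t * cf \<beta> 1" using stO \<O>_L d1 by (simp add: cf_simps)
  also have "\<dots> = \<rho> l * (s * g + t * h)" using g h by (simp add: algebra_simps)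
  finally have "1 = s * g + t * h" using \<rho>_nz[OF l] by simp
  also have "\<dots> \<in> \<mm> q" using m g h by (intro \<mm>_closed(3,5))
  finally show False using one_\<mm> by blast
qed

end

section \<open>The Stein factorization\<close>

lemma dlin_sum: "(\<Sum>i\<in>UNIV. const_ratfun (h $ i) * T $ i) = dlin h"
  by (simp add: dlin_dotp dotp_def)

lemma chart_ring_\<O>: assumes "dotp h q \<noteq> 0" shows "chart_ring T h \<subseteq> \<O> q"
proof
  fix f assume "f \<in> chart_ring T h"
  then obtain n G where f: "f = ev G / dlin h ^ n" "homogeneous n G" unfolding chart_ring_def dlin_sum by blast
  have hn: "homogeneous n (lin h ^ n)" using homogeneous_power[OF homogeneous_lin, of n h] by simp
  have "dlin h ^ n = ev (lin h ^ n)" by (simp add: dlin_def ev_simps)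
  then show "f \<in> \<O> q" using f \<O>I[OF f(2) hn] assms by (simp add: value_simps value_lin)
qed

lemma chart_ringI: "homogeneous n G \<Longrightarrow> ev G / dlin h ^ n \<in> chart_ring T h"
  unfolding chart_ring_def dlin_sum by blast

lemma const_chart_ring: "const_ratfun c \<in> chart_ring T h"
  using chart_ringI[OF homogeneous_cst, of c h] by (simp add: eval3_cst[OF const_ratfun_hom])

context
  fixes Y N
  assumes res: "resolution T Y" and st: "stein_factorization T Y N"
begin

lemma direct_image_subring: "is_subring (direct_image_ring T Y h)"
proof -
  have "is_subring R" if "R \<in> Y" for R
    using iterated_blowup_subring res that by (auto simp: resolution_def)
  then show ?thesis unfolding is_subring_def direct_image_ring_def by blast
qed

lemma chart_direct_image: "chart_ring T h \<subseteq> direct_image_ring T Y h"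
proof
  fix f assume f: "f \<in> chart_ring T h"
  show "f \<in> direct_image_ring T Y h"
    unfolding direct_image_ring_def
  proof (intro CollectI ballI allI impI)
    fix R q assume "R \<in> Y" "lies_over T R q \<and> (\<Sum>i\<in>UNIV. h $ i * q $ i) \<noteq> 0"
    then have "dotp h q \<noteq> 0" "\<O> q \<subseteq> R" by (auto simp: lies_over_def dominates_def dotp_def)
    then show "f \<in> R" using chart_ring_\<O> f by blast
  qed
qed

text \<open>
  The functions on the preimage of a chart form a finite algebra over the ring of the chart, hence are integral over
  its local rings.
\<close>

lemma direct_image_\<Lambda>:
  assumes "dotp h q \<noteq> 0" "dotp l q \<noteq> 0" shows "direct_image_ring T Y h \<subseteq> \<Lambda> q l"
proof -
  have "h \<noteq> 0" using assms by auto
  then have "finite_module (chart_ring T h) (direct_image_ring T Y h)"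
    using st by (auto simp: stein_factorization_def)
  then show ?thesis
    using finite_algebra_integral[OF assms(2) direct_image_subring chart_ring_\<O>[OF assms(1)]] by blast
qed

lemma cover_normal: "S \<in> N \<Longrightarrow> normal_ring S"
  using st by (auto simp: stein_factorization_def)

text \<open>
  A point over \<open>q\<close> comes from a chart \<open>h\<close> containing \<open>q\<close>: otherwise \<open>h / l\<close> vanishes at \<open>q\<close>, while its
  inverse is regular on the chart.
\<close>

lemma cover_point:
  assumes S: "S \<in> N" "lies_over T S q" and l: "dotp l q \<noteq> 0"
  obtains B J where "is_subring B" "is_maximal_ideal B J" "S = localize B J" "B \<subseteq> \<Lambda> q l"
proof -
  obtain h J where h: "h \<noteq> 0" "S = localize (direct_image_ring T Y h) J" "is_maximal_ideal (direct_image_ring T Y h) J"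
    using S(1) st unfolding stein_factorization_def closed_points_def by auto
  note loc = localization[OF direct_image_subring h(3), folded h(2)]
  have "dotp h q \<noteq> 0"
  proof
    assume 0: "dotp h q = 0"
    have "dlin h / dlin l \<in> \<mm> q" using dlin_\<mm>[OF l] 0 by simp
    then have "dlin h / dlin l \<in> nonunits S" using S(2) by (auto simp: lies_over_def dominates_def)
    moreover have "dlin l / dlin h \<in> S"
      using chart_ringI[OF homogeneous_lin, of l h] chart_direct_image loc(2) by (auto simp: dlin_def)
    moreover have "dlin h / dlin l \<noteq> 0" using dlin_nz[OF h(1)] dlin_nz[OF dotp_nz[OF l]] by simp
    ultimately show False by (auto simp: nonunits_def)
  qed
  then show ?thesis using that[OF direct_image_subring h(3,2)] direct_image_\<Lambda> l by blast
qed

text \<open>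
  Such a point exists, since the functions whose component of weight \<open>0\<close> vanishes at \<open>q\<close> form a maximal
  ideal.
\<close>

lemma points_over_branch_line:
  assumes l: "dotp l q \<noteq> 0" and aq: "dotp a q = 0"
  shows "{S \<in> N. lies_over T S q} = {\<Lambda> q l}"
proof -
  have q: "q \<noteq> 0" using l by auto
  have sub: "S = \<Lambda> q l" if S: "S \<in> N" "lies_over T S q" for S
  proof (rule cover_point[OF S l])
    fix B J assume *: "is_subring B" "is_maximal_ideal B J" "S = localize B J" "B \<subseteq> \<Lambda> q l"
    show ?thesis
      by (rule ramified_local_ring[OF l aq * cover_normal[OF S(1)]]) (use S in \<open>simp add: lies_over_def\<close>)
  qed
  define B where "B = direct_image_ring T Y l"
  define J where "J = {f \<in> B. cf f 0 \<in> \<mm> q}"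
  have B: "is_subring B" unfolding B_def by (rule direct_image_subring)
  note Bc = subring_closed[OF B]
  have B\<Lambda>: "B \<subseteq> \<Lambda> q l" unfolding B_def by (rule direct_image_\<Lambda>[OF l l])
  have chart: "chart_ring T l \<subseteq> B" unfolding B_def by (rule chart_direct_image)
  have c\<O>: "cf f 0 = f" if "f \<in> \<O> q" for f using that \<O>_L by (simp add: cf_simps d_pos)
  have ideal: "is_ideal B J"
    unfolding is_ideal_def
  proof (intro conjI ballI)
    show "J \<subseteq> B" by (auto simp: J_def)
    show "0 \<in> J" using Bc \<mm>_closed(1) by (simp add: J_def cf_simps K.zero_L d_pos)
    show "f + g \<in> J" if "f \<in> J" "g \<in> J" for f g
      using that Bc(6) \<mm>_closed(3) by (simp add: J_def cf_simps d_pos)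
    show "f * g \<in> J" if "f \<in> B" "g \<in> J" for f g
      using that Bc(4) cf_0_mult_\<mm>[OF l aq, of f g] B\<Lambda> unfolding J_def by blast
  qed
  have "J' = J \<or> J' = B" if J': "is_ideal B J'" "J \<subseteq> J'" for J'
  proof (rule ccontr)
    assume *: "\<not> (J' = J \<or> J' = B)"
    note J'c = ideal_closed[OF J'(1)]
    obtain f where f: "f \<in> J'" "f \<notin> J" using * J' by blast
    then have fB: "f \<in> B" using J'c(2) by blast
    then have "cf f 0 \<in> \<O> q" using cf_0_\<O>[OF l aq] B\<Lambda> by blast
    then obtain c where c: "cf f 0 - const_ratfun c \<in> \<mm> q" by (rule residue)
    have cB: "const_ratfun x \<in> B" for x using const_chart_ring chart by blast
    have "cf ((f - const_ratfun c) + const_ratfun c) 0 = cf (f - const_ratfun c) 0 + cf (const_ratfun c) 0"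
      by (rule K.cf_add[OF U U d_pos])
    then have "cf (f - const_ratfun c) 0 = cf f 0 - const_ratfun c" by (simp add: c\<O>[OF const_\<O>])
    then have "f - const_ratfun c \<in> J" using c fB cB Bc(3) by (simp add: J_def)
    then have "f + (-1) * (f - const_ratfun c) \<in> J'" using J'(2) f J'c(3,4) Bc(1,5) by blast
    then have cJ: "const_ratfun c \<in> J'" by simp
    have "c \<noteq> 0" using c f fB by (auto simp: J_def const_ratfun_simps)
    then have "1 = const_ratfun (inverse c) * const_ratfun c" by (simp add: const_ratfun_simps(1) flip: const_ratfun_simps(4))
    then have "1 \<in> J'" using J'c(4)[OF cB cJ] by metis
    then have "J' = B" using J'c(2) J'c(4)[of _ 1] by auto
    then show False using * by blast
  qed
  moreover have "1 \<in> B - J" using Bc(1) one_\<mm> by (simp add: J_def cf_simps K.one_L d_pos)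
  ultimately have max: "is_maximal_ideal B J" unfolding is_maximal_ideal_def using ideal by blast
  note loc = localization[OF B max]
  define S where "S = localize B J"
  have "l \<noteq> 0" using l by auto
  then have SN: "S \<in> N"
    using st max unfolding stein_factorization_def closed_points_def S_def B_def by blast
  have frac: "\<exists>f g. x = f / g \<and> f \<in> B \<and> g \<in> B \<and> g \<notin> J \<and> f \<in> \<O> q \<and> g \<in> \<O> q" if "x \<in> \<O> q" for x
  proof -
    from that obtain n G H where x: "homogeneous n G" "homogeneous n H" "value_at H q \<noteq> 0" "ev H \<noteq> 0" "x = ev G / ev H"
      by (rule \<O>E)
    have hn: "homogeneous n (lin l ^ n)" using homogeneous_power[OF homogeneous_lin, of n l] by simp
    have e: "dlin l ^ n = ev (lin l ^ n)" by (simp add: dlin_def ev_simps)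
    have *: "ev F / dlin l ^ n \<in> B \<and> ev F / dlin l ^ n \<in> \<O> q" if "homogeneous n F" for F
      using chart_ringI[OF that] chart chart_ring_\<O>[OF l] by blast
    have "ev H / dlin l ^ n \<notin> \<mm> q"
      unfolding e using \<O>_unit_iff[OF x(2) hn] l x(3) by (simp add: value_simps value_lin)
    then have "ev H / dlin l ^ n \<notin> J" using c\<O> * x(2) by (simp add: J_def)
    moreover have "x = (ev G / dlin l ^ n) / (ev H / dlin l ^ n)"
      using x dlin_nz[OF dotp_nz[OF l]] by simp
    ultimately show ?thesis using * x by blast
  qed
  have "dominates S (\<O> q)"
    unfolding dominates_def
  proof (intro conjI subsetI)
    fix x assume "x \<in> \<O> q"
    then show "x \<in> S" using frac unfolding S_def localize_def by blast
  next
    fix x assume x: "x \<in> \<mm> q"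
    then obtain f g where fg: "x = f / g" "f \<in> B" "g \<in> B" "g \<notin> J" "f \<in> \<O> q" "g \<in> \<O> q"
      using frac \<mm>_\<O> by meson
    have "g \<noteq> 0" using fg(4) ideal_closed(1)[OF ideal] by blast
    then have "f = g * x" using fg(1) by simp
    then have "f \<in> \<mm> q" using x fg(6) \<mm>_closed(4) by simp
    then have "f \<in> J" using fg c\<O> by (simp add: J_def)
    then show "x \<in> nonunits S" unfolding S_def fg(1) using loc(4)[OF fg(2-4)] by blast
  qed
  then have "lies_over T S q" using q by (simp add: lies_over_def)
  then show ?thesis using sub SN by blast
qed

text \<open>
  Away from the two lines, \<open>\<theta>\<^sup>d\<close> is a unit at \<open>q\<close> with residue \<open>c \<noteq> 0\<close>, so that \<open>\<theta>\<close> is congruent to a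
  simple root \<open>z\<close> of \<open>X\<^sup>d - c\<close>, and \<open>\<theta> - z\<close> is a multiple of \<open>\<theta>\<^sup>d - c\<close>.
\<close>

lemma unramified:
  assumes S: "S \<in> N" "lies_over T S q" and aq: "dotp a q \<noteq> 0" and bq: "dotp b q \<noteq> 0"
  shows "local_biholomorphism T S q"
proof (rule cover_point[OF S bq])
  fix B J assume B: "is_subring B" and J: "is_maximal_ideal B J" and SJ: "S = localize B J" and B\<Lambda>: "B \<subseteq> \<Lambda> q b"
  note loc = localization[OF B J, folded SJ]
  note c = subring_closed[OF loc(1)] and Ic = ideal_closed[OF loc(5)]
  have \<O>S: "\<O> q \<subseteq> S" and \<mm>S: "\<mm> q \<subseteq> nonunits S" using S by (auto simp: dominates_def lies_over_def)
  have q: "q \<noteq> 0" using aq by auto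
  obtain e f where ef: "independent2 e f" "dotp e q = 0" "dotp f q = 0"
  proof -
    obtain k where k: "q $ k \<noteq> 0" using q by (auto simp: vec_eq_iff)
    have *: "independent2 (crossp q u) (crossp q v)" if "dotp q (crossp u v) \<noteq> 0" for u v
    proof -
      have "crossp (crossp q u) (crossp q v) = dotp q (crossp u v) *s q"
        by (simp add: vec3_simps algebra_simps)
      then show ?thesis using that q unfolding independent2_def by (metis vector_mul_eq_0)
    qed
    have "\<exists>u v. dotp q (crossp u v) \<noteq> 0"
    proof -
      have "dotp q (crossp (axis 2 1) (axis 3 1)) = q $ 1" "dotp q (crossp (axis 3 1) (axis 1 1)) = q $ 2"
        "dotp q (crossp (axis 1 1) (axis 2 1)) = q $ 3"
        by (simp_all add: dotp_3 axis_def)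
      then show ?thesis using k exhaust_3[of k] by metis
    qed
    moreover have "dotp (crossp q u) q = 0" for u by (simp add: dotp_3 algebra_simps)
    ultimately show ?thesis using * that by blast
  qed
  define s t where "s = dlin e / dlin b" and "t = dlin f / dlin b"
  have m: "\<mm> q = ideal_gen (\<O> q) {s, t}" unfolding s_def t_def by (rule \<mm>_generators[OF ef bq])
  have stm: "s \<in> \<mm> q" "t \<in> \<mm> q" unfolding s_def t_def using ef dlin_\<mm>[OF bq] by auto
  then have stO: "s \<in> \<O> q" "t \<in> \<O> q" using \<mm>_\<O> by auto
  then have stS: "s \<in> S" "t \<in> S" using \<O>S by auto
  define I where "I = ideal_gen S {s, t}"
  have I_eq: "I = {\<alpha> * s + \<beta> * t | \<alpha> \<beta>. \<alpha> \<in> S \<and> \<beta> \<in> S}" unfolding I_def by (rule ideal_gen2[OF loc(1) stS])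
  have I: "is_ideal S I" unfolding I_eq by (rule is_ideal_gen2[OF loc(1) stS])
  note IIc = ideal_closed[OF I]
  have \<mm>I: "\<mm> q \<subseteq> I" unfolding m ideal_gen2[OF subring_\<O> stO] I_eq using \<O>S by blast
  have In: "I \<subseteq> nonunits S"
    unfolding I_def ideal_gen_def by (rule hull_minimal) (use stm \<mm>S loc(5) in auto)
  have cS: "const_ratfun x \<in> S" for x using const_\<O> \<O>S by blast
  have cn: "const_ratfun x \<in> nonunits S \<longleftrightarrow> x = 0" for x
  proof -
    have "1 \<in> nonunits S" if "const_ratfun x \<in> nonunits S" "x \<noteq> 0"
    proof -
      have "1 = const_ratfun (inverse x) * const_ratfun x"
        using that by (simp add: const_ratfun_simps(1) flip: const_ratfun_simps(4))
      then show ?thesis using Ic(4)[OF cS that(1)] by metis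
    qed
    then show ?thesis using loc(6) Ic(1) by (auto simp: const_ratfun_simps)
  qed
  have pow: "x ^ n - y ^ n \<in> H" if "x - y \<in> H" "x \<in> S" "y \<in> S" "is_ideal S H" for x y H n
    unfolding power_diff_sumr2 using that
    by (intro ideal_closed(5)[OF that(4)] subring_sum[OF loc(1)] c) auto
  define z0 where "z0 = dotp a q / dotp b q"
  have z0: "z0 \<noteq> 0" using aq bq by (simp add: z0_def)
  have \<theta>0: "\<theta> ^ d - const_ratfun z0 \<in> \<mm> q"
  proof -
    have "dotp (a - z0 *s b) q = 0" using bq by (simp add: dotp_diff dotp_scale z0_def)
    moreover have "dlin (a - z0 *s b) = dlin a - const_ratfun z0 * dlin b"
      by (simp add: dlin_dotp dotp_3 const_ratfun_simps algebra_simps)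
    then have "dlin (a - z0 *s b) / dlin b = \<theta> ^ d - const_ratfun z0"
      using b_nz by (simp add: \<theta>d diff_divide_distrib)
    ultimately show ?thesis using dlin_\<mm>[OF bq] by metis
  qed
  have \<theta>S: "\<theta> \<in> S"
  proof (rule normal_ring_root[OF cover_normal[OF S(1)] loc(1) d_pos])
    show "\<theta> ^ d \<in> S" unfolding \<theta>d using dlin_\<O>[OF bq] \<O>S by blast
  qed
  obtain z where z: "\<theta> - const_ratfun z \<in> nonunits S" "z ^ d = z0"
  proof -
    define p where "p = monom 1 d + [:- z0:]"
    define ee where "ee = (\<lambda>p. poly (map_poly const_ratfun p) \<theta>)"
    have ee: "unital_hom ee" unfolding ee_def by (rule hom_eval[OF const_ratfun_hom])
    have lc: "lead_coeff p = 1" and p0: "p \<noteq> 0"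
    proof -
      have "degree p = d" unfolding p_def using d_pos by (subst degree_add_eq_left) (auto simp: degree_monom_eq)
      then show "lead_coeff p = 1" using d_pos by (simp add: p_def coeff_pCons split: nat.splits)
      then show "p \<noteq> 0" by auto
    qed
    have "p = (\<Prod>z | poly p z = 0. [:- z, 1:] ^ order z p)"
      using complex_poly_decompose[of p] lc by simp
    then have "ee p = (\<Prod>z | poly p z = 0. ee [:- z, 1:] ^ order z p)"
      by (metis (no_types, lifting) hom_prod[OF ee] hom_power[OF ee] prod.cong)
    moreover have "ee p = \<theta> ^ d - const_ratfun z0"
      unfolding p_def hom_add[OF ee] by (simp add: ee_def map_poly_monom poly_monom const_ratfun_simps eval_pCons[OF const_ratfun_hom])
    moreover have "ee [:- z, 1:] = \<theta> - const_ratfun z" for z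
      by (simp add: ee_def eval_pCons[OF const_ratfun_hom] const_ratfun_simps)
    ultimately have pr: "(\<Prod>z | poly p z = 0. (\<theta> - const_ratfun z) ^ order z p) \<in> nonunits S"
      using \<theta>0 \<mm>S by auto
    have "\<exists>z\<in>X. (\<theta> - const_ratfun z) ^ order z p \<in> nonunits S"
      if "finite X" "(\<Prod>z\<in>X. (\<theta> - const_ratfun z) ^ order z p) \<in> nonunits S" for X
      using that
    proof (induction X)
      case empty then show ?case using loc(6) by simp
    next
      case (insert x X)
      let ?f = "(\<theta> - const_ratfun x) ^ order x p" and ?g = "\<Prod>z\<in>X. (\<theta> - const_ratfun z) ^ order z p"
      show ?case
      proof (cases "?f \<in> nonunits S")
        case False
        have "?f \<in> S" by (rule c(7)[OF c(3)[OF \<theta>S cS]])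
        then have "inverse ?f \<in> S" "?f \<noteq> 0" using False by (auto simp: nonunits_def)
        then have "inverse ?f * (?f * ?g) \<in> nonunits S" using insert Ic(4) by auto
        moreover have "inverse ?f * (?f * ?g) = ?g" using \<open>?f \<noteq> 0\<close> by simp
        ultimately have "?g \<in> nonunits S" by metis
        then show ?thesis using insert by blast
      qed simp
    qed
    from this[OF poly_roots_finite[OF p0] pr] obtain z
      where z: "poly p z = 0" "(\<theta> - const_ratfun z) ^ order z p \<in> nonunits S" by blast
    have "\<theta> - const_ratfun z \<in> nonunits S"
      using subring_nonunit_power[OF loc(1) _ z(2)] c(3)[OF \<theta>S cS] by blast
    moreover have "z ^ d = z0" using z(1) by (simp add: p_def poly_monom)
    ultimately show ?thesis using that by blast
  qed
  have \<theta>I: "\<theta> - const_ratfun z \<in> I"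
  proof -
    define Q where "Q = (\<Sum>i<d. const_ratfun z ^ (d - Suc i) * \<theta> ^ i)"
    have Q: "(\<theta> - const_ratfun z) * Q = \<theta> ^ d - const_ratfun z0"
      unfolding Q_def power_diff_sumr2[symmetric] using z(2) by (simp flip: const_ratfun_simps(9))
    have QS: "Q \<in> S" unfolding Q_def by (intro subring_sum[OF loc(1)] c \<theta>S cS)
    have "Q - (\<Sum>i<d. const_ratfun z ^ (d - Suc i) * const_ratfun z ^ i) \<in> nonunits S"
      unfolding Q_def sum_subtractf[symmetric] right_diff_distrib[symmetric]
      by (intro ideal_sum[OF loc(5)] Ic(4) c pow z(1) \<theta>S cS loc(5))
    moreover have "(\<Sum>i<d. const_ratfun z ^ (d - Suc i) * const_ratfun z ^ i) = const_ratfun (of_nat d * z ^ (d - 1))"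
    proof -
      have "const_ratfun z ^ (d - Suc i) * const_ratfun z ^ i = const_ratfun (z ^ (d - 1))" if "i < d" for i
        using that by (simp add: const_ratfun_simps(9) flip: power_add)
      moreover have "const_ratfun (\<Sum>i<d. z ^ (d - 1)) = (\<Sum>i<d. const_ratfun (z ^ (d - 1)))"
        by (rule const_ratfun_simps)
      ultimately show ?thesis by simp
    qed
    ultimately have Qc: "Q - const_ratfun (of_nat d * z ^ (d - 1)) \<in> nonunits S" by simp
    have "Q \<notin> nonunits S"
    proof
      assume "Q \<in> nonunits S"
      then have "Q + (-1) * (Q - const_ratfun (of_nat d * z ^ (d - 1))) \<in> nonunits S"
        using Qc Ic(3,4) c(1,5) by blast
      then have "const_ratfun (of_nat d * z ^ (d - 1)) \<in> nonunits S" by simp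
      then have "of_nat d * z ^ (d - 1) = 0" using cn by blast
      then show False using z(2) z0 d_pos by auto
    qed
    then have "inverse Q \<in> S" "Q \<noteq> 0" using QS by (auto simp: nonunits_def)
    then have "inverse Q * ((\<theta> - const_ratfun z) * Q) \<in> I" using Q \<theta>0 \<mm>I IIc(4) by auto
    moreover have "inverse Q * ((\<theta> - const_ratfun z) * Q) = \<theta> - const_ratfun z"
      using \<open>Q \<noteq> 0\<close> by simp
    ultimately show ?thesis by metis
  qed
  have nI: "nonunits S \<subseteq> I"
  proof
    fix x assume x: "x \<in> nonunits S"
    then obtain f g where fg: "x = f / g" "f \<in> B" "g \<in> B" "g \<notin> J" unfolding SJ nonunits_def localize_def by blast
    then have fJ: "f \<in> J" using x loc(4) by blast
    have "\<exists>r. \<forall>i. i < d \<longrightarrow> cf f i - const_ratfun (r i) \<in> \<mm> q"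
      using residue[OF W_\<O>[OF bq \<Lambda>_W[OF bq]]] fg(2) B\<Lambda> by (intro choice) (metis subsetD)
    then obtain r where r: "\<And>i. i < d \<Longrightarrow> cf f i - const_ratfun (r i) \<in> \<mm> q" by blast
    have "(\<Sum>i<d. cf f i * \<theta> ^ i) - (\<Sum>i<d. const_ratfun (r i) * const_ratfun z ^ i) \<in> I"
      unfolding sum_subtractf[symmetric]
    proof (rule ideal_sum[OF I])
      fix i assume "i \<in> {..<d}"
      then have i: "i < d" by simp
      have "cf f i * \<theta> ^ i - const_ratfun (r i) * const_ratfun z ^ i =
        (cf f i - const_ratfun (r i)) * \<theta> ^ i + const_ratfun (r i) * (\<theta> ^ i - const_ratfun z ^ i)"
        by (simp add: algebra_simps)
      also have "\<dots> \<in> I"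
        using r[OF i] \<mm>I by (intro IIc(3) IIc(5) IIc(4)[OF cS] pow[OF \<theta>I \<theta>S cS I] c(7) \<theta>S) auto
      finally show "cf f i * \<theta> ^ i - const_ratfun (r i) * const_ratfun z ^ i \<in> I" .
    qed
    moreover have "(\<Sum>i<d. const_ratfun (r i) * const_ratfun z ^ i) = const_ratfun (\<Sum>i<d. r i * z ^ i)"
      by (simp add: const_ratfun_simps)
    ultimately have fI: "f - const_ratfun (\<Sum>i<d. r i * z ^ i) \<in> I" using expand[of f] by simp
    moreover have "f \<in> nonunits S"
    proof -
      have "1 \<notin> J" using loc(2,6) fg(4) ideal_closed[of B J] J unfolding is_maximal_ideal_def
        by (metis fg(3) mult.right_neutral)
      then show ?thesis using loc(4)[OF fg(2) subring_closed(1)[OF B]] fJ by simp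
    qed
    then have "f + (-1) * (f - const_ratfun (\<Sum>i<d. r i * z ^ i)) \<in> nonunits S"
      using fI In Ic(3,4) c(1,5) by blast
    then have "(\<Sum>i<d. r i * z ^ i) = 0" using cn by simp
    then have "f \<in> I" using fI by (simp add: const_ratfun_simps)
    then have "f * inverse g \<in> I" using loc(3)[OF fg(3,4)] IIc(5) by blast
    then show "x \<in> I" using fg(1) by (simp add: divide_inverse)
  qed
  then have "nonunits S = ideal_gen S {s, t}" using In I_def by blast
  then show ?thesis unfolding local_biholomorphism_def using m by blast
qed

end

end

section \<open>Ramification indices\<close>

context kummer_cover
begin

context
  fixes q :: "complex ^ 3"
  assumes aq: "dotp a q = 0" and bq: "dotp b q \<noteq> 0"
begin

abbreviation R where "R \<equiv> \<Lambda> q b"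

lemma W_b: "W q b i = \<O> q"
  using b_nz by (auto simp: W_def[OF bq] \<rho>_def[OF bq] image_def)

lemma R_cf: "f \<in> R \<Longrightarrow> i < d \<Longrightarrow> cf f i \<in> \<O> q"
  using \<Lambda>_W[OF bq] W_b by blast

lemma R_I: "(\<And>i. i < d \<Longrightarrow> cf f i \<in> \<O> q) \<Longrightarrow> f \<in> R"
  using \<Lambda>_I[OF bq] W_b by blast

lemmas R_closed = \<Lambda>_closed[OF bq] and R_subring = \<Lambda>_subring[OF bq] and nonunits_R = nonunits_\<Lambda>[OF bq aq]

lemma \<theta>_R: "\<theta> \<in> R" and \<theta>_nonunit: "\<theta> \<in> nonunits R"
proof -
  have "\<rho> b = 1" using b_nz by (simp add: \<rho>_def[OF bq])
  then show "\<theta> \<in> nonunits R" using \<rho>_\<theta>_\<Lambda>[OF bq aq] by simp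
  then show "\<theta> \<in> R" by (simp add: nonunits_def)
qed

lemma split_\<theta>: assumes "f \<in> R" obtains f' where "f' \<in> R" "f = cf f 0 + \<theta> * f'"
proof -
  define c where "c i = (if Suc i < d then cf f (Suc i) else 0)" for i
  define f' where "f' = (\<Sum>i<d. c i * \<theta> ^ i)"
  have c: "c i \<in> \<O> q" for i using R_cf[OF assms] \<O>_closed by (simp add: c_def)
  have "cf f' i = c i" if "i < d" for i using K.cf_eqI[OF _ f'_def that] c \<O>_L by blast
  then have "f' \<in> R" using R_I c by simp
  moreover have "f = cf f 0 + \<theta> * f'"
  proof -
    obtain k where k: "d = Suc k" using d_pos by (cases d) auto
    have "f = cf f 0 + (\<Sum>i<k. cf f (Suc i) * \<theta> ^ Suc i)"
      using expand[of f] unfolding k sum.lessThan_Suc_shift by simp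
    moreover have "f' = (\<Sum>i<k. cf f (Suc i) * \<theta> ^ i)" by (simp add: f'_def c_def k)
    ultimately show ?thesis by (simp add: sum_distrib_left mult_ac)
  qed
  ultimately show ?thesis using that by blast
qed

lemma cf_1_\<theta>_mult: "cf (\<theta> * x) 1 = cf x 0"
proof -
  have d1: "1 < d" using d2 by simp
  have "\<theta> * x = (\<Sum>i<d. cf x i * \<theta> ^ Suc i)"
  proof -
    have "\<theta> * (\<Sum>i<d. cf x i * \<theta> ^ i) = (\<Sum>i<d. cf x i * \<theta> ^ Suc i)"
      by (simp add: sum_distrib_left mult_ac)
    then show ?thesis using expand[of x] by simp
  qed
  then have "cf (\<theta> * x) 1 = (\<Sum>i<d. cf (cf x i * \<theta> ^ Suc i) 1)" by (simp only: K.cf_sum[OF U d1])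
  also have "\<dots> = (\<Sum>i<d. if i = 0 then cf x 0 else 0)"
  proof (intro sum.cong refl)
    fix i assume "i \<in> {..<d}"
    then have i: "i < d" by simp
    have "1 = Suc i mod d \<longleftrightarrow> i = 0"
    proof (cases "Suc i < d")
      case False
      then have "Suc i = d" using i by simp
      then show ?thesis using d1 by auto
    qed auto
    then show "cf (cf x i * \<theta> ^ Suc i) 1 = (if i = 0 then cf x 0 else 0)"
      using K.cf_power[OF cf_L[OF i] d1, of x "Suc i"] d1 by (auto simp del: power_Suc)
  qed
  also have "\<dots> = cf x 0" using d_pos by simp
  finally show ?thesis .
qed

lemma unit_mult: "f \<in> R \<Longrightarrow> g \<in> R \<Longrightarrow> cf f 0 \<notin> \<mm> q \<Longrightarrow> cf g 0 \<notin> \<mm> q \<Longrightarrow> f * g \<in> R \<and> cf (f * g) 0 \<notin> \<mm> q"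
  using cf_0_mult_\<mm>[OF bq aq, of f g] R_closed(4)[of f g] by blast

lemma unit_power: "f \<in> R \<Longrightarrow> cf f 0 \<notin> \<mm> q \<Longrightarrow> f ^ n \<in> R \<and> cf (f ^ n) 0 \<notin> \<mm> q"
  by (induction n) (simp_all add: unit_mult R_closed cf_simps K.one_L d_pos one_\<mm>)

lemma cf_0_\<theta>_power: assumes "0 < n" shows "cf (\<theta> ^ n) 0 \<in> \<mm> q"
proof -
  have t: "\<theta> ^ d \<in> \<mm> q" unfolding \<theta>d using dlin_\<mm>[OF bq] aq by simp
  have "(\<theta> ^ d) ^ k \<in> \<mm> q" if "0 < k" for k
    using that
  proof (induction k)
    case (Suc k)
    then show ?case using t \<mm>_closed(5)[OF t, of "(\<theta> ^ d) ^ k"] \<mm>_\<O>[OF t] \<O>_closed(7) by simp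
  qed simp
  moreover have "0 < n div d" if "n mod d = 0" using that assms by (auto simp: div_greater_zero_iff dvd_imp_le mod_eq_0_iff_dvd d_pos)
  ultimately show ?thesis
    using K.cf_power[OF K.one_L d_pos, of n] \<mm>_closed(1) by (auto split: if_splits)
qed

text \<open>The ideal of the line \<open>a = 0\<close> is radical, as the form \<open>a\<close> is prime.\<close>

lemma line_radical:
  assumes f: "f \<in> \<O> q" and x: "f ^ r = \<theta> ^ d * x" "x \<in> \<O> q"
  obtains y where "y \<in> \<O> q" "f = \<theta> ^ d * y"
proof (cases "f = 0")
  case True then show ?thesis using that[of 0] \<O>_closed(2) by simp
next
  case False
  note ab0 = independent2_nz[OF ab]
  obtain n G H where G: "homogeneous n G" "homogeneous n H" "value_at H q \<noteq> 0" "ev H \<noteq> 0" "f = ev G / ev H"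
    using f by (rule \<O>E)
  obtain m E F where E: "homogeneous m E" "homogeneous m F" "value_at F q \<noteq> 0" "ev F \<noteq> 0" "x = ev E / ev F"
    using x(2) by (rule \<O>E)
  have "ev (G ^ r * (lin b * F)) = ev (lin a * (E * H ^ r))"
    using x(1) G E b_nz by (simp add: ev_simps \<theta>d dlin_def field_simps)
  moreover have "homogeneous (r * n + (1 + m)) (G ^ r * (lin b * F))"
    using G E by (intro homogeneous_mult homogeneous_power homogeneous_lin)
  moreover have "homogeneous (1 + (m + r * n)) (lin a * (E * H ^ r))"
    using G E by (intro homogeneous_mult homogeneous_power homogeneous_lin)
  ultimately have "G ^ r * (lin b * F) = lin a * (E * H ^ r)"
    using ev_eq_iff[of "r * n + (1 + m)"] by (simp add: ac_simps)
  then have "lin a dvd G ^ r * (lin b * F)" by simp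
  moreover have "\<not> lin a dvd F" using lin_dvd_iff[OF ab0(1)] aq E(3) by blast
  moreover have "\<not> lin a dvd lin b" using lin_dvd_lin_iff[OF ab0] ab by simp
  ultimately have "lin a dvd G" using lin_prime[OF ab0(1)] prime_elem_dvd_mult_iff prime_elem_dvd_power by metis
  then obtain G' where G': "G = lin a * G'" ..
  have "G \<noteq> 0" using False G by (auto simp: ev_simps)
  then obtain k where k: "homogeneous k G'" "n = 1 + k"
    using homogeneous_factors[of n "lin a" G'] G(1) G' homogeneous_unique[OF _ homogeneous_lin] by (metis mult_eq_0_iff)
  have "f = \<theta> ^ d * (ev (G' * lin b) / ev H)"
    using G(5) G' b_nz by (simp add: ev_simps dlin_def \<theta>d)
  moreover have "ev (G' * lin b) / ev H \<in> \<O> q"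
    using k G homogeneous_mult[OF k(1) homogeneous_lin, of b] by (intro \<O>I[of n]) (simp_all add: add.commute)
  ultimately show ?thesis using that by blast
qed

lemma curve_ideal: "curve_ideal_at T {q. q \<noteq> 0 \<and> dotp a q = 0} q = {\<alpha> * \<theta> ^ d | \<alpha>. \<alpha> \<in> \<O> q}"
  using curve_ideal_line[OF independent2_nz(1)[OF ab] refl bq]
  unfolding ideal_gen1[OF subring_\<O> dlin_\<O>[OF bq]] \<theta>d .

lemma ramification_index_d: "ramification_index T {q. q \<noteq> 0 \<and> dotp a q = 0} q R d"
proof -
  have q: "q \<noteq> 0" using bq by auto
  obtain u where u: "dotp a u = 1" using dotp_eq_1 independent2_nz(1)[OF ab] by blast
  define e where "e = crossp q u"
  have eq: "dotp e q = 0" by (simp add: e_def dotp_3 algebra_simps)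
  have "crossp e a = (- 1) *s q"
    using u aq unfolding e_def vec3_simps dotp_3 crossp_nth by (simp, algebra)
  then have ea: "independent2 e a" using q by (auto simp: independent2_def vec3_simps vec3_eq_iff)
  define s where "s = dlin e / dlin b"
  have m: "\<mm> q = ideal_gen (\<O> q) {s, \<theta> ^ d}"
    unfolding s_def \<theta>d by (rule \<mm>_generators[OF ea eq aq bq])
  have sm: "s \<in> \<mm> q" "s \<in> \<O> q" unfolding s_def using dlin_\<mm>[OF bq] eq dlin_\<O>[OF bq] by auto
  have tO: "\<theta> ^ d \<in> \<O> q" unfolding \<theta>d by (rule dlin_\<O>[OF bq])
  have C: "curve_ideal_at T {q. q \<noteq> 0 \<and> dotp a q = 0} q = ideal_gen (\<O> q) {\<theta> ^ d}"
    unfolding curve_ideal ideal_gen1[OF subring_\<O> tO] ..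
  have sR: "s \<in> R" using \<O>_\<Lambda>[OF bq] sm by blast
  note gen = ideal_gen2[OF R_subring sR \<theta>_R]
  have n: "nonunits R = ideal_gen R {s, \<theta>}"
  proof
    show "nonunits R \<subseteq> ideal_gen R {s, \<theta>}"
    proof
      fix f assume "f \<in> nonunits R"
      then have f: "f \<in> R" "cf f 0 \<in> \<mm> q" using nonunits_R by auto
      obtain f' where f': "f' \<in> R" "f = cf f 0 + \<theta> * f'" using split_\<theta>[OF f(1)] .
      obtain \<alpha> \<beta> where \<alpha>: "cf f 0 = \<alpha> * s + \<beta> * \<theta> ^ d" "\<alpha> \<in> \<O> q" "\<beta> \<in> \<O> q"
        using f(2) unfolding m ideal_gen2[OF subring_\<O> sm(2) tO] by blast
      have "\<theta> ^ d = \<theta> ^ (d - 1) * \<theta>" using d_pos by (simp add: power_eq_if)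
      then have "f = \<alpha> * s + (\<beta> * \<theta> ^ (d - 1) + f') * \<theta>" using f'(2) \<alpha>(1) by (simp add: algebra_simps)
      moreover have "\<beta> * \<theta> ^ (d - 1) + f' \<in> R"
        by (intro R_closed(4,6,7) f' \<theta>_R \<O>_\<Lambda>[OF bq] \<alpha>)
      ultimately show "f \<in> ideal_gen R {s, \<theta>}" unfolding gen using \<alpha> \<O>_\<Lambda>[OF bq] by blast
    qed
    have "cf s 0 = s" using sm \<O>_L by (simp add: cf_simps d_pos)
    then have "s \<in> nonunits R" using nonunits_R sR sm by simp
    moreover have "is_ideal R (nonunits R)"
      unfolding is_ideal_def nonunits_R Ball_def subset_iff
      using R_closed \<mm>_closed(1,3) cf_0_mult_\<mm>[OF bq aq] by (simp add: cf_simps K.zero_L d_pos)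
    ultimately show "ideal_gen R {s, \<theta>} \<subseteq> nonunits R"
      unfolding ideal_gen_def using \<theta>_nonunit by (intro hull_minimal) auto
  qed
  have "1 \<in> R - nonunits R" using R_closed(1) nonunits_R by (simp add: cf_simps K.one_L d_pos one_\<mm>)
  moreover have "\<theta> ^ d = 1 * \<theta> ^ d" "d \<ge> 1" using d_pos by simp_all
  ultimately show ?thesis unfolding ramification_index_def using m C n by blast
qed

text \<open>
  Let \<open>t = e w\<^sup>r\<close>. As \<open>\<theta>\<close> lies in \<open>(s,w)\<close>, the component of weight \<open>1\<close> of \<open>w\<close> is a unit; as \<open>w\<^sup>r\<close>
  vanishes on the reduced line, so does the component of weight \<open>0\<close>. Hence \<open>w\<close> is a
  unit times \<open>\<theta>\<close>, and \<open>r\<close> can be read off by comparing \<open>w\<^sup>r\<close> with \<open>\<theta>\<^sup>d\<close>.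
\<close>

lemma ramification_index_unique:
  assumes "ramification_index T {q. q \<noteq> 0 \<and> dotp a q = 0} q R r"
  shows "r = d"
proof -
  obtain s t w e where r: "1 \<le> r" and m: "\<mm> q = ideal_gen (\<O> q) {s, t}"
    and C: "curve_ideal_at T {q. q \<noteq> 0 \<and> dotp a q = 0} q = ideal_gen (\<O> q) {t}"
    and n: "nonunits R = ideal_gen R {s, w}" and e: "e \<in> R - nonunits R" and t: "t = e * w ^ r"
    using assms unfolding ramification_index_def by blast
  have st: "s \<in> \<mm> q" "t \<in> \<mm> q" using hull_subset[of "{s, t}" "is_ideal (\<O> q)"] m by (auto simp: ideal_gen_def)
  have w: "w \<in> nonunits R" using hull_subset[of "{s, w}" "is_ideal R"] n by (auto simp: ideal_gen_def)
  then have wR: "w \<in> R" "cf w 0 \<in> \<mm> q" using nonunits_R by auto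
  have stO: "s \<in> \<O> q" "t \<in> \<O> q" using st \<mm>_\<O> by auto
  have sR: "s \<in> R" using \<O>_\<Lambda>[OF bq] stO by blast
  have eu: "e \<in> R" "cf e 0 \<notin> \<mm> q" using e nonunits_R by auto
  have d1: "1 < d" using d2 by simp
  obtain w' where w': "w' \<in> R" "w = cf w 0 + \<theta> * w'" using split_\<theta>[OF wR(1)] .
  have w0: "cf w 0 \<in> \<O> q" using wR \<mm>_\<O> by blast
  have w'u: "cf w' 0 \<notin> \<mm> q"
  proof
    assume w'0: "cf w' 0 \<in> \<mm> q"
    obtain \<alpha> \<beta> where \<alpha>: "\<theta> = \<alpha> * s + \<beta> * w" "\<alpha> \<in> R" "\<beta> \<in> R"
      using \<theta>_nonunit unfolding n ideal_gen2[OF R_subring sR wR(1)] by blast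
    have "1 = cf (1 * \<theta> ^ 1) 1" using K.cf_power[OF K.one_L d1, of 1] d1 by simp
    also have "1 * \<theta> ^ 1 = s * \<alpha> + (cf w 0 * \<beta> + \<theta> * (\<beta> * w'))"
    proof -
      have "\<theta> = s * \<alpha> + \<beta> * (cf w 0 + \<theta> * w')" using \<alpha>(1) w'(2) by (simp add: mult.commute)
      then show ?thesis by (simp add: algebra_simps)
    qed
    also have "cf \<dots> 1 = s * cf \<alpha> 1 + (cf w 0 * cf \<beta> 1 + cf (\<beta> * w') 0)"
      using stO w0 \<O>_L d1 by (simp add: cf_simps cf_1_\<theta>_mult[unfolded One_nat_def])
    also have "\<dots> \<in> \<mm> q"
      using st wR w'0 R_cf[OF \<alpha>(2) d1] R_cf[OF \<alpha>(3) d1] cf_0_mult_\<mm>[OF bq aq \<alpha>(3) w'(1)]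
      by (intro \<mm>_closed(3,5)) auto
    finally show False using one_\<mm> by blast
  qed
  have tO: "\<theta> ^ d \<in> \<O> q" unfolding \<theta>d by (rule dlin_\<O>[OF bq])
  have gen: "{\<alpha> * \<theta> ^ d | \<alpha>. \<alpha> \<in> \<O> q} = {\<alpha> * t | \<alpha>. \<alpha> \<in> \<O> q}"
    using C unfolding curve_ideal ideal_gen1[OF subring_\<O> stO(2)] .
  have "t = 1 * t" "\<theta> ^ d = 1 * \<theta> ^ d" by simp_all
  then have "t \<in> {\<alpha> * \<theta> ^ d | \<alpha>. \<alpha> \<in> \<O> q}" "\<theta> ^ d \<in> {\<alpha> * t | \<alpha>. \<alpha> \<in> \<O> q}"
    using gen \<O>_closed(1) by blast+
  then obtain x y where x: "t = x * \<theta> ^ d" "x \<in> \<O> q" and y: "\<theta> ^ d = y * t" "y \<in> \<O> q" by blast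
  have xu: "x \<notin> \<mm> q"
  proof
    assume "x \<in> \<mm> q"
    moreover have "\<theta> ^ d = (y * x) * \<theta> ^ d" using x y by (simp add: mult.assoc)
    then have "y * x = 1" using K.\<theta>_nz by simp
    ultimately show False using \<mm>_closed(4)[OF y(2)] one_\<mm> by metis
  qed
  have main: "e * w ^ r = x * \<theta> ^ d" using t x by simp
  obtain w1 where w1: "w1 \<in> \<O> q" "cf w 0 = \<theta> ^ d * w1"
  proof -
    have pw: "\<exists>h\<in>\<O> q. cf (w ^ k) 0 = cf w 0 ^ k + \<theta> ^ d * h" for k
    proof (induction k)
      case 0 show ?case by (intro bexI[of _ 0]) (simp_all add: cf_simps K.one_L d_pos \<O>_closed)
    next
      case (Suc k)
      then obtain h where h: "h \<in> \<O> q" "cf (w ^ k) 0 = cf w 0 ^ k + \<theta> ^ d * h" by blast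
      obtain g where g: "g \<in> \<O> q" "cf (w * w ^ k) 0 = cf w 0 * cf (w ^ k) 0 + \<theta> ^ d * g"
        using cf_0_mult[OF bq aq wR(1) R_closed(7)[OF wR(1), of k]] unfolding \<theta>d by blast
      have "cf (w ^ Suc k) 0 = cf w 0 ^ Suc k + \<theta> ^ d * (cf w 0 * h + g)"
        using g(2) h(2) by (simp add: algebra_simps)
      moreover have "cf w 0 * h + g \<in> \<O> q" by (intro \<O>_closed(4,6) w0 g(1) h(1))
      ultimately show ?case by blast
    qed
    obtain h where h: "h \<in> \<O> q" "cf (w ^ r) 0 = cf w 0 ^ r + \<theta> ^ d * h" using pw by blast
    obtain g where g: "g \<in> \<O> q" "cf (e * w ^ r) 0 = cf e 0 * cf (w ^ r) 0 + \<theta> ^ d * g"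
      using cf_0_mult[OF bq aq eu(1) R_closed(7)[OF wR(1), of r]] unfolding \<theta>d by blast
    have e0: "cf e 0 \<in> \<O> q" "inverse (cf e 0) \<in> \<O> q" "cf e 0 \<noteq> 0"
      using R_cf[OF eu(1) d_pos] eu \<O>_inverse \<mm>_closed(1) by auto
    have "x * \<theta> ^ d \<in> L" using x tO \<O>_closed(4) \<O>_L by blast
    then have "cf (e * w ^ r) 0 = x * \<theta> ^ d" unfolding main by (simp add: cf_simps d_pos)
    then have "cf e 0 * cf w 0 ^ r = \<theta> ^ d * (x - cf e 0 * h - g)"
      using g h by (simp add: algebra_simps)
    then have "cf w 0 ^ r = \<theta> ^ d * (inverse (cf e 0) * (x - cf e 0 * h - g))"
      using e0(3) by (simp add: field_simps)
    moreover have "inverse (cf e 0) * (x - cf e 0 * h - g) \<in> \<O> q"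
      using e0 x h g by (intro \<O>_closed(3,4))
    ultimately show ?thesis using line_radical[OF w0] that by blast
  qed
  define w2 where "w2 = w' + w1 * \<theta> ^ (d - 1)"
  have w2R: "w2 \<in> R" unfolding w2_def by (intro R_closed(4,6,7) w' \<theta>_R \<O>_\<Lambda>[OF bq] w1)
  have "(d - 1) mod d = d - 1" "d - 1 \<noteq> 0" using d1 by auto
  then have "cf w2 0 = cf w' 0"
    unfolding w2_def using K.cf_power[OF \<O>_L[OF w1(1)] d_pos, of "d - 1"] by (simp add: cf_simps d_pos)
  then have w2u: "cf w2 0 \<notin> \<mm> q" using w'u by simp
  have "\<theta> ^ d = \<theta> * \<theta> ^ (d - 1)" using d_pos by (simp add: power_eq_if)
  then have "w = \<theta> * w2" using w'(2) w1(2) by (simp add: w2_def algebra_simps)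
  then have main2: "(e * w2 ^ r) * \<theta> ^ r = x * \<theta> ^ d" using main by (simp add: power_mult_distrib mult_ac)
  define v where "v = e * w2 ^ r"
  have v: "v \<in> R" "cf v 0 \<notin> \<mm> q" unfolding v_def using unit_mult[OF eu(1) _ eu(2)] unit_power[OF w2R w2u] by blast+
  have xR: "x \<in> R" "cf x 0 = x" using x \<O>_\<Lambda>[OF bq] \<O>_L by (auto simp: cf_simps d_pos)
  show "r = d"
  proof (rule linorder_cases[of r d])
    assume "r < d"
    then have "\<theta> ^ d = \<theta> ^ (d - r) * \<theta> ^ r" by (simp flip: power_add)
    then have "v = x * \<theta> ^ (d - r)" using main2 K.\<theta>_nz by (simp add: v_def)
    then have "cf v 0 \<in> \<mm> q"
      using cf_0_mult_\<mm>[OF bq aq xR(1) R_closed(7)[OF \<theta>_R]] cf_0_\<theta>_power \<open>r < d\<close> by simp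
    then show ?thesis using v by blast
  next
    assume "d < r"
    then have "\<theta> ^ r = \<theta> ^ (r - d) * \<theta> ^ d" by (simp flip: power_add)
    then have "x = v * \<theta> ^ (r - d)" using main2 K.\<theta>_nz by (simp add: v_def mult.assoc)
    then have "cf x 0 \<in> \<mm> q"
      using cf_0_mult_\<mm>[OF bq aq v(1) R_closed(7)[OF \<theta>_R]] cf_0_\<theta>_power \<open>d < r\<close> by simp
    then show ?thesis using xR xu by simp
  qed
qed

end

text \<open>
  The tuple is determined, since two conditions that hold at a generic point of the line hold simultaneously at some
  point of it.
\<close>

lemma branching_tuple_line:
  assumes res: "resolution T Y" and st: "stein_factorization T Y N"
  shows "branching_tuple T N {q. q \<noteq> 0 \<and> dotp a q = 0} = [d]"
  unfolding branching_tuple_def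
proof (rule the_equality)
  let ?C = "{q. q \<noteq> 0 \<and> dotp a q = 0}"
  note ab0 = independent2_nz[OF ab]
  obtain q1 where q1: "dotp a q1 = 0" "dotp b q1 = 1" using independent2_separating[OF ab] .
  have over: "{S \<in> N. lies_over T S q} = {\<Lambda> q b}" if "q \<in> ?C" "value_at (lin b) q \<noteq> 0" for q
    using points_over_branch_line[OF res st] that by (simp add: value_lin)
  have "generically_on ?C (\<lambda>q. \<exists>Ss. distinct Ss \<and> set Ss = {S \<in> N. lies_over T S q} \<and>
          list_all2 (ramification_index T ?C q) Ss [d])"
    unfolding generically_on_def
  proof (intro exI conjI ballI impI)
    show "homogeneous 1 (lin b)" by (rule homogeneous_lin)
    have "q1 \<noteq> 0" using q1 by auto
    then show "\<exists>q\<in>?C. value_at (lin b) q \<noteq> 0" using q1 by (auto simp: value_lin)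
    fix q assume q: "q \<in> ?C" "value_at (lin b) q \<noteq> 0"
    show "distinct [\<Lambda> q b]" "set [\<Lambda> q b] = {S \<in> N. lies_over T S q}" using over[OF q] by simp_all
    show "list_all2 (ramification_index T ?C q) [\<Lambda> q b] [d]"
      using ramification_index_d[of q] q by (simp add: value_lin)
  qed
  then show "sorted_wrt (\<ge>) [d] \<and> generically_on ?C (\<lambda>q. \<exists>Ss. distinct Ss \<and> set Ss = {S \<in> N. lies_over T S q} \<and>
          list_all2 (ramification_index T ?C q) Ss [d])" by simp
  fix rs
  assume "sorted_wrt (\<ge>) rs \<and> generically_on ?C (\<lambda>q. \<exists>Ss. distinct Ss \<and> set Ss = {S \<in> N. lies_over T S q} \<and>
          list_all2 (ramification_index T ?C q) Ss rs)"
  then obtain n G where G: "homogeneous n G" "\<exists>q\<in>?C. value_at G q \<noteq> 0"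
    and rs: "\<And>q. q \<in> ?C \<Longrightarrow> value_at G q \<noteq> 0 \<Longrightarrow> \<exists>Ss. distinct Ss \<and> set Ss = {S \<in> N. lies_over T S q} \<and>
          list_all2 (ramification_index T ?C q) Ss rs"
    unfolding generically_on_def by blast
  have "\<not> lin a dvd G" using G lin_dvd_form_iff[OF ab0(1)] by auto
  moreover have "\<not> lin a dvd lin b" using lin_dvd_lin_iff[OF ab0] ab by simp
  ultimately have "\<not> lin a dvd lin b * G" using lin_prime[OF ab0(1)] by (simp add: prime_elem_dvd_mult_iff)
  then obtain q where q: "q \<in> ?C" "value_at (lin b) q \<noteq> 0" "value_at G q \<noteq> 0"
    using lin_dvd_form_iff[OF ab0(1) homogeneous_mult[OF homogeneous_lin G(1)]] by (auto simp: value_simps)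
  obtain Ss where Ss: "distinct Ss" "set Ss = {\<Lambda> q b}" "list_all2 (ramification_index T ?C q) Ss rs"
    using rs[OF q(1,3)] over[OF q(1,2)] by auto
  have "length Ss = 1" using Ss distinct_card[OF Ss(1)] by simp
  then have "Ss = [\<Lambda> q b]" using Ss(2) by (cases Ss) auto
  then obtain r where "rs = [r]" "ramification_index T ?C q (\<Lambda> q b) r"
    using Ss(3) by (auto simp: list_all2_Cons1)
  then show "rs = [d]" using ramification_index_unique[of q] q by (simp add: value_lin)
qed

text \<open>
  Here \<open>q\<close> may be the intersection of the two lines; leaving it out of the branch locus would change the
  irreducible components.
\<close>

lemma branch_line_in_locus:
  assumes res: "resolution T Y" and st: "stein_factorization T Y N" and q: "q \<noteq> 0" "dotp a q = 0"
  shows "q \<in> branch_locus T N"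
proof -
  obtain l where l: "dotp l q = 1" using dotp_eq_1[OF q(1)] dotp_commute by metis
  then have l0: "dotp l q \<noteq> 0" by simp
  show ?thesis
    unfolding branch_locus_def
    using points_over_branch_line[OF res st l0 q(2)] not_local_biholomorphism[OF l0 q(2)] by blast
qed

text \<open>
  The roles of the two branch lines are symmetric; up to the factor \<open>\<theta>\<^bsup>d-1\<^esup>\<close>, an expansion in powers of the inverse of
  \<open>\<theta>\<close> is an expansion in powers of \<open>\<theta>\<close> read backwards.
\<close>

lemma swapped: "kummer_cover T b a (inverse \<theta>) d"
proof
  show "d \<ge> 2" by (rule d2)
  show "independent2 b a" using ab independent2_sym by blast
  show "inverse \<theta> ^ d = dlin b / dlin a" by (simp add: power_inverse \<theta>d)
  have e: "\<theta> ^ (d - 1) * (inverse \<theta> ^ i) = \<theta> ^ (d - Suc i)" if "i < d" for i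
  proof -
    have "d - 1 = (d - Suc i) + i" using that by simp
    then show ?thesis using K.\<theta>_nz by (simp add: power_add power_inverse)
  qed
  have r: "\<theta> ^ (d - 1) * (\<Sum>i<d. c i * inverse \<theta> ^ i) = (\<Sum>i<d. c (d - Suc i) * \<theta> ^ i)" for c
  proof -
    have "\<theta> ^ (d - 1) * (\<Sum>i<d. c i * inverse \<theta> ^ i) = (\<Sum>i<d. c i * \<theta> ^ (d - Suc i))"
      unfolding sum_distrib_left using e by (intro sum.cong refl) (simp add: mult.left_commute)
    also have "\<dots> = (\<Sum>i<d. c (d - Suc i) * \<theta> ^ (d - Suc (d - Suc i)))"
      by (rule sum.nat_diff_reindex[symmetric])
    also have "\<dots> = (\<Sum>i<d. c (d - Suc i) * \<theta> ^ i)"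
      by (intro sum.cong refl) (simp add: Suc_diff_Suc)
    finally show ?thesis .
  qed
  fix c i
  assume c: "\<And>i. i < d \<Longrightarrow> c i \<in> L" and 0: "(\<Sum>i<d. c i * inverse \<theta> ^ i) = 0" and i: "i < d"
  have "(\<Sum>i<d. c (d - Suc i) * \<theta> ^ i) = 0" using r[of c] 0 by simp
  then have "c (d - Suc (d - Suc i)) = 0"
    using weights_independent[of "\<lambda>i. c (d - Suc i)" "d - Suc i"] c i by simp
  then show "c i = 0" using i by (simp add: Suc_diff_Suc)
next
  fix f
  define c where "c i = cf (\<theta> ^ (d - 1) * f) (d - Suc i)" for i
  have e: "\<theta> ^ i = \<theta> ^ (d - 1) * inverse \<theta> ^ (d - Suc i)" if "i < d" for i
  proof -
    have "d - 1 = i + (d - Suc i)" using that by simp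
    then show ?thesis using K.\<theta>_nz by (simp add: power_add power_inverse)
  qed
  have "\<theta> ^ (d - 1) * f = (\<Sum>i<d. cf (\<theta> ^ (d - 1) * f) i * \<theta> ^ i)" by (rule expand)
  also have "\<dots> = \<theta> ^ (d - 1) * (\<Sum>i<d. cf (\<theta> ^ (d - 1) * f) i * inverse \<theta> ^ (d - Suc i))"
    unfolding sum_distrib_left
  proof (intro sum.cong refl)
    fix i assume "i \<in> {..<d}"
    then have i: "i < d" by simp
    show "cf (\<theta> ^ (d - 1) * f) i * \<theta> ^ i = \<theta> ^ (d - 1) * (cf (\<theta> ^ (d - 1) * f) i * inverse \<theta> ^ (d - Suc i))"
      unfolding e[OF i] by (rule mult.left_commute)
  qed
  also have "(\<Sum>i<d. cf (\<theta> ^ (d - 1) * f) i * inverse \<theta> ^ (d - Suc i)) = (\<Sum>i<d. c i * inverse \<theta> ^ i)"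
    unfolding c_def by (subst sum.nat_diff_reindex[symmetric]) (intro sum.cong refl, simp add: Suc_diff_Suc)
  finally have "f = (\<Sum>i<d. c i * inverse \<theta> ^ i)" using K.\<theta>_nz by simp
  moreover have "\<forall>i<d. c i \<in> L" using cf_L d_pos by (simp add: c_def)
  ultimately show "\<exists>c. (\<forall>i<d. c i \<in> L) \<and> f = (\<Sum>i<d. c i * inverse \<theta> ^ i)" by blast
qed

end


section \<open>The weighted branching type of a Kummer cover\<close>

definition line :: "complex ^ 3 \<Rightarrow> (complex ^ 3) set" where
  "line a = {q. q \<noteq> 0 \<and> dotp a q = 0}"

lemma zariski_closed_line: "zariski_closed (line a)"
  unfolding zariski_closed_def line_def
  using homogeneous_lin[of a] by (intro exI[of _ "{lin a}"]) (auto simp: value_lin simp del: One_nat_def)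

text \<open>Forms not vanishing on the line are those not divisible by its prime equation.\<close>

lemma zariski_irreducible_line: assumes "a \<noteq> 0" shows "zariski_irreducible (line a)"
  unfolding zariski_irreducible_def
proof (intro conjI allI impI)
  show "zariski_closed (line a)" by (rule zariski_closed_line)
  show "line a \<noteq> {}" using line_nonempty[OF assms] by (auto simp: line_def)
  fix Z1 Z2 assume Z: "zariski_closed Z1 \<and> zariski_closed Z2 \<and> line a \<subseteq> Z1 \<union> Z2"
  have *: "\<exists>n F. homogeneous n F \<and> \<not> lin a dvd F \<and> (\<forall>q\<in>Z. value_at F q = 0)"
    if Z: "zariski_closed Z" and n: "\<not> line a \<subseteq> Z" for Z
  proof -
    obtain \<F> where F: "\<forall>F\<in>\<F>. \<exists>n. homogeneous n F" "Z = {q. q \<noteq> 0 \<and> (\<forall>F\<in>\<F>. value_at F q = 0)}"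
      using Z unfolding zariski_closed_def by blast
    then obtain q F where q: "q \<in> line a" "F \<in> \<F>" "value_at F q \<noteq> 0" using n by (auto simp: line_def)
    obtain n where hF: "homogeneous n F" using F(1) q(2) by blast
    have "\<not> lin a dvd F" using lin_dvd_form_iff[OF assms hF] q by (auto simp: line_def)
    then show ?thesis using hF F(2) q(2) by blast
  qed
  show "line a \<subseteq> Z1 \<or> line a \<subseteq> Z2"
  proof (rule ccontr)
    assume "\<not> (line a \<subseteq> Z1 \<or> line a \<subseteq> Z2)"
    then obtain n F m G where F: "homogeneous n F" "\<not> lin a dvd F" "\<forall>q\<in>Z1. value_at F q = 0"
      and G: "homogeneous m G" "\<not> lin a dvd G" "\<forall>q\<in>Z2. value_at G q = 0"
      using *[of Z1] *[of Z2] Z by blast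
    have "value_at (F * G) q = 0" if "q \<in> line a" for q
      using that Z F(3) G(3) by (auto simp: value_simps)
    then have "lin a dvd F * G"
      unfolding lin_dvd_form_iff[OF assms homogeneous_mult[OF F(1) G(1)]] by (auto simp: line_def)
    then show False using lin_prime[OF assms] F(2) G(2) by (simp add: prime_elem_dvd_mult_iff)
  qed
qed

lemma line_subset_iff: assumes "independent2 a b" shows "\<not> line a \<subseteq> line b"
proof -
  obtain q where q: "dotp a q = 0" "dotp b q = 1" using independent2_separating[OF assms] .
  then have "q \<noteq> 0" by auto
  then have "q \<in> line a" "q \<notin> line b" using q by (simp_all add: line_def)
  then show ?thesis by blast
qed

lemma components_two_lines:
  assumes ab: "independent2 a b"
  shows "irreducible_components (line a \<union> line b) = {line a, line b}"
proof -
  note ab0 = independent2_nz[OF ab]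
  have ba: "independent2 b a" using ab independent2_sym by blast
  have sub: "Z \<subseteq> line a \<or> Z \<subseteq> line b" if "zariski_irreducible Z" "Z \<subseteq> line a \<union> line b" for Z
    using that zariski_closed_line unfolding zariski_irreducible_def by blast
  have comp: "Z' = line c" if c: "\<not> line c \<subseteq> line c'" and Z': "line c \<subseteq> Z'" "Z' \<subseteq> line c \<or> Z' \<subseteq> line c'" for Z' c c'
    using that by blast
  have "line a \<in> irreducible_components (line a \<union> line b)"
    unfolding irreducible_components_def
    using zariski_irreducible_line[OF ab0(1)] comp[OF line_subset_iff[OF ab]] sub
    by (intro CollectI conjI allI impI) blast+
  moreover have "line b \<in> irreducible_components (line a \<union> line b)"
    unfolding irreducible_components_def
    using zariski_irreducible_line[OF ab0(2)] comp[OF line_subset_iff[OF ba]] sub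
    by (intro CollectI conjI allI impI) blast+
  moreover have "Z = line a \<or> Z = line b" if "Z \<in> irreducible_components (line a \<union> line b)" for Z
  proof -
    have Z: "zariski_irreducible Z" "Z \<subseteq> line a \<union> line b"
      and max: "\<And>Z'. zariski_irreducible Z' \<Longrightarrow> Z \<subseteq> Z' \<Longrightarrow> Z' \<subseteq> line a \<union> line b \<Longrightarrow> Z' = Z"
      using that unfolding irreducible_components_def by simp_all
    show ?thesis
      using sub[OF Z] max[OF zariski_irreducible_line[OF ab0(1)]] max[OF zariski_irreducible_line[OF ab0(2)]]
      by (metis Un_upper1 Un_upper2)
  qed
  ultimately show ?thesis by blast
qed

lemma curve_degree_line: assumes "a \<noteq> 0" shows "curve_degree (line a) = 1"
  unfolding curve_degree_def
proof (rule the_equality)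
  show "\<exists>F. irreducible F \<and> homogeneous 1 F \<and> line a = {q. q \<noteq> 0 \<and> value_at F q = 0}"
    using prime_elem_imp_irreducible[OF lin_prime[OF assms]] homogeneous_lin
    by (intro exI[of _ "lin a"]) (auto simp: line_def value_lin)
  fix n assume "\<exists>F. irreducible F \<and> homogeneous n F \<and> line a = {q. q \<noteq> 0 \<and> value_at F q = 0}"
  then obtain F where F: "irreducible F" "homogeneous n F" "line a = {q. q \<noteq> 0 \<and> value_at F q = 0}" by blast
  have "lin a dvd F" unfolding lin_dvd_form_iff[OF assms F(2)] using F(3) by (auto simp: line_def)
  then obtain G where G: "F = lin a * G" ..
  have "is_unit G" using irreducibleD[OF F(1) G] prime_elem_not_unit[OF lin_prime[OF assms]] by blast
  then have "homogeneous (1 + 0) F" unfolding G by (intro homogeneous_mult homogeneous_lin unit_homogeneous)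
  then show "n = 1" using homogeneous_unique[OF F(2)] F(1) by (simp add: irreducible_def)
qed

theorem kummer_cover_branching:
  assumes "kummer_cover T a b \<theta> d" and res: "resolution T Y" and st: "stein_factorization T Y N"
  shows "weighted_branching T N = Poly_Mapping.single [d] 2"
proof -
  interpret A: kummer_cover T a b \<theta> d by fact
  interpret B: kummer_cover T b a "inverse \<theta>" d by (rule A.swapped)
  note ab0 = independent2_nz[OF A.ab]
  have "branch_locus T N = line a \<union> line b"
  proof
    show "branch_locus T N \<subseteq> line a \<union> line b"
    proof
      fix q assume "q \<in> branch_locus T N"
      then obtain S where S: "S \<in> N" "lies_over T S q" "\<not> local_biholomorphism T S q"
        unfolding branch_locus_def by blast
      then show "q \<in> line a \<union> line b"
        using A.unramified[OF res st S(1,2)] by (auto simp: line_def lies_over_def)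
    qed
    show "line a \<union> line b \<subseteq> branch_locus T N"
      using A.branch_line_in_locus[OF res st] B.branch_line_in_locus[OF res st] by (auto simp: line_def)
  qed
  then have c: "irreducible_components (branch_locus T N) = {line a, line b}"
    using components_two_lines[OF A.ab] by simp
  have "line a \<noteq> line b" using line_subset_iff[OF A.ab] by blast
  then show ?thesis
    unfolding weighted_branching_def c
    using A.branching_tuple_line[OF res st] B.branching_tuple_line[OF res st] ab0
    by (simp add: curve_degree_line line_def[symmetric] flip: single_add)
qed

section \<open>The Gauss map\<close>

lemma homogeneous_subst:
  fixes L :: "cpoly3 ^ 3"
  assumes G: "homogeneous n G" and L: "\<And>i. homogeneous k (L $ i)"
  shows "homogeneous (k * n) (eval3 cst G L)"
  unfolding homogeneous_iff_scaled
proof -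
  have "scaled (cst c) = [:cst c:]" for c
    by (simp add: scaled_def eval3_cst hom_cst_const)
  then have "scaled (eval3 cst G L) = eval3 (\<lambda>c. [:cst c:]) G (\<chi> i. scaled (L $ i))"
    using hom_eval3_comp[OF hom_scaled hom_cst] by simp
  also have "(\<chi> i. scaled (L $ i)) = monom 1 k *s (\<chi> i. [:L $ i:])"
  proof -
    have "monom 1 k * [:x:] = monom x k" for x :: cpoly3
      using mult_monom[of 1 k x 0] by (simp add: monom_0)
    then show ?thesis using L by (simp add: vec_eq_iff homogeneous_iff_scaled vector_scalar_mult_def)
  qed
  also have "eval3 (\<lambda>c. [:cst c:]) G \<dots> = monom 1 k ^ n * [:eval3 cst G L:]"
    using eval3_scale[OF hom_cst_const G] hom_eval3_comp[OF hom_const_poly hom_cst, of G L] by simp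
  also have "\<dots> = monom (eval3 cst G L) (k * n)"
    by (simp add: monom_power mult_monom monom_0[symmetric])
  finally show "scaled (eval3 cst G L) = monom (eval3 cst G L) (k * n)" .
qed

lemma common_denominator_L:
  assumes T: "dominant_point T" and c: "\<And>i. i < (d::nat) \<Longrightarrow> c i \<in> ratio_field const_ratfun T"
  obtains n G H where "homogeneous n H" "H \<noteq> 0" "\<And>i. i < d \<Longrightarrow> homogeneous n (G i)"
    "\<And>i. i < d \<Longrightarrow> c i = eval3 const_ratfun (G i) T / eval3 const_ratfun H T"
proof -
  interpret dominant_point T by fact
  have "\<exists>n H G. homogeneous n H \<and> H \<noteq> 0 \<and> (\<forall>i<d. homogeneous n (G i) \<and> c i = ev (G i) / ev H)"
    using c
  proof (induction d)
    case 0 show ?case using homogeneous_1 by (intro exI[of _ 0] exI[of _ 1]) simp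
  next
    case (Suc d)
    then obtain n H G where H: "homogeneous n H" "H \<noteq> 0" "\<forall>i<d. homogeneous n (G i) \<and> c i = ev (G i) / ev H"
      by (metis less_SucI)
    obtain m G' H' where G': "homogeneous m G'" "homogeneous m H'" "H' \<noteq> 0" "c d = ev G' / ev H'"
      using Suc.prems[of d] LE by blast
    have nz: "ev H \<noteq> 0" "ev H' \<noteq> 0" using ev_eq_0_iff H G' by blast+
    let ?G = "\<lambda>i. if i < d then G i * H' else H * G'"
    show ?case
    proof (intro exI conjI allI impI)
      show "homogeneous (n + m) (H * H')" "H * H' \<noteq> 0" using H G' homogeneous_mult by auto
      fix i assume "i < Suc d"
      then show "homogeneous (n + m) (?G i)" "c i = ev (?G i) / ev (H * H')"
        using H G' nz homogeneous_mult by (auto simp: ev_simps less_Suc_eq)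
    qed
  qed
  then show ?thesis using that by metis
qed

locale pencil_foliation =
  fixes a b uh vh :: "complex ^ 3" and d :: nat
  assumes d2: "d \<ge> 2" and ab: "independent2 a b" and uv: "independent2 uh vh"
begin

text \<open>
  The foliation has at the point \<open>p\<close> the direction \<open>W p = u\<^sup>d a + v\<^sup>d b\<close>; its tangent line is the
  line through \<open>p\<close> and \<open>W p\<close>.
\<close>

definition W :: "cpoly3 ^ 3" where "W = (\<chi> i. cst (a $ i) * lin uh ^ d + cst (b $ i) * lin vh ^ d)"

definition \<omega> :: "cpoly3 ^ 3" where "\<omega> = crossp W coord"

lemma homogeneous_W: "homogeneous d (W $ i)"
proof -
  have "homogeneous (0 + d * 1) (cst c * lin x ^ d)" for c x
    by (intro homogeneous_mult homogeneous_cst homogeneous_power homogeneous_lin)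
  then have "homogeneous d (cst c * lin x ^ d)" for c x by simp
  then show ?thesis unfolding W_def by (simp only: vec_lambda_beta homogeneous_add)
qed

lemma homogeneous_\<omega>: "homogeneous (d + 1) (\<omega> $ i)"
  using exhaust_3[of i] homogeneous_mult[OF homogeneous_W homogeneous_coord] homogeneous_diff
  by (auto simp: \<omega>_def)

definition W_at :: "(complex \<Rightarrow> 'a::comm_ring_1) \<Rightarrow> 'a ^ 3 \<Rightarrow> 'a ^ 3" where
  "W_at \<iota> p = (dotp (vmap \<iota> uh) p) ^ d *s vmap \<iota> a + (dotp (vmap \<iota> vh) p) ^ d *s vmap \<iota> b"

lemma eval3_W: assumes "unital_hom \<iota>" shows "eval3 \<iota> (W $ i) p = W_at \<iota> p $ i"
proof -
  note h = hom_eval3[OF assms, of p]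
  have "eval3 \<iota> (W $ i) p = \<iota> (a $ i) * dotp (vmap \<iota> uh) p ^ d + \<iota> (b $ i) * dotp (vmap \<iota> vh) p ^ d"
    unfolding W_def vec_lambda_beta hom_add[OF h] hom_mult[OF h] hom_power[OF h] eval3_lin[OF assms] eval3_cst[OF assms] ..
  then show ?thesis by (simp add: W_at_def mult.commute)
qed

lemma eval3_\<omega>: assumes "unital_hom \<iota>" shows "(\<chi> i. eval3 \<iota> (\<omega> $ i) p) = crossp (W_at \<iota> p) p"
proof -
  note h = hom_eval3[OF assms, of p]
  show ?thesis
    by (simp add: vec3_eq_iff \<omega>_def hom_diff[OF h] hom_mult[OF h] eval3_W[OF assms] eval3_coord[OF assms])
qed

abbreviation base :: "complex ^ 3" where "base \<equiv> crossp uh vh"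

text \<open>
  On the line \<open>v = \<tau> u\<close> through the base point the direction is constantly \<open>a + \<tau>\<^sup>d b\<close>; this vanishes when the line
  itself has this direction.
\<close>

definition incidence :: "complex \<Rightarrow> complex" where "incidence \<tau> = dotp (a + \<tau> ^ d *s b) (vh - \<tau> *s uh)"

definition incidence_poly :: "complex poly" where
  "incidence_poly = monom (dotp a vh) 0 + monom (- dotp a uh) 1 + monom (dotp b vh) d + monom (- dotp b uh) (d + 1)"

lemma eval_incidence_poly:
  assumes "unital_hom \<iota>"
  shows "poly (map_poly \<iota> incidence_poly) t = dotp (vmap \<iota> a + t ^ d *s vmap \<iota> b) (vmap \<iota> vh - t *s vmap \<iota> uh)"
proof -
  note h = hom_eval[OF assms, of t]
  have m: "poly (map_poly \<iota> (monom c n)) t = \<iota> c * t ^ n" for c n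
    by (simp add: map_poly_monom hom_zero[OF assms] poly_monom)
  show ?thesis
    unfolding incidence_poly_def hom_add[OF h] m hom_minus[OF assms] dotp_hom[OF assms] dotp_add dotp_diff dotp_scale
    by (simp add: algebra_simps)
qed

lemma poly_incidence_poly: "poly incidence_poly \<tau> = incidence \<tau>"
  using eval_incidence_poly[OF hom_id, of \<tau>] by (simp add: incidence_def map_poly_idI)

lemma incidence_poly_nz: "incidence_poly \<noteq> 0"
proof
  assume "incidence_poly = 0"
  then have "coeff incidence_poly 0 = 0" "coeff incidence_poly 1 = 0" "coeff incidence_poly d = 0" "coeff incidence_poly (d + 1) = 0" by simp_all
  then have "dotp a vh = 0" "dotp a uh = 0" "dotp b vh = 0" "dotp b uh = 0"
    using d2 by (auto simp: incidence_poly_def)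
  then obtain x y where "a = x *s base" "b = y *s base"
    using common_zero[OF uv] dotp_commute by metis
  then have "crossp a b = 0" by (simp add: vec3_simps)
  then show False using ab by (simp add: independent2_def)
qed

lemma finite_incidence: "finite {\<tau>. incidence \<tau> = 0}"
  using poly_roots_finite[OF incidence_poly_nz] by (simp add: poly_incidence_poly)

text \<open>The homogeneous version: the points whose direction is that of the line joining them to the base point.\<close>

definition H :: cpoly3 where
  "H = (\<Sum>i\<in>UNIV. W $ i * (cst (vh $ i) * lin uh - cst (uh $ i) * lin vh))"

lemma homogeneous_H: "homogeneous (d + 1) H"
proof -
  have "homogeneous (0 + 1) (cst c * lin x)" for c x by (intro homogeneous_mult homogeneous_cst homogeneous_lin)
  then have "homogeneous 1 (cst c * lin x)" for c x by simp
  then show ?thesis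
    unfolding H_def by (intro homogeneous_sum homogeneous_mult homogeneous_W homogeneous_diff)
qed

lemma eval3_H:
  assumes "unital_hom \<iota>"
  shows "eval3 \<iota> H p = dotp (W_at \<iota> p) (dotp (vmap \<iota> uh) p *s vmap \<iota> vh - dotp (vmap \<iota> vh) p *s vmap \<iota> uh)"
proof -
  note h = hom_eval3[OF assms, of p]
  show ?thesis
    unfolding H_def hom_sum[OF h] hom_mult[OF h] hom_diff[OF h] eval3_W[OF assms] eval3_lin[OF assms] eval3_cst[OF assms]
    by (simp add: dotp_def mult.commute)
qed

lemma H_nz: "H \<noteq> 0"
proof
  assume H0: "H = 0"
  have "incidence \<tau> = 0" for \<tau>
  proof -
    obtain p1 where p1: "dotp vh p1 = 0" "dotp uh p1 = 1" using independent2_separating uv independent2_sym by metis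
    obtain p2 where p2: "dotp uh p2 = 0" "dotp vh p2 = 1" using independent2_separating uv by metis
    define p where "p = p1 + \<tau> *s p2"
    have p: "dotp uh p = 1" "dotp vh p = \<tau>" using p1 p2 by (simp_all add: p_def dotp_add dotp_scale)
    have "0 = value_at H p" using H0 by (simp add: value_simps)
    also have "\<dots> = incidence \<tau>" unfolding eval3_H[OF hom_id] by (simp add: p W_at_def incidence_def)
    finally show ?thesis by simp
  qed
  then have "{\<tau>. incidence \<tau> = 0} = UNIV" by auto
  then show False using finite_incidence infinite_UNIV_char_0[where 'a = complex] by simp
qed

text \<open>
  The points at which the tangent line is \<open>q\<close>: they lie on \<open>q\<close> and on a line \<open>v = \<tau> u\<close>
  through the base point on which the direction field is constant and tangent to \<open>q\<close>.
\<close>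

lemma gauss_fibre:
  assumes q: "dotp (a + \<tau> ^ d *s b) q = 0" and p: "p = crossp q (vh - \<tau> *s uh)"
  shows "dotp uh p = - dotp base q" "dotp vh p = \<tau> * - dotp base q"
    "crossp (W_at (\<lambda>c. c) p) p = ((- dotp base q) ^ d * incidence \<tau>) *s q"
proof -
  define e where "e = - dotp base q"
  show u: "dotp uh p = - dotp base q" "dotp vh p = \<tau> * - dotp base q"
    unfolding p by (simp_all add: dotp_3 algebra_simps)
  define X where "X = a + \<tau> ^ d *s b"
  have "W_at (\<lambda>c. c) p = e ^ d *s X"
    unfolding W_at_def X_def by (simp add: u e_def[symmetric] power_mult_distrib vec_eq_iff algebra_simps)
  moreover have "crossp X (crossp q m) = dotp X m *s q - dotp X q *s m" for m
    by (simp add: vec3_simps algebra_simps)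
  moreover have "crossp (c *s x) y = c *s crossp x y" for c :: complex and x y
    by (simp add: vec3_simps algebra_simps)
  ultimately show "crossp (W_at (\<lambda>c. c) p) p = ((- dotp base q) ^ d * incidence \<tau>) *s q"
    using q unfolding p X_def[symmetric] e_def[symmetric] by (simp add: incidence_def X_def[symmetric])
qed

abbreviation T :: "ratfun ^ 3" where "T \<equiv> gauss_coords \<omega>"

abbreviation gp :: "ratfun ^ 3" where "gp \<equiv> generic_point_plane"

definition u :: ratfun where "u = dotp (vmap const_ratfun uh) gp"
definition v :: ratfun where "v = dotp (vmap const_ratfun vh) gp"

definition \<theta> :: ratfun where "\<theta> = v / u"

lemma dotp_gp_nz: "x \<noteq> 0 \<Longrightarrow> dotp (vmap const_ratfun x) gp \<noteq> 0"
  using plane.dlin_nz[of x] by (simp add: plane.dlin_dotp)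

lemma u_nz: "u \<noteq> 0" and v_nz: "v \<noteq> 0"
  unfolding u_def v_def using dotp_gp_nz independent2_nz[OF uv] by auto

lemma T_eq: "T = crossp (W_at const_ratfun gp) gp"
  unfolding gauss_coords_def by (rule eval3_\<omega>[OF const_ratfun_hom])

text \<open>
  A generic line is tangent to the foliation at \<open>d\<close> points with \<open>d\<close> different
  values of \<open>\<theta>\<close>; hence a polynomial in \<open>\<theta>\<close> of degree less than \<open>d\<close> over the field of the dual
  plane vanishes only if its coefficients do.
\<close>

lemma forms_independent:
  assumes G: "\<And>i. i < d \<Longrightarrow> homogeneous n (G i)"
    and 0: "(\<Sum>i<d. eval3 const_ratfun (G i) T * \<theta> ^ i) = 0" and j: "j < d"
  shows "G j = 0"
proof -
  define F where "F = (\<Sum>i<d. eval3 cst (G i) \<omega> * (lin vh ^ i * lin uh ^ (d - 1 - i)))"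
  have hF: "homogeneous ((d + 1) * n + (d - 1)) F"
    unfolding F_def
  proof (rule homogeneous_sum)
    fix i assume "i \<in> {..<d}"
    then have i: "i < d" by simp
    have "homogeneous ((d + 1) * n + (i * 1 + (d - 1 - i) * 1)) (eval3 cst (G i) \<omega> * (lin vh ^ i * lin uh ^ (d - 1 - i)))"
      using homogeneous_subst[OF G[OF i] homogeneous_\<omega>]
      by (intro homogeneous_mult homogeneous_power homogeneous_lin)
    moreover have "i * 1 + (d - 1 - i) * 1 = d - 1" using i by simp
    ultimately show "homogeneous ((d + 1) * n + (d - 1)) (eval3 cst (G i) \<omega> * (lin vh ^ i * lin uh ^ (d - 1 - i)))"
      by (simp only:)
  qed
  note h = hom_eval3[OF const_ratfun_hom, of gp]
  have "eval3 const_ratfun F gp = (\<Sum>i<d. eval3 const_ratfun (G i) T * (v ^ i * u ^ (d - 1 - i)))"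
    unfolding F_def hom_sum[OF h] hom_mult[OF h] hom_power[OF h] eval3_lin[OF const_ratfun_hom]
      eval3_subst[OF const_ratfun_hom] u_def[symmetric] v_def[symmetric] gauss_coords_def ..
  also have "\<dots> = u ^ (d - 1) * (\<Sum>i<d. eval3 const_ratfun (G i) T * \<theta> ^ i)"
    unfolding sum_distrib_left
  proof (intro sum.cong refl)
    fix i assume "i \<in> {..<d}"
    then have "u ^ (d - 1) = u ^ (d - 1 - i) * u ^ i" by (simp flip: power_add)
    then show "eval3 const_ratfun (G i) T * (v ^ i * u ^ (d - 1 - i)) = u ^ (d - 1) * (eval3 const_ratfun (G i) T * \<theta> ^ i)"
      using u_nz by (simp add: \<theta>_def power_divide)
  qed
  finally have "eval3 const_ratfun F gp = 0" using 0 by simp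
  then have F0: "F = 0" using plane.generic[OF hF] by blast
  define bad where "bad = {\<tau>. incidence \<tau> = 0}"
  define E where "E = lin a * (lin b * (lin base * (\<Prod>\<tau>\<in>bad. lin (a + \<tau> ^ d *s b))))"
  have "value_at (E * G j) q = 0" for q
  proof (rule ccontr)
    assume nz: "value_at (E * G j) q \<noteq> 0"
    have fin: "finite bad" unfolding bad_def by (rule finite_incidence)
    have q: "dotp a q \<noteq> 0" "dotp b q \<noteq> 0" "dotp base q \<noteq> 0" "\<And>\<tau>. \<tau> \<in> bad \<Longrightarrow> dotp (a + \<tau> ^ d *s b) q \<noteq> 0"
      "value_at (G j) q \<noteq> 0"
      using nz fin by (auto simp: E_def value_simps value_lin hom_prod[OF hom_eval3[OF hom_id]])
    define X where "X = {\<tau>. \<tau> ^ d = - dotp a q / dotp b q}"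
    have cX: "card X = d" unfolding X_def
      by (rule card_nth_roots) (use q d2 in auto)
    define h where "h = (\<Sum>i<d. monom (value_at (G i) q) i)"
    have "X \<subseteq> {\<tau>. poly h \<tau> = 0}"
    proof
      fix \<tau> assume "\<tau> \<in> X"
      have \<tau>: "dotp (a + \<tau> ^ d *s b) q = 0"
      proof -
        have "\<tau> ^ d * dotp b q = - dotp a q" using \<open>\<tau> \<in> X\<close> q by (simp add: X_def)
        then show ?thesis unfolding dotp_add dotp_scale by simp
      qed
      define p where "p = crossp q (vh - \<tau> *s uh)"
      define e where "e = - dotp base q"
      have e: "e \<noteq> 0" "incidence \<tau> \<noteq> 0" using q \<tau> by (auto simp: e_def bad_def)
      note fib = gauss_fibre[OF \<tau> p_def, folded e_def]
      note hv = hom_eval3[OF hom_id, of p]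
      have "(\<chi> i. value_at (\<omega> $ i) p) = (e ^ d * incidence \<tau>) *s q"
        unfolding eval3_\<omega>[OF hom_id] fib(3) ..
      then have "value_at (eval3 cst (G i) \<omega>) p = (e ^ d * incidence \<tau>) ^ n * value_at (G i) q" if "i < d" for i
        using eval3_scale[OF hom_id G[OF that]] by (simp add: eval3_subst[OF hom_id])
      then have "value_at F p = (\<Sum>i<d. (e ^ d * incidence \<tau>) ^ n * value_at (G i) q * ((\<tau> * e) ^ i * e ^ (d - 1 - i)))"
        unfolding F_def hom_sum[OF hv] by (simp add: value_simps value_lin fib)
      also have "\<dots> = (e ^ d * incidence \<tau>) ^ n * e ^ (d - 1) * poly h \<tau>"
        unfolding h_def poly_sum sum_distrib_left
      proof (intro sum.cong refl)
        fix i assume "i \<in> {..<d}"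
        then have "e ^ (d - 1) = e ^ i * e ^ (d - 1 - i)" by (simp flip: power_add)
        then show "(e ^ d * incidence \<tau>) ^ n * value_at (G i) q * ((\<tau> * e) ^ i * e ^ (d - 1 - i)) =
          (e ^ d * incidence \<tau>) ^ n * e ^ (d - 1) * poly (monom (value_at (G i) q) i) \<tau>"
          by (simp add: poly_monom power_mult_distrib mult_ac)
      qed
      finally show "\<tau> \<in> {\<tau>. poly h \<tau> = 0}" using F0 e by (simp add: value_simps)
    qed
    moreover have "degree h < d"
    proof -
      have "degree h \<le> d - 1" unfolding h_def
      proof (rule degree_sum_le)
        fix i assume "i \<in> {..<d}"
        then show "degree (monom (value_at (G i) q) i) \<le> d - 1"
          using degree_monom_le[of "value_at (G i) q" i] by simp
      qed simp
      then show ?thesis using d2 by simp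
    qed
    ultimately have "h = 0"
      using card_poly_roots_bound[of h] cX card_mono[OF poly_roots_finite[of h]] by (metis leD le_trans)
    moreover have "coeff h j = value_at (G j) q" unfolding h_def using j by (simp add: coeff_sum)
    ultimately show False using q(5) by simp
  qed
  then have "E * G j = 0" by (rule cpoly3_eq_0I)
  moreover have "a + \<tau> ^ d *s b \<noteq> 0" for \<tau>
  proof
    assume "a + \<tau> ^ d *s b = 0"
    then have "1 *s a + \<tau> ^ d *s b = 0" by simp
    then show False using ab unfolding independent2_iff by (metis zero_neq_one)
  qed
  then have "E \<noteq> 0"
    using independent2_nz[OF ab] uv finite_incidence by (auto simp: E_def lin_eq_0_iff independent2_def bad_def)
  ultimately show ?thesis by simp
qed

lemma dominant: "dominant_point T"
proof
  fix n G assume G: "homogeneous n G" "eval3 const_ratfun G T = 0"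
  define H where "H i = (if i = 0 then G else 0)" for i :: nat
  have "(\<Sum>i<d. eval3 const_ratfun (H i) T * \<theta> ^ i) = (\<Sum>i<d. 0)"
    using G(2) hom_zero[OF hom_eval3[OF const_ratfun_hom]] by (intro sum.cong) (auto simp: H_def)
  then have "H 0 = 0" using forms_independent[of n H 0] G d2 by (simp add: H_def homogeneous_0)
  then show "G = 0" by (simp add: H_def)
qed

sublocale D: dominant_point T by (rule dominant)

lemma dlin_T: "D.dlin a = v ^ d * dotp (vmap const_ratfun (crossp a b)) gp"
    "D.dlin (- b) = u ^ d * dotp (vmap const_ratfun (crossp a b)) gp"
proof -
  have e: "D.dlin x = dotp (vmap const_ratfun x) (crossp (W_at const_ratfun gp) gp)" for x
    unfolding T_eq[symmetric] by (rule D.dlin_dotp)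
  show "D.dlin a = v ^ d * dotp (vmap const_ratfun (crossp a b)) gp"
    "D.dlin (- b) = u ^ d * dotp (vmap const_ratfun (crossp a b)) gp"
    unfolding e W_at_def u_def[symmetric] v_def[symmetric]
    by (simp_all add: vec3_simps const_ratfun_simps algebra_simps)
qed

sublocale P: kummer_point T a "- b" \<theta> d
proof
  show "d \<ge> 2" by (rule d2)
  show "independent2 a (- b)" using ab by (auto simp: independent2_def vec3_eq_iff)
  have "dotp (vmap const_ratfun (crossp a b)) gp \<noteq> 0" using dotp_gp_nz ab by (simp add: independent2_def)
  then show "\<theta> ^ d = D.dlin a / D.dlin (- b)" unfolding dlin_T by (simp add: \<theta>_def power_divide)
  fix c i assume c: "\<And>i. i < d \<Longrightarrow> c i \<in> D.L" and 0: "(\<Sum>i<d. c i * \<theta> ^ i) = 0" and i: "i < d"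
  obtain n G H where H: "homogeneous n H" "H \<noteq> 0" "\<And>i. i < d \<Longrightarrow> homogeneous n (G i)"
    "\<And>i. i < d \<Longrightarrow> c i = D.ev (G i) / D.ev H"
    using common_denominator_L[OF dominant, of d c] c by metis
  have nz: "D.ev H \<noteq> 0" using D.ev_eq_0_iff H by blast
  have "(\<Sum>i<d. D.ev (G i) * \<theta> ^ i) = D.ev H * (\<Sum>i<d. c i * \<theta> ^ i)"
    unfolding sum_distrib_left using nz H(4) by (intro sum.cong) auto
  then have "G i = 0" using forms_independent[OF H(3)] 0 i by simp
  then show "c i = 0" using H(4)[OF i] by (simp add: D.ev_simps)
qed

lemma gp_3: "gp $ 3 = 1"
  by (simp add: generic_point_plane_def)

text \<open>
  The point of the plane is the intersection of its tangent line with the line \<open>v = \<theta> u\<close>.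
\<close>

lemma gp_in_M: "gp $ i \<in> P.K.M"
proof -
  define m where "m = vmap const_ratfun vh - \<theta> *s vmap const_ratfun uh"
  define w where "w = dotp (W_at const_ratfun gp) m"
  have pm: "dotp gp m = 0"
    using u_nz by (simp add: m_def dotp_diff dotp_scale dotp_commute[of gp] \<theta>_def u_def[symmetric] v_def[symmetric])
  have "crossp (crossp x p) m = dotp x m *s p - dotp p m *s x" for x p :: "ratfun ^ 3"
    by (simp add: vec3_simps algebra_simps)
  then have c: "crossp T m = w *s gp" unfolding T_eq w_def using pm by simp
  have w: "w \<noteq> 0"
  proof
    assume "w = 0"
    moreover have "u *s m = u *s vmap const_ratfun vh - v *s vmap const_ratfun uh"
      using u_nz by (simp add: m_def \<theta>_def vec_eq_iff vector_scalar_mult_def right_diff_distrib)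
    then have "eval3 const_ratfun H gp = u * w"
      unfolding eval3_H[OF const_ratfun_hom] u_def[symmetric] v_def[symmetric] w_def by (metis dotp_scale(1))
    ultimately show False using plane.generic[OF homogeneous_H] H_nz by simp
  qed
  have TM: "T $ i / D.dlin a \<in> P.K.M" for i
  proof -
    have "T $ i = D.dlin (axis i 1)"
      using exhaust_3[of i] by (auto simp: D.dlin_dotp dotp_3 axis_def const_ratfun_simps)
    then show ?thesis using D.dlin_L P.K.L_M by simp
  qed
  have cM: "const_ratfun c \<in> P.K.M" for c using D.const_\<O> D.\<O>_L P.K.L_M by blast
  have neg: "- f \<in> P.K.M" if "f \<in> P.K.M" for f
    using P.K.M_mult(1)[OF cM[of "- 1"] that] by (simp add: const_ratfun_simps)
  have sub: "f - g \<in> P.K.M" if "f \<in> P.K.M" "g \<in> P.K.M" for f g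
    using P.K.M_add(1)[OF that(1) neg[OF that(2)]] by simp
  have mM: "m $ i \<in> P.K.M" for i
    unfolding m_def using sub[OF cM P.K.M_mult(1)[OF P.K.\<theta>_M cM]] by simp
  have y: "crossp T m $ i / D.dlin a \<in> P.K.M" for i
  proof -
    have "(T $ i * m $ j - T $ k * m $ l) / D.dlin a \<in> P.K.M" for i j k l
      using sub[OF P.K.M_mult(1)[OF TM mM] P.K.M_mult(1)[OF TM mM], of i j k l] by (simp add: diff_divide_distrib)
    then show ?thesis using exhaust_3[of i] by auto
  qed
  have "gp $ i = (crossp T m $ i / D.dlin a) * inverse (crossp T m $ 3 / D.dlin a)"
    unfolding c using w gp_3 P.a_nz by simp
  then show ?thesis using P.K.M_mult(1)[OF y P.K.M_inverse[OF y]] by metis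
qed

lemma M_UNIV: "f \<in> P.K.M"
proof -
  have cM: "const_ratfun c \<in> P.K.M" for c using D.const_\<O> D.\<O>_L P.K.L_M by blast
  have xy: "Fraction_Field.Fract varX 1 \<in> P.K.M" "Fraction_Field.Fract varY 1 \<in> P.K.M"
    using gp_in_M[of 1] gp_in_M[of 2] by (simp_all add: generic_point_plane_def)
  note hF = hom_add[OF hom_Fract] hom_mult[OF hom_Fract]
  have x: "Fraction_Field.Fract [:h:] 1 \<in> P.K.M" for h :: "complex poly"
  proof (induction h)
    case 0 show ?case using cM[of 0] by (simp add: const_ratfun_simps Zero_fract_def[symmetric])
  next
    case (pCons c h)
    have e: "[:pCons c h:] = [:[:c:]:] + varX * [:h:]" by (simp add: varX_def)
    show ?case
      unfolding e hF const_ratfun_def[symmetric]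
      using P.K.M_add(1)[OF cM[of c] P.K.M_mult(1)[OF xy(1) pCons(2)]] by blast
  qed
  have y: "Fraction_Field.Fract g 1 \<in> P.K.M" for g :: cpoly2
  proof (induction g)
    case 0 show ?case using cM[of 0] by (simp add: const_ratfun_simps Zero_fract_def[symmetric])
  next
    case (pCons h g)
    have e: "pCons h g = [:h:] + varY * g" by (simp add: varY_def)
    show ?case unfolding e hF using P.K.M_add(1)[OF x P.K.M_mult(1)[OF xy(2) pCons(2)]] by blast
  qed
  obtain g h where f: "f = Fraction_Field.Fract g h" "h \<noteq> 0" by (cases f) auto
  have "f = Fraction_Field.Fract g 1 * inverse (Fraction_Field.Fract h 1)"
    using f by simp
  then show ?thesis using P.K.M_mult(1)[OF y P.K.M_inverse[OF y]] by metis
qed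

lemma kummer: "kummer_cover T a (- b) \<theta> d"
proof (intro kummer_cover.intro kummer_cover_axioms.intro)
  show "kummer_point T a (- b) \<theta> d" ..
  fix f show "\<exists>c. (\<forall>i<d. c i \<in> D.L) \<and> f = (\<Sum>i<d. c i * \<theta> ^ i)"
    using M_UNIV[of f] unfolding P.K.M_def by blast
qed

end

section \<open>The rational function field has no regular differentials\<close>

text \<open>
  The field of constants is algebraically closed, so a relation splits into linear factors, one of which would vanish
  and make the element constant.
\<close>

lemma transcendental:
  fixes \<iota> :: "complex \<Rightarrow> 'a::field"
  assumes \<iota>: "unital_hom \<iota>" and x: "x \<notin> range \<iota>" and p: "poly (map_poly \<iota> p) x = 0"
  shows "p = 0"
  using p
proof (induction "degree p" arbitrary: p rule: less_induct)
  case less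
  note h = hom_eval[OF \<iota>, of x]
  show ?case
  proof (cases "degree p = 0")
    case True
    then obtain c where c: "p = [:c:]" by (metis degree_eq_zeroE)
    then have "\<iota> c = 0" using less(2) by (simp add: eval_pCons[OF \<iota>])
    moreover have "\<iota> c \<noteq> 0" if "c \<noteq> 0"
    proof
      assume "\<iota> c = 0"
      then have "\<iota> (c * inverse c) = 0" by (simp add: hom_mult[OF \<iota>])
      then show False using that by (simp add: hom_one[OF \<iota>])
    qed
    ultimately show ?thesis using c by auto
  next
    case False
    then obtain z where "poly p z = 0" using fundamental_theorem_of_algebra by (metis constant_degree)
    then obtain q where q: "p = [:- z, 1:] * q" by (metis dvdE poly_eq_0_iff_dvd)
    then have q0: "q \<noteq> 0" using False by auto
    have "(x - \<iota> z) * poly (map_poly \<iota> q) x = 0"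
      using less(2) unfolding q hom_mult[OF h]
      by (simp add: eval_pCons[OF \<iota>] hom_minus[OF \<iota>] hom_one[OF \<iota>] hom_zero[OF \<iota>])
    moreover have "x - \<iota> z \<noteq> 0" using x by auto
    moreover have "degree p = degree q + 1"
      unfolding q using q0 by (subst degree_mult_eq) auto
    ultimately have "q = 0" using less(1)[of q] by simp
    then show ?thesis using q by simp
  qed
qed

lemma hom_fls_const: "unital_hom fls_const"
  by (simp add: unital_hom_def fls_const_mult_const fls_plus_const)

locale rational_function_field =
  fixes \<tau> :: "complex fls"
  assumes \<tau>: "\<tau> \<notin> range fls_const"
begin

definition ev :: "complex poly \<Rightarrow> complex fls" where "ev p = poly (map_poly fls_const p) \<tau>"

lemma hom_ev: "unital_hom ev"
  unfolding ev_def by (rule hom_eval[OF hom_fls_const])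

lemmas ev_simps = hom_simps[OF hom_ev]

lemma ev_eq_0_iff [simp]: "ev p = 0 \<longleftrightarrow> p = 0"
  using transcendental[OF hom_fls_const \<tau>, of p] ev_simps(2) by (auto simp: ev_def)

lemma ev_eq_iff: "ev p = ev q \<longleftrightarrow> p = q"
  using ev_eq_0_iff[of "p - q"] by (simp add: ev_simps del: ev_eq_0_iff)

lemma ev_const: "ev [:c:] = fls_const c" and ev_X: "ev [:0, 1:] = \<tau>"
  by (simp_all add: ev_def eval_pCons[OF hom_fls_const])

definition E :: "complex fls set" where "E = {ev p / ev q | p q. q \<noteq> 0}"

lemma E_I: "q \<noteq> 0 \<Longrightarrow> ev p / ev q \<in> E" by (auto simp: E_def)

lemma E_ev: "ev p \<in> E" using E_I[of 1 p] by (simp add: ev_simps)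

lemma E_closed: assumes "f \<in> E" "g \<in> E" shows "f + g \<in> E" "f * g \<in> E" "f - g \<in> E" "f / g \<in> E"
proof -
  obtain p q r s where f: "f = ev p / ev q" "q \<noteq> 0" and g: "g = ev r / ev s" "s \<noteq> 0"
    using assms unfolding E_def by blast
  have "f + g = ev (p * s + r * q) / ev (q * s)" "f * g = ev (p * r) / ev (q * s)"
    "f - g = ev (p * s - r * q) / ev (q * s)"
    using f g by (simp_all add: ev_simps add_frac_eq diff_frac_eq)
  then show "f + g \<in> E" "f * g \<in> E" "f - g \<in> E" using f g E_I[of "q * s"] by simp_all
  show "f / g \<in> E"
  proof (cases "r = 0")
    case True then show ?thesis using g E_ev[of 0] by (simp add: ev_simps)
  next
    case False
    have "f / g = ev (p * s) / ev (q * r)" using f g by (simp add: ev_simps)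
    then show ?thesis using E_I[of "q * r"] False f by simp
  qed
qed

text \<open>The local rings of the projective line at the finite points and at infinity.\<close>

definition V :: "complex \<Rightarrow> complex fls set" where "V c = {ev p / ev q | p q. poly q c \<noteq> 0}"

definition V_inf :: "complex fls set" where "V_inf = {ev p / ev q | p q. q \<noteq> 0 \<and> degree p \<le> degree q}"

lemma V_subring: "f \<in> V c \<Longrightarrow> g \<in> V c \<Longrightarrow> f + g \<in> V c \<and> f - g \<in> V c \<and> f * g \<in> V c"
proof -
  assume "f \<in> V c" "g \<in> V c"
  then obtain p q r s where f: "f = ev p / ev q" "poly q c \<noteq> 0" and g: "g = ev r / ev s" "poly s c \<noteq> 0"
    unfolding V_def by blast
  then have nz: "q \<noteq> 0" "s \<noteq> 0" by auto
  have "f + g = ev (p * s + r * q) / ev (q * s)" "f * g = ev (p * r) / ev (q * s)"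
    "f - g = ev (p * s - r * q) / ev (q * s)"
    using f g nz by (simp_all add: ev_simps add_frac_eq diff_frac_eq)
  moreover have "poly (q * s) c \<noteq> 0" using f g by simp
  ultimately show ?thesis unfolding V_def by blast
qed

lemma V_inf_subring: "f \<in> V_inf \<Longrightarrow> g \<in> V_inf \<Longrightarrow> f + g \<in> V_inf \<and> f - g \<in> V_inf \<and> f * g \<in> V_inf"
proof -
  assume "f \<in> V_inf" "g \<in> V_inf"
  then obtain p q r s where f: "f = ev p / ev q" "q \<noteq> 0" "degree p \<le> degree q"
    and g: "g = ev r / ev s" "s \<noteq> 0" "degree r \<le> degree s"
    unfolding V_inf_def by blast
  have "f + g = ev (p * s + r * q) / ev (q * s)" "f * g = ev (p * r) / ev (q * s)"
    "f - g = ev (p * s - r * q) / ev (q * s)"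
    using f g by (simp_all add: ev_simps add_frac_eq diff_frac_eq)
  moreover have d: "degree (q * s) = degree q + degree s" using f g by (simp add: degree_mult_eq)
  have "degree (p * s) \<le> degree q + degree s" "degree (r * q) \<le> degree q + degree s" "degree (p * r) \<le> degree q + degree s"
    using f g degree_mult_le[of p s] degree_mult_le[of r q] degree_mult_le[of p r] by linarith+
  then have "degree (p * s + r * q) \<le> degree (q * s)" "degree (p * r) \<le> degree (q * s)" "degree (p * s - r * q) \<le> degree (q * s)"
    unfolding d by (auto intro: degree_add_le degree_diff_le)
  moreover have "q * s \<noteq> 0" using f g by simp
  ultimately show ?thesis unfolding V_inf_def by blast
qed

lemma const_V: "fls_const c \<in> V z" "fls_const c \<in> V_inf"
proof -
  have e: "fls_const c = ev [:c:] / ev 1" by (simp add: ev_simps ev_const)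
  show "fls_const c \<in> V z" unfolding V_def e by (intro CollectI exI[of _ "[:c:]"] exI[of _ 1]) simp
  show "fls_const c \<in> V_inf" unfolding V_inf_def e by (intro CollectI exI[of _ "[:c:]"] exI[of _ 1]) simp
qed

lemma E_coprime: assumes "f \<in> E" obtains p q where "coprime p q" "q \<noteq> 0" "f = ev p / ev q"
proof -
  obtain p q where f: "f = ev p / ev q" "q \<noteq> 0" using assms unfolding E_def by blast
  obtain g p' q' where *: "g \<noteq> 0" "p = p' * g" "q = q' * g" "coprime p' q'"
    using gcd_coprime_exists[of p q] f(2) by (metis gcd_eq_0_iff)
  have "f = ev p' / ev q'" unfolding f(1) *(2,3) using *(1) by (simp add: ev_simps)
  moreover have "q' \<noteq> 0" using f *(3) by auto
  ultimately show ?thesis using * that by blast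
qed

lemma coprime_no_common_root: "coprime p q \<Longrightarrow> poly p c = 0 \<Longrightarrow> poly q (c::complex) \<noteq> 0"
proof
  assume "coprime p q" "poly p c = 0" "poly q c = 0"
  then have "is_unit [:- c, 1:]" using poly_eq_0_iff_dvd coprime_common_divisor by metis
  then show False by (simp add: is_unit_poly_iff)
qed

lemma place_V: "place_ring fls_const E (V c)"
  unfolding place_ring_def
proof (intro conjI ballI)
  show "is_subring (V c)" unfolding is_subring_def
    using V_subring const_V(1)[of 1 c] by (simp)
  show "range fls_const \<subseteq> V c" using const_V by blast
  have "V c \<subseteq> E" unfolding V_def E_def by force
  moreover have "1 / ev [:- c, 1:] \<notin> V c"
  proof
    assume "1 / ev [:- c, 1:] \<in> V c"
    then obtain p q where pq: "1 / ev [:- c, 1:] = ev p / ev q" "poly q c \<noteq> 0" unfolding V_def by blast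
    then have "q \<noteq> 0" by auto
    then have "ev q = ev p * ev [:- c, 1:]" using pq by (simp add: field_simps)
    then have "ev q = ev (p * [:- c, 1:])" by (simp only: ev_simps(4))
    then have "q = p * [:- c, 1:]" unfolding ev_eq_iff .
    then show False using pq(2) by simp
  qed
  moreover have "1 / ev [:- c, 1:] \<in> E" using E_I[of "[:- c, 1:]" 1] by (simp add: ev_simps(1))
  ultimately show "V c \<subset> E" by blast
  fix f assume "f \<in> E"
  then obtain p q where f: "coprime p q" "q \<noteq> 0" "f = ev p / ev q" by (rule E_coprime)
  show "f \<in> V c \<or> inverse f \<in> V c"
  proof (cases "poly q c = 0")
    case True
    then have "poly p c \<noteq> 0" using coprime_no_common_root f(1) by blast
    moreover have "inverse f = ev q / ev p" using f by simp
    ultimately show ?thesis unfolding V_def by blast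
  qed (use f V_def in blast)
qed

lemma place_V_inf: "place_ring fls_const E V_inf"
  unfolding place_ring_def
proof (intro conjI ballI)
  show "is_subring V_inf" unfolding is_subring_def
    using V_inf_subring const_V(2)[of 1] by (simp)
  show "range fls_const \<subseteq> V_inf" using const_V by blast
  have "V_inf \<subseteq> E" unfolding V_inf_def E_def by blast
  moreover have "\<tau> \<notin> V_inf"
  proof
    assume "\<tau> \<in> V_inf"
    then obtain p q where pq: "ev [:0, 1:] = ev p / ev q" "q \<noteq> 0" "degree p \<le> degree q" unfolding V_inf_def ev_X by blast
    then have "ev q * ev [:0, 1:] = ev p" by (simp add: field_simps)
    then have "ev (q * [:0, 1:]) = ev p" by (simp only: ev_simps(4))
    then have "q * [:0, 1:] = p" unfolding ev_eq_iff .
    then have "degree p = degree q + 1" using pq(2) by (metis degree_mult_eq degree_pCons_eq_if degree_0 pCons_eq_0_iff one_neq_zero Suc_eq_plus1 add.commute plus_1_eq_Suc One_nat_def)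
    then show False using pq(3) by simp
  qed
  moreover have "\<tau> \<in> E" using E_ev[of "[:0, 1:]"] by (simp add: ev_X)
  ultimately show "V_inf \<subset> E" by blast
  fix f assume "f \<in> E"
  then obtain p q where f: "f = ev p / ev q" "q \<noteq> 0" unfolding E_def by blast
  show "f \<in> V_inf \<or> inverse f \<in> V_inf"
  proof (cases "degree p \<le> degree q")
    case False
    then have "p \<noteq> 0" by auto
    moreover have "inverse f = ev q / ev p" using f by simp
    ultimately show ?thesis using False unfolding V_inf_def by (metis (mono_tags, lifting) mem_Collect_eq nat_le_linear)
  qed (use f V_inf_def in blast)
qed

lemma fls_deriv_\<tau>: "fls_deriv \<tau> \<noteq> 0"
proof
  assume "fls_deriv \<tau> = 0"
  moreover have "fls_nth (fls_deriv \<tau>) (n - 1) = of_int n * fls_nth \<tau> n" for n by simp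
  ultimately have "of_int n * fls_nth \<tau> n = 0" for n by (metis fls_zero_nth)
  then have "fls_nth \<tau> n = 0" if "n \<noteq> 0" for n using that by (metis mult_eq_0_iff of_int_eq_0_iff)
  then have "\<tau> = fls_const (fls_nth \<tau> 0)" by (intro fls_eqI) simp
  then show False using \<tau> by blast
qed

text \<open>The derivation \<open>d/d\<tau>\<close>, obtained from that of Laurent series by the chain rule.\<close>

definition D0 :: "complex fls \<Rightarrow> complex fls" where
  "D0 f = (if f \<in> E then fls_deriv f / fls_deriv \<tau> else 0)"

lemma fls_deriv_ev: "fls_deriv (ev p) = ev (pderiv p) * fls_deriv \<tau>"
proof (induction p)
  case 0 show ?case by (simp add: ev_simps(2))
next
  case (pCons c p)
  have "pCons c p = [:c:] + [:0, 1:] * p" by simp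
  then have "ev (pCons c p) = fls_const c + \<tau> * ev p"
    by (metis ev_simps(3,4) ev_const ev_X)
  moreover have "pderiv (pCons c p) = p + [:0, 1:] * pderiv p" by (simp add: pderiv_pCons)
  then have "ev (pderiv (pCons c p)) = ev p + \<tau> * ev (pderiv p)" by (metis ev_simps(3,4) ev_X)
  ultimately show ?case using pCons by (simp add: algebra_simps)
qed

lemma derivation_ev:
  assumes D: "D \<in> derivations fls_const E"
  shows "D (ev p) = ev (pderiv p) * D \<tau>"
proof (induction p)
  case 0
  have "D (fls_const 0) = 0" using D unfolding derivations_def by blast
  then show ?case by (simp add: ev_simps(2))
next
  case (pCons c p)
  have "pCons c p = [:c:] + [:0, 1:] * p" by simp
  then have e: "ev (pCons c p) = ev [:c:] + \<tau> * ev p"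
    by (metis ev_simps(3,4) ev_X)
  have EE: "ev [:c:] \<in> E" "\<tau> \<in> E" "ev p \<in> E" "\<tau> * ev p \<in> E" using E_ev E_closed ev_X by metis+
  have add: "D (f + g) = D f + D g" and mul: "D (f * g) = D f * g + f * D g" if "f \<in> E" "g \<in> E" for f g
    using D that unfolding derivations_def by blast+
  have "D (ev (pCons c p)) = D (ev [:c:]) + (D \<tau> * ev p + \<tau> * D (ev p))"
    unfolding e add[OF EE(1,4)] mul[OF EE(2,3)] ..
  moreover have "D (ev [:c:]) = 0" using D unfolding derivations_def ev_const by blast
  moreover have "pderiv (pCons c p) = p + [:0, 1:] * pderiv p" by (simp add: pderiv_pCons)
  then have "ev (pderiv (pCons c p)) = ev p + \<tau> * ev (pderiv p)" by (metis ev_simps(3,4) ev_X)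
  ultimately show ?case using pCons by (simp add: algebra_simps)
qed

lemma quotient_rule:
  fixes q :: "'a::field"
  assumes "q \<noteq> 0" shows "(p' * t - p / q * (q' * t)) / q = (p' * q - p * q') / (q * q) * t"
  using assms by (simp add: field_simps)

lemma derivation_frac:
  assumes D: "D \<in> derivations fls_const E" and q: "q \<noteq> 0"
  shows "D (ev p / ev q) = ev (pderiv p * q - p * pderiv q) / ev (q ^ 2) * D \<tau>"
proof -
  let ?f = "ev p / ev q"
  have "D (?f * ev q) = D ?f * ev q + ?f * D (ev q)"
    using D E_I[OF q, of p] E_ev[of q] unfolding derivations_def by blast
  moreover have "?f * ev q = ev p" using q by simp
  ultimately have "D ?f * ev q = ev (pderiv p) * D \<tau> - ?f * (ev (pderiv q) * D \<tau>)"
    using derivation_ev[OF D] by (simp add: algebra_simps)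
  then have "D ?f = (ev (pderiv p) * D \<tau> - ?f * (ev (pderiv q) * D \<tau>)) / ev q"
    using q by (simp add: field_simps)
  also have "\<dots> = ev (pderiv p * q - p * pderiv q) / ev (q ^ 2) * D \<tau>"
    unfolding ev_simps(4,6) power2_eq_square using quotient_rule[of "ev q"] q by simp
  finally show ?thesis .
qed

lemma D0: "D0 \<in> derivations fls_const E"
proof -
  have "D0 f \<in> E" if "f \<in> E" for f
  proof -
    obtain p q where f: "f = ev p / ev q" "q \<noteq> 0" using \<open>f \<in> E\<close> unfolding E_def by blast
    have "fls_deriv (f * ev q) = fls_deriv f * ev q + f * fls_deriv (ev q)" by (simp add: algebra_simps)
    moreover have "f * ev q = ev p" using f by simp
    ultimately have "fls_deriv f * ev q = (ev (pderiv p) - f * ev (pderiv q)) * fls_deriv \<tau>"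
      by (simp add: fls_deriv_ev algebra_simps)
    then have "D0 f = (ev (pderiv p) - f * ev (pderiv q)) / ev q"
      using that f(2) fls_deriv_\<tau> by (simp add: D0_def field_simps)
    then show ?thesis using that E_ev E_closed by simp
  qed
  moreover have "fls_const c \<in> E" for c using E_ev[of "[:c:]"] by (simp add: ev_const)
  ultimately show ?thesis
    unfolding derivations_def
    using E_closed by (auto simp: D0_def add_divide_distrib add.commute mult.commute)
qed

lemma D0_\<tau>: "D0 \<tau> = 1"
  using E_ev[of "[:0, 1:]"] fls_deriv_\<tau> by (simp add: D0_def ev_X)

lemma derivation_D0: assumes "D \<in> derivations fls_const E" "f \<in> E" shows "D f = D0 f * D \<tau>"
proof -
  obtain p q where f: "f = ev p / ev q" "q \<noteq> 0" using assms(2) unfolding E_def by blast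
  show ?thesis unfolding f(1) derivation_frac[OF assms(1) f(2)] derivation_frac[OF D0 f(2)] by (simp add: D0_\<tau>)
qed

lemma D0_V: assumes "f \<in> V c" shows "D0 f \<in> V c"
proof -
  obtain p q where f: "f = ev p / ev q" "poly q c \<noteq> 0" using assms unfolding V_def by blast
  then have q: "q \<noteq> 0" by auto
  have "poly (q ^ 2) c \<noteq> 0" using f by simp
  then show ?thesis unfolding f(1) derivation_frac[OF D0 q] D0_\<tau> V_def by (simp only: mult_1_right) blast
qed

text \<open>
  The differential \<open>d \<tau>\<close> has a double pole at infinity. The value at infinity of a regular function
  is subtracted in order to gain the second power of \<open>\<tau>\<close>.
\<close>

lemma D0_V_inf: assumes "f \<in> V_inf" shows "\<tau> ^ 2 * D0 f \<in> V_inf"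
proof -
  obtain p q where f: "f = ev p / ev q" "q \<noteq> 0" "degree p \<le> degree q" using assms unfolding V_inf_def by blast
  define c where "c = coeff p (degree q) / lead_coeff q"
  define r where "r = p - smult c q"
  have f': "f = fls_const c + ev r / ev q"
  proof -
    have "p = r + [:c:] * q" by (simp add: r_def)
    then have "ev p = ev r + fls_const c * ev q" by (metis ev_simps(3,4) ev_const)
    then show ?thesis using f by (simp add: add_divide_distrib)
  qed
  have E: "fls_const c \<in> E" "ev r / ev q \<in> E" using E_ev[of "[:c:]"] E_I[OF f(2)] by (auto simp: ev_const)
  have "D0 f = D0 (fls_const c) + D0 (ev r / ev q)"
    using D0 E unfolding f' derivations_def by blast
  also have "D0 (fls_const c) = 0" using D0 unfolding derivations_def by blast
  finally have D: "D0 f = ev (pderiv r * q - r * pderiv q) / ev (q ^ 2)"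
    using derivation_frac[OF D0 f(2), of r] by (simp add: D0_\<tau>)
  show ?thesis
  proof (cases "r = 0")
    case True
    then have "\<tau> ^ 2 * D0 f = fls_const 0" unfolding D by (simp add: ev_simps)
    then show ?thesis using const_V(2) by metis
  next
    case False
    have r: "degree r < degree q"
    proof -
      have "coeff r (degree q) = 0" using f(2) by (simp add: r_def c_def)
      moreover have "degree r \<le> degree q" unfolding r_def using f(3) by (intro degree_diff_le) auto
      ultimately show ?thesis
        using False by (metis leading_coeff_0_iff le_neq_implies_less)
    qed
    have 1: "degree (pderiv r * q) + 2 \<le> 2 * degree q"
    proof (cases "pderiv r = 0")
      case True
      then show ?thesis using r by simp
    next
      case F: False
      then have "degree r \<noteq> 0" by (metis pderiv_eq_0_iff)
      then show ?thesis using degree_mult_le[of "pderiv r" q] r by (simp add: degree_pderiv)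
    qed
    have 2: "degree (r * pderiv q) + 2 \<le> 2 * degree q"
      using degree_mult_le[of r "pderiv q"] r by (simp add: degree_pderiv)
    define n where "n = pderiv r * q - r * pderiv q"
    have n: "degree n + 2 \<le> 2 * degree q"
    proof -
      have "degree n \<le> 2 * degree q - 2" unfolding n_def using 1 2 by (intro degree_diff_le) auto
      then show ?thesis using 1 by linarith
    qed
    have "\<tau> ^ 2 * D0 f = ev ([:0, 1:] ^ 2 * n) / ev (q ^ 2)"
      unfolding D n_def[symmetric] ev_simps(4,9) ev_X by simp
    moreover have "degree ([:0, 1:] ^ 2 * n) \<le> 2 + degree n"
      using degree_mult_le[of "[:0, 1::complex:] ^ 2" n] by (simp add: degree_power_eq)
    then have "degree ([:0, 1:] ^ 2 * n) \<le> degree (q ^ 2)"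
      using n f(2) by (simp add: degree_power_eq)
    ultimately show ?thesis unfolding V_inf_def using f(2) by (intro CollectI exI[of _ "[:0, 1:] ^ 2 * n"] exI[of _ "q ^ 2"]) simp
  qed
qed

lemma V_sum: "(\<And>x. x \<in> X \<Longrightarrow> f x \<in> V c) \<Longrightarrow> sum f X \<in> V c"
  using V_subring const_V(1)[of 0 c] by (induction X rule: infinite_finite_induct) simp_all

lemma V_inf_sum: "(\<And>x. x \<in> X \<Longrightarrow> f x \<in> V_inf) \<Longrightarrow> sum f X \<in> V_inf"
  using V_inf_subring const_V(2)[of 0] by (induction X rule: infinite_finite_induct) simp_all

text \<open>A function without poles at finite points is a polynomial, which cannot vanish doubly at infinity.\<close>

lemma regular_everywhere:
  assumes fin: "\<And>c. h \<in> V c" and inf: "\<tau> ^ 2 * h \<in> V_inf"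
  shows "h = 0"
proof -
  have "h \<in> E" using fin[of 0] place_V[of 0] unfolding place_ring_def by blast
  then obtain p q where h: "coprime p q" "q \<noteq> 0" "h = ev p / ev q" by (rule E_coprime)
  have "degree q = 0"
  proof (rule ccontr)
    assume "degree q \<noteq> 0"
    then obtain c where c: "poly q c = 0" using fundamental_theorem_of_algebra by (metis constant_degree)
    obtain r s where rs: "h = ev r / ev s" "poly s c \<noteq> 0" using fin[of c] unfolding V_def by blast
    then have "s \<noteq> 0" by auto
    then have "ev (p * s) = ev (r * q)" using rs h by (simp add: ev_simps field_simps)
    then have "p * s = r * q" by (simp only: ev_eq_iff)
    then have "poly p c * poly s c = 0" using c by (metis poly_mult mult_zero_right)
    then show False using rs coprime_no_common_root[OF h(1)] c by simp
  qed
  obtain r s where rs: "\<tau> ^ 2 * h = ev r / ev s" "s \<noteq> 0" "degree r \<le> degree s" using inf unfolding V_inf_def by blast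
  have "ev ([:0, 1:] ^ 2 * p * s) = ev (r * q)"
    unfolding ev_simps(4,9) ev_X using rs h by (simp add: field_simps)
  then have e: "[:0, 1:] ^ 2 * p * s = r * q" by (simp only: ev_eq_iff)
  have "p = 0"
  proof (rule ccontr)
    assume "p \<noteq> 0"
    then have "degree ([:0, 1:] ^ 2 * p * s) = 2 + degree p + degree s"
      using rs(2) by (simp add: degree_mult_eq degree_power_eq)
    moreover have "degree (r * q) \<le> degree r" using degree_mult_le[of r q] \<open>degree q = 0\<close> by simp
    ultimately show False using e rs(3) by simp
  qed
  then show ?thesis using h by (simp add: ev_simps)
qed

text \<open>
  A differential is determined by its value on the derivation \<open>d/d\<tau>\<close>, which is its coefficient with respect to \<open>d\<tau>\<close>.
\<close>

lemma regular_differentials: "regular_differentials fls_const E = {\<lambda>D. 0}"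
proof
  have "(\<lambda>D. 0) \<in> differentials fls_const E V" for V
    unfolding differentials_def by (intro CollectI exI[of _ 0]) auto
  then show "{\<lambda>D. 0} \<subseteq> regular_differentials fls_const E" by (simp add: regular_differentials_def)
  show "regular_differentials fls_const E \<subseteq> {\<lambda>D. 0}"
  proof
    fix \<eta> assume \<eta>: "\<eta> \<in> regular_differentials fls_const E"
    have at: "\<eta> D0 \<in> V" if V: "place_ring fls_const E V'" and c: "\<And>n f g. (\<And>i. i < n \<Longrightarrow> f i \<in> V' \<and> g i \<in> V') \<Longrightarrow>
        (\<Sum>i<(n::nat). f i * D0 (g i)) \<in> V" for V V'
    proof -
      have "\<eta> \<in> differentials fls_const E V'" using \<eta> V unfolding regular_differentials_def by blast
      then obtain n f g where "\<eta> = (\<lambda>D. if D \<in> derivations fls_const E then \<Sum>i<n. f i * D (g i) else 0)"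
          "\<forall>i<(n::nat). f i \<in> V' \<and> g i \<in> V'"
        unfolding differentials_def by blast
      then show ?thesis using c[of n f g] D0 by simp
    qed
    have "\<eta> D0 \<in> V c" for c
    proof (rule at[OF place_V[of c]])
      fix n :: nat and f g assume "\<And>i. i < n \<Longrightarrow> f i \<in> V c \<and> g i \<in> V c"
      then show "(\<Sum>i<n. f i * D0 (g i)) \<in> V c" using V_subring D0_V by (intro V_sum) auto
    qed
    moreover have "\<eta> D0 \<in> {h. \<tau> ^ 2 * h \<in> V_inf}"
    proof (rule at[OF place_V_inf])
      fix n :: nat and f g assume fg: "\<And>i. i < n \<Longrightarrow> f i \<in> V_inf \<and> g i \<in> V_inf"
      have "\<tau> ^ 2 * (\<Sum>i<n. f i * D0 (g i)) = (\<Sum>i<n. f i * (\<tau> ^ 2 * D0 (g i)))"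
        by (simp add: sum_distrib_left mult_ac)
      also have "\<dots> \<in> V_inf" using fg V_inf_subring D0_V_inf by (intro V_inf_sum) auto
      finally show "(\<Sum>i<n. f i * D0 (g i)) \<in> {h. \<tau> ^ 2 * h \<in> V_inf}" by simp
    qed
    ultimately have 0: "\<eta> D0 = 0" using regular_everywhere by blast
    obtain n f g where e: "\<eta> = (\<lambda>D. if D \<in> derivations fls_const E then \<Sum>i<n. f i * D (g i) else 0)"
        "\<forall>i<(n::nat). f i \<in> E \<and> g i \<in> E"
      using \<eta> unfolding regular_differentials_def differentials_def by blast
    have "\<eta> D = 0" for D
    proof (cases "D \<in> derivations fls_const E")
      case True
      have "\<eta> D = (\<Sum>i<n. f i * (D0 (g i) * D \<tau>))" using e True derivation_D0 by simp
      also have "\<dots> = \<eta> D0 * D \<tau>" using e D0 by (simp add: sum_distrib_right mult.assoc)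
      finally show ?thesis using 0 by simp
    qed (simp add: e)
    then show "\<eta> \<in> {\<lambda>D. 0}" by auto
  qed
qed

lemma genus_0: "function_field_genus fls_const E 0"
proof -
  let ?scale = "\<lambda>c (\<eta> :: (complex fls \<Rightarrow> complex fls) \<Rightarrow> complex fls) D. fls_const c * \<eta> D"
  interpret m: module ?scale
  proof
    fix a b :: complex and x y :: "(complex fls \<Rightarrow> complex fls) \<Rightarrow> complex fls"
    show "?scale a (x + y) = ?scale a x + ?scale a y"
      by (rule ext) (simp add: distrib_left)
    show "?scale (a + b) x = ?scale a x + ?scale b x"
      by (rule ext) (simp only: hom_add[OF hom_fls_const] distrib_right plus_fun_apply)
    show "?scale a (?scale b x) = ?scale (a * b) x"
      by (rule ext) (simp only: hom_mult[OF hom_fls_const] mult.assoc)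
    show "?scale 1 x = x"
      by (rule ext) (simp only: hom_one[OF hom_fls_const] mult_1_left)
  qed
  have "module.span ?scale {} = {\<lambda>D. 0}" using m.span_empty by (simp add: zero_fun_def)
  moreover have "\<not> module.dependent ?scale {}" by (rule m.independent_empty)
  ultimately show ?thesis
    unfolding function_field_genus_def Let_def regular_differentials by (intro exI[of _ "{}"]) simp
qed

end

lemma homogeneous_0_unit: assumes "homogeneous 0 G" "G \<noteq> 0" shows "is_unit G"
proof -
  define c where "c = value_at G 0"
  have "value_at G p = c" for p
  proof -
    have "value_at G (0 *s p) = value_at G p" unfolding eval3_scale[OF hom_id assms(1)] by simp
    then show ?thesis by (simp only: vector_smult_lzero c_def)
  qed
  then have G: "G = cst c" by (intro cpoly3_eqI) (simp add: value_simps)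
  then have "c \<noteq> 0" using assms(2) by auto
  then have "G * cst (inverse c) = 1" by (simp add: G one_pCons)
  then show ?thesis by (metis dvd_triv_left)
qed

text \<open>
  If the form has no zero in the affine coordinate \<open>y\<close> of the line, it is constant in it, hence a multiple of a power of
  the other homogeneous coordinate, and vanishes at the point at infinity.
\<close>

lemma zero_on_line:
  assumes A: "homogeneous m A" and m: "m > 0"
  obtains y where "value_at A (p1 + y *s p2) = 0" | "value_at A p2 = 0"
proof -
  define f where "f p q = eval3 (\<lambda>c. [:c:]) A (\<chi> i. [:p $ i, q $ i:])" for p q :: "complex ^ 3"
  have f: "poly (f p q) y = value_at A (p + y *s q)" for p q y
  proof -
    have v: "(\<chi> i. poly ((\<chi> i. [:p $ i, q $ i:]) $ i) y) = p + y *s q" by (simp add: vec_eq_iff)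
    show ?thesis unfolding f_def hom_eval3_comp[OF hom_poly_at hom_const_poly] v by simp
  qed
  show ?thesis
  proof (cases "\<exists>y. poly (f p1 p2) y = 0")
    case True then show ?thesis using that(1) f by auto
  next
    case False
    then have "constant (poly (f p1 p2))" using fundamental_theorem_of_algebra by blast
    then obtain c where c: "\<And>y. poly (f p1 p2) y = c" unfolding constant_def by metis
    have "poly (f p2 p1 - monom c m) x = 0" if "x \<noteq> 0" for x
    proof -
      have "p2 + x *s p1 = x *s (p1 + inverse x *s p2)"
        using that by (simp add: vec_eq_iff distrib_left flip: mult.assoc)
      then have "poly (f p2 p1) x = x ^ m * poly (f p1 p2) (inverse x)"
        unfolding f by (simp only: eval3_scale[OF hom_id A])
      then have "poly (f p2 p1) x = x ^ m * c" by (simp only: c)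
      then show ?thesis by (simp add: poly_monom)
    qed
    then have "UNIV - {0} \<subseteq> {x. poly (f p2 p1 - monom c m) x = 0}" by auto
    moreover have "infinite (UNIV - {0 :: complex})" using infinite_UNIV_char_0 by simp
    ultimately have "f p2 p1 - monom c m = 0" using poly_roots_finite infinite_super by blast
    then have "poly (f p2 p1) 0 = 0" using m by (simp add: poly_monom)
    then show ?thesis using f[of p2 p1 0] that(2) by simp
  qed
qed

context pencil_foliation
begin

section \<open>The curves of tangency are irreducible and rational\<close>

text \<open>The polar curve of \<open>s\<close>, the preimage of the line \<open>s\<close> of the dual plane.\<close>

definition polar :: "complex ^ 3 \<Rightarrow> cpoly3" where "polar s = (\<Sum>i\<in>UNIV. cst (s $ i) * \<omega> $ i)"

lemma homogeneous_polar: "homogeneous (d + 1) (polar s)"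
proof -
  have "homogeneous (0 + (d + 1)) (cst c * \<omega> $ i)" for c i
    by (intro homogeneous_mult homogeneous_cst homogeneous_\<omega>)
  then have "homogeneous (d + 1) (cst c * \<omega> $ i)" for c i by simp
  then show ?thesis unfolding polar_def by (rule homogeneous_sum)
qed

lemma eval3_polar: assumes "unital_hom \<iota>"
  shows "eval3 \<iota> (polar s) p = dotp (vmap \<iota> s) (crossp (W_at \<iota> p) p)"
proof -
  note h = hom_eval3[OF assms, of p]
  show ?thesis
    unfolding polar_def hom_sum[OF h] hom_mult[OF h] eval3_cst[OF assms] eval3_\<omega>[OF assms, symmetric]
    by (simp add: dotp_def)
qed

lemma base_uv: "dotp uh base = 0" "dotp vh base = 0"
  by (rule dotp_crossp)+

lemma crossp_base: "crossp base s = dotp uh s *s vh - dotp vh s *s uh"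
  by (simp add: vec3_simps algebra_simps)

lemma value_H: "value_at H s = dotp s (crossp (W_at (\<lambda>c. c) s) base)"
  unfolding eval3_H[OF hom_id] vmap_id crossp_base[symmetric] by (simp add: dotp_3 algebra_simps)

text \<open>Substitution of \<open>p + t base\<close> for \<open>p\<close>; the field of directions does not change along lines
  through the base point, so that \<open>polar s\<close> becomes a linear polynomial in \<open>t\<close>.\<close>

definition shift :: "cpoly3 \<Rightarrow> cpoly3 poly" where
  "shift A = eval3 (\<lambda>c. [:cst c:]) A (\<chi> i. [:coord $ i, cst (base $ i):])"

definition polar_slope :: "complex ^ 3 \<Rightarrow> cpoly3" where "polar_slope s = dotp (vmap cst s) (crossp W (vmap cst base))"

lemma hom_shift: "unital_hom shift"
  unfolding shift_def by (rule hom_eval3[OF hom_cst_const])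

lemma shift_at_0: "poly (shift A) 0 = A"
  unfolding shift_def hom_eval3_comp[OF hom_poly_at hom_cst_const]
  by (simp add: eval3_cst_coord vec_lambda_eta)

lemma shift_polar: "shift (polar s) = [:polar s, polar_slope s:]"
proof -
  define p where "p = (\<chi> i. [:coord $ i, cst (base $ i):])"
  let ?\<iota> = "\<lambda>c. [:cst c:]"
  have l: "dotp (vmap ?\<iota> x) p = [:lin x:]" if "dotp x base = 0" for x
  proof -
    have "dotp (vmap ?\<iota> x) p = [:lin x, cst (dotp x base):]"
      by (simp add: p_def dotp_3 lin_def sum_3 mult.commute)
    then show ?thesis using that by simp
  qed
  have "W_at ?\<iota> p = vmap (\<lambda>f. [:f:]) W"
    unfolding W_at_def l[OF base_uv(1)] l[OF base_uv(2)]
    by (simp add: vec_eq_iff W_def vector_scalar_mult_def hom_power[OF hom_const_poly, symmetric] mult.commute)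
  then show ?thesis
    unfolding shift_def eval3_polar[OF hom_cst_const] p_def[symmetric]
    by (simp add: p_def dotp_3 polar_slope_def polar_def sum_3 \<omega>_def smult_diff_right algebra_simps)
qed

lemma value_polar_slope: "value_at (polar_slope s) p = dotp s (crossp (W_at (\<lambda>c. c) p) base)"
  unfolding polar_slope_def by (simp only: dotp_3 crossp_nth vmap_nth value_simps eval3_W[OF hom_id])

text \<open>
  A factor that is constant along the lines through the base point divides both coefficients of
  the linear polynomial. At a common zero outside the base point, the line through it and
  the base point contains the direction, hence \<open>s\<close>, contrary to the choice of \<open>s\<close>.
\<close>

lemma invariant_factor_unit:
  assumes s: "dotp s (crossp a b) \<noteq> 0" "value_at H s \<noteq> 0"
    and AB: "polar s = A * B" and A: "degree (shift A) = 0"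
  shows "is_unit A"
proof -
  have g0: "polar_slope s \<noteq> 0" using s(2) value_polar_slope[of s s] value_H by (auto simp: value_simps)
  have F0: "polar s \<noteq> 0" using shift_polar[of s] g0 shift_at_0[of "polar s"] hom_zero[OF hom_shift] by (metis pCons_eq_0_iff)
  obtain m where m: "homogeneous m A" using homogeneous_factors homogeneous_polar AB F0 by metis
  obtain A' where A': "shift A = [:A':]" using A by (rule degree_eq_zeroE)
  then have "A' = A" using shift_at_0[of A] by simp
  then have e: "[:polar s, polar_slope s:] = smult A (shift B)"
    using shift_polar[of s] A' unfolding AB hom_mult[OF hom_shift] by simp
  have "polar_slope s = A * coeff (shift B) 1" using arg_cong[OF e, of "\<lambda>p. coeff p 1"] by simp
  show ?thesis
  proof (cases "m = 0")
    case True
    then show ?thesis using homogeneous_0_unit m AB F0 by auto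
  next
    case False
    obtain p1 where p1: "dotp vh p1 = 0" "dotp uh p1 = 1" using independent2_separating uv independent2_sym by metis
    obtain p2 where p2: "dotp uh p2 = 0" "dotp vh p2 = 1" using independent2_separating uv by metis
    obtain p where p: "value_at A p = 0" "dotp uh p \<noteq> 0 \<or> dotp vh p \<noteq> 0"
    proof (rule zero_on_line[OF m, of p1 p2])
      show "0 < m" using False by simp
      show thesis if "value_at A (p1 + y *s p2) = 0" for y
        using that p1 p2 \<open>\<And>p. value_at A p = 0 \<Longrightarrow> dotp uh p \<noteq> 0 \<or> dotp vh p \<noteq> 0 \<Longrightarrow> thesis\<close>[of "p1 + y *s p2"]
        by (simp add: dotp_add dotp_scale)
      show thesis if "value_at A p2 = 0"
        using that p2 \<open>\<And>p. value_at A p = 0 \<Longrightarrow> dotp uh p \<noteq> 0 \<or> dotp vh p \<noteq> 0 \<Longrightarrow> thesis\<close>[of p2] by simp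
    qed
    define x y where "x = dotp uh p ^ d" and "y = dotp vh p ^ d"
    define w where "w = x *s a + y *s b"
    have w: "W_at (\<lambda>c. c) p = w" by (simp add: W_at_def w_def x_def y_def)
    have xy: "x \<noteq> 0 \<or> y \<noteq> 0" using p(2) by (auto simp: x_def y_def)
    define n where "n = crossp s w"
    have "value_at (polar s) p = 0" "value_at (polar_slope s) p = 0"
      using p(1) AB \<open>polar_slope s = A * _\<close> by (simp_all add: value_simps)
    then have 0: "dotp s (crossp w p) = 0" "dotp s (crossp w base) = 0"
      using eval3_polar[OF hom_id, of s p] value_polar_slope w by simp_all
    have rot: "dotp q (crossp s w) = dotp s (crossp w q)" for q
      by (simp add: dotp_3 algebra_simps)
    have n0: "n \<noteq> 0"
    proof
      assume "n = 0"
      then have "dotp a n = 0" "dotp b n = 0" by simp_all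
      moreover have "dotp a n = - y * dotp s (crossp a b)" "dotp b n = x * dotp s (crossp a b)"
        by (simp_all add: n_def w_def dotp_3 algebra_simps)
      ultimately show False using s(1) xy by auto
    qed
    have "crossp base p \<noteq> 0"
    proof
      assume c: "crossp base p = 0"
      then have "dotp p1 (crossp base p) = 0" "dotp p2 (crossp base p) = 0" by simp_all
      then have "dotp uh p * dotp vh p1 - dotp vh p * dotp uh p1 = 0" "dotp uh p * dotp vh p2 - dotp vh p * dotp uh p2 = 0"
        unfolding crossp_base by (simp_all add: dotp_diff dotp_scale dotp_commute[of p1] dotp_commute[of p2])
      then show False using p1 p2 p(2) by simp
    qed
    then have ind: "independent2 base p" by (simp add: independent2_def)
    have "dotp base n = 0" "dotp p n = 0" "dotp s n = 0"
      unfolding n_def rot using 0 by (simp_all add: dotp_3 algebra_simps)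
    then obtain k l where kl: "s = k *s base + l *s p" using covector_combination[OF ind _ _ _ n0] by metis
    have ds: "dotp uh s = l * dotp uh p" "dotp vh s = l * dotp vh p"
      unfolding kl by (simp_all add: dotp_add dotp_scale base_uv)
    have "W_at (\<lambda>c. c) s = l ^ d *s w"
      by (simp add: W_at_def w_def x_def y_def ds power_mult_distrib vec_eq_iff algebra_simps)
    moreover have "dotp s (crossp (c *s w) base) = c * dotp s (crossp w base)" for c
      by (simp add: vec3_simps algebra_simps)
    ultimately have "value_at H s = 0" unfolding value_H using 0 by simp
    then show ?thesis using s(2) by simp
  qed
qed

text \<open>One of two factors has degree \<open>0\<close> in \<open>t\<close> after the substitution.\<close>

lemma polar_irreducible:
  assumes s: "dotp s (crossp a b) \<noteq> 0" "value_at H s \<noteq> 0"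
  shows "irreducible (polar s)"
proof (rule irreducibleI)
  have g0: "polar_slope s \<noteq> 0" using s(2) value_polar_slope[of s s] value_H by (auto simp: value_simps)
  show F0: "polar s \<noteq> 0" using shift_polar[of s] g0 hom_zero[OF hom_shift] by (metis pCons_eq_0_iff)
  show "\<not> is_unit (polar s)"
    using unit_homogeneous[of "polar s"] homogeneous_unique[OF homogeneous_polar _ F0, of 0] by auto
  fix A B assume AB: "polar s = A * B"
  have "shift A * shift B = [:polar s, polar_slope s:]" using shift_polar[of s] unfolding AB hom_mult[OF hom_shift] by simp
  then have "degree (shift A * shift B) = 1" using g0 by simp
  moreover from this have "shift A \<noteq> 0" "shift B \<noteq> 0" by auto
  ultimately have "degree (shift A) = 0 \<or> degree (shift B) = 0" by (auto simp: degree_mult_eq)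
  then show "is_unit A \<or> is_unit B"
    using invariant_factor_unit[OF s AB] invariant_factor_unit[OF s, of B A] AB by (auto simp: mult.commute)
qed

text \<open>
  The lines through the base point parametrize the curve by \<open>\<tau> = v / u\<close>: the point is the
  intersection of the line with the tangent line, both of which depend rationally on \<open>\<tau>\<close>.
\<close>

lemma polar_genus:
  assumes s: "dotp s (crossp a b) \<noteq> 0" "value_at H s \<noteq> 0" and \<xi>: "generic_point_of (polar s) \<xi>"
  shows "function_field_genus fls_const (ratio_field fls_const \<xi>) 0"
proof -
  note irr = polar_irreducible[OF s]
  note hc = hom_fls_const
  have ev0: "eval3 fls_const G \<xi> = 0 \<longleftrightarrow> polar s dvd G" if "homogeneous n G" for n G
    using \<xi> that unfolding generic_point_of_def by blast
  have lin: "dotp (vmap fls_const x) \<xi> \<noteq> 0" if "x \<noteq> 0" for x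
  proof
    assume "dotp (vmap fls_const x) \<xi> = 0"
    then have "polar s dvd lin x" using ev0[OF homogeneous_lin] by (simp add: eval3_lin[OF hc])
    then obtain K where K: "lin x = polar s * K" ..
    have x: "lin x \<noteq> 0" using that by (simp add: lin_eq_0_iff)
    obtain m k where mk: "homogeneous m (polar s)" "1 = m + k" using homogeneous_factors[of 1 "polar s" K] homogeneous_lin x K by metis
    have "d + 1 = m" using homogeneous_unique[OF homogeneous_polar mk(1)] irr by (auto simp: irreducible_def)
    then show False using mk d2 by simp
  qed
  define u v where "u = dotp (vmap fls_const uh) \<xi>" and "v = dotp (vmap fls_const vh) \<xi>"
  have u0: "u \<noteq> 0" unfolding u_def using lin independent2_nz[OF uv] by blast
  define \<tau> where "\<tau> = v / u"
  have "\<tau> \<notin> range fls_const"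
  proof
    assume "\<tau> \<in> range fls_const"
    then obtain c where "v = fls_const c * u" using u0 by (auto simp: \<tau>_def field_simps)
    moreover have "dotp (vmap fls_const (vh - c *s uh)) \<xi> = v - fls_const c * u"
      unfolding u_def v_def
      by (simp only: dotp_3 vmap_nth vector_minus_component vector_smult_component hom_diff[OF hc] hom_mult[OF hc]) algebra
    ultimately have "dotp (vmap fls_const (vh - c *s uh)) \<xi> = 0" by simp
    moreover have "vh - c *s uh \<noteq> 0"
    proof
      assume "vh - c *s uh = 0"
      then have "(- c) *s uh + 1 *s vh = 0" by (simp add: vec3_simps algebra_simps)
      then show False using uv unfolding independent2_iff by (metis zero_neq_one)
    qed
    ultimately show False using lin by blast
  qed
  then interpret R: rational_function_field \<tau> by unfold_locales
  let ?c = "vmap fls_const"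
  define X where "X = ?c a + \<tau> ^ d *s ?c b"
  define m where "m = ?c vh - \<tau> *s ?c uh"
  define n where "n = crossp (?c s) X"
  have m\<xi>: "dotp m \<xi> = 0" using u0 by (simp add: m_def dotp_diff dotp_scale u_def[symmetric] v_def[symmetric] \<tau>_def)
  have W: "W_at fls_const \<xi> = u ^ d *s X"
    using u0 by (simp add: W_at_def u_def[symmetric] v_def[symmetric] X_def vec_eq_iff vector_scalar_mult_def \<tau>_def power_divide algebra_simps)
  have "dotp (?c s) (crossp (u ^ d *s X) \<xi>) = u ^ d * dotp n \<xi>"
    by (simp add: n_def vec3_simps algebra_simps)
  moreover have "eval3 fls_const (polar s) \<xi> = 0" using ev0[OF homogeneous_polar] by simp
  ultimately have n\<xi>: "dotp n \<xi> = 0" unfolding eval3_polar[OF hc] W using u0 by simp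
  have ind: "independent2 n m"
  proof -
    have "dotp (crossp (?c a) (?c b)) (crossp n m) = - dotp (?c s) (crossp (?c a) (?c b)) * dotp X m"
      unfolding n_def X_def by (simp add: vec3_simps algebra_simps)
    moreover have "dotp (?c s) (crossp (?c a) (?c b)) = fls_const (dotp s (crossp a b))"
      by (simp only: dotp_3 crossp_nth vmap_nth hom_add[OF hc] hom_diff[OF hc] hom_mult[OF hc])
    moreover have "dotp X m = R.ev incidence_poly"
      unfolding X_def m_def R.ev_def eval_incidence_poly[OF hc] ..
    ultimately have "dotp (crossp (?c a) (?c b)) (crossp n m) \<noteq> 0"
      using s(1) incidence_poly_nz by simp
    then show ?thesis unfolding independent2_def by auto
  qed
  obtain c where c: "\<xi> = c *s crossp n m" using common_zero[OF ind n\<xi> m\<xi>] .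
  have "\<xi> \<noteq> 0" using \<xi> by (simp add: generic_point_of_def)
  then have c0: "c \<noteq> 0" using c by auto
  define k where "k x = vmap (\<lambda>c. [:c:]) x" for x :: "complex ^ 3"
  define \<kappa> where "\<kappa> = crossp (crossp (k s) (k a + [:0, 1:] ^ d *s k b)) (k vh - [:0, 1:] *s k uh)"
  have ek: "R.ev (k x $ i) = fls_const (x $ i)" for x i by (simp add: k_def R.ev_const)
  have \<kappa>: "vmap R.ev \<kappa> = crossp n m"
    unfolding \<kappa>_def n_def m_def X_def vec3_eq_iff
    by (simp only: vmap_nth crossp_nth vector_minus_component vector_add_component vector_smult_component
        R.ev_simps(3,4,6,9) ek R.ev_X)
  have val: "eval3 fls_const G \<xi> = c ^ N * R.ev (eval3 (\<lambda>c. [:c:]) G \<kappa>)" if "homogeneous N G" for N G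
  proof -
    have "eval3 fls_const G (vmap R.ev \<kappa>) = R.ev (eval3 (\<lambda>c. [:c:]) G \<kappa>)"
      unfolding hom_eval3_comp[OF R.hom_ev hom_const_poly] by (simp add: R.ev_const vmap_def)
    then show ?thesis using eval3_scale[OF hc that, of c "crossp n m"] by (simp add: c \<kappa>)
  qed
  have "ratio_field fls_const \<xi> = R.E"
  proof
    show "ratio_field fls_const \<xi> \<subseteq> R.E"
    proof
      fix f assume "f \<in> ratio_field fls_const \<xi>"
      then obtain n G K where f: "f = eval3 fls_const G \<xi> / eval3 fls_const K \<xi>" "homogeneous n G" "homogeneous n K"
          "eval3 fls_const K \<xi> \<noteq> 0"
        unfolding ratio_field_def by blast
      let ?G = "eval3 (\<lambda>c. [:c:]) G \<kappa>" and ?K = "eval3 (\<lambda>c. [:c:]) K \<kappa>"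
      have "?K \<noteq> 0" using f(4) unfolding val[OF f(3)] by auto
      moreover have "f = R.ev ?G / R.ev ?K" unfolding f(1) val[OF f(2)] val[OF f(3)] using c0 by simp
      ultimately show "f \<in> R.E" using R.E_I by blast
    qed
    show "R.E \<subseteq> ratio_field fls_const \<xi>"
    proof
      fix f assume "f \<in> R.E"
      then obtain p q where f: "f = R.ev p / R.ev q" "q \<noteq> 0" unfolding R.E_def by blast
      define N where "N = max (degree p) (degree q)"
      define G where "G r = (\<Sum>i\<le>N. cst (coeff r i) * (lin vh ^ i * lin uh ^ (N - i)))" for r
      have hG: "homogeneous N (G r)" for r
        unfolding G_def
      proof (rule homogeneous_sum)
        fix i assume "i \<in> {..N}"
        then have i: "0 + (i * 1 + (N - i) * 1) = N" by simp
        have "homogeneous (0 + (i * 1 + (N - i) * 1)) (cst (coeff r i) * (lin vh ^ i * lin uh ^ (N - i)))"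
          by (intro homogeneous_mult homogeneous_cst homogeneous_power homogeneous_lin)
        then show "homogeneous N (cst (coeff r i) * (lin vh ^ i * lin uh ^ (N - i)))" unfolding i .
      qed
      have vG: "eval3 fls_const (G r) \<xi> = u ^ N * R.ev r" if "degree r \<le> N" for r
      proof -
        note h = hom_eval3[OF hc, of \<xi>]
        have "r = (\<Sum>i\<le>N. [:coeff r i:] * [:0, 1:] ^ i)"
          using poly_as_sum_of_monoms'[OF that] by (simp add: monom_altdef)
        then have "R.ev r = R.ev (\<Sum>i\<le>N. [:coeff r i:] * [:0, 1:] ^ i)" by simp
        also have "\<dots> = (\<Sum>i\<le>N. fls_const (coeff r i) * \<tau> ^ i)"
          by (simp only: R.ev_simps(4,7,9) R.ev_const R.ev_X)
        finally have e: "R.ev r = (\<Sum>i\<le>N. fls_const (coeff r i) * \<tau> ^ i)" .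
        have "eval3 fls_const (G r) \<xi> = (\<Sum>i\<le>N. fls_const (coeff r i) * (v ^ i * u ^ (N - i)))"
          unfolding G_def hom_sum[OF h] hom_mult[OF h] hom_power[OF h] eval3_cst[OF hc] eval3_lin[OF hc] u_def v_def ..
        also have "\<dots> = (\<Sum>i\<le>N. u ^ N * (fls_const (coeff r i) * \<tau> ^ i))"
        proof (intro sum.cong refl)
          fix i assume "i \<in> {..N}"
          then have "u ^ N = u ^ (N - i) * u ^ i" by (simp flip: power_add)
          then show "fls_const (coeff r i) * (v ^ i * u ^ (N - i)) = u ^ N * (fls_const (coeff r i) * \<tau> ^ i)"
            using u0 by (simp add: \<tau>_def power_divide)
        qed
        finally show ?thesis by (simp add: e sum_distrib_left)
      qed
      have "f = eval3 fls_const (G p) \<xi> / eval3 fls_const (G q) \<xi>"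
        using vG[of p] vG[of q] u0 f by (simp add: N_def)
      moreover have "eval3 fls_const (G q) \<xi> \<noteq> 0" using vG[of q] u0 f by (simp add: N_def)
      ultimately show "f \<in> ratio_field fls_const \<xi>" unfolding ratio_field_def using hG by blast
    qed
  qed
  then show ?thesis using R.genus_0 by simp
qed

text \<open>The two conditions of irreducibility exclude only a curve.\<close>

lemma good_line_exists: obtains s where "dotp s (crossp a b) \<noteq> 0" "value_at H s \<noteq> 0" "s \<noteq> 0"
proof -
  have "lin (crossp a b) * H \<noteq> 0" using ab H_nz by (simp add: lin_eq_0_iff independent2_def)
  then obtain s where "value_at (lin (crossp a b) * H) s \<noteq> 0" using cpoly3_eq_0I by blast
  then have s: "dotp (crossp a b) s \<noteq> 0" "value_at H s \<noteq> 0" by (auto simp: value_simps value_lin)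
  then have "s \<noteq> 0" by auto
  then show ?thesis using that s dotp_commute by metis
qed

lemma genus: "foliation_genus \<omega> 0"
  unfolding foliation_genus_def generically_on_def
proof (intro exI conjI ballI impI)
  show "homogeneous (1 + (d + 1)) (lin (crossp a b) * H)"
    by (intro homogeneous_mult homogeneous_lin homogeneous_H)
  obtain s where "dotp s (crossp a b) \<noteq> 0" "value_at H s \<noteq> 0" "s \<noteq> 0" by (rule good_line_exists)
  then show "\<exists>q\<in>- {0}. value_at (lin (crossp a b) * H) q \<noteq> 0"
    by (intro bexI[of _ s]) (auto simp: value_simps value_lin dotp_commute)
  fix s assume "value_at (lin (crossp a b) * H) s \<noteq> 0"
  then have s: "dotp s (crossp a b) \<noteq> 0" "value_at H s \<noteq> 0"
    by (auto simp: value_simps value_lin dotp_commute)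
  show "geometric_genus (\<Sum>i\<in>UNIV. [:[:[:s $ i:]:]:] * \<omega> $ i) 0"
    unfolding polar_def[symmetric] geometric_genus_def
    using polar_irreducible[OF s] homogeneous_polar polar_genus[OF s] by blast
qed

end


section \<open>From the vector field to the Gauss map\<close>

lemma total_degree_le_dehomogenized: "homogeneous n F \<Longrightarrow> total_degree_le n (poly F 1)"
  unfolding total_degree_le_def by (simp add: coeff_dehomogenized)

lemma homogenize_dehomogenized:
  assumes F: "homogeneous n F" shows "homogenize n (poly F 1) = F"
proof -
  define f where "f = poly F 1"
  have td: "total_degree_le n f" unfolding f_def by (rule total_degree_le_dehomogenized[OF F])
  have h: "homogeneous n (homogenize n f)"
    unfolding homogenize_def
  proof (intro homogeneous_sum)
    fix j i assume "j \<in> {..n}" "i \<in> {..n - j}"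
    then have "n = i + j + (n - i - j)" by simp
    then show "homogeneous n (monom (monom (monom (coeff (coeff f j) i) i) j) (n - i - j))"
      by (subst homogeneous_iff_scaled) (simp add: scaled_monomial)
  qed
  have ms: "(\<Sum>i\<in>X. monom (h i) j) = monom (\<Sum>i\<in>X. h i) j" for h :: "nat \<Rightarrow> complex poly" and j X
    by (induction X rule: infinite_finite_induct) (simp_all add: add_monom)
  have "poly (homogenize n f) 1 = (\<Sum>j\<le>n. \<Sum>i\<le>n - j. monom (monom (coeff (coeff f j) i) i) j)"
    unfolding homogenize_def by (simp add: poly_sum poly_monom)
  also have "\<dots> = (\<Sum>j\<le>n. monom (coeff f j) j)"
  proof (intro sum.cong refl)
    fix j assume j: "j \<in> {..n}"
    have "degree (coeff f j) \<le> n - j"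
    proof (rule degree_le, intro allI impI)
      fix i assume "n - j < i"
      then have "\<not> i + j \<le> n" using j by simp
      then show "coeff (coeff f j) i = 0" using td unfolding total_degree_le_def by blast
    qed
    then have "(\<Sum>i\<le>n - j. monom (coeff (coeff f j) i) i) = coeff f j" by (rule poly_as_sum_of_monoms')
    then show "(\<Sum>i\<le>n - j. monom (monom (coeff (coeff f j) i) i) j) = monom (coeff f j) j"
      using ms[of "\<lambda>i. monom (coeff (coeff f j) i) i" j "{..n - j}"] by simp
  qed
  also have "\<dots> = f"
  proof (rule poly_as_sum_of_monoms', rule degree_le, intro allI impI poly_eqI)
    fix j i assume "n < j"
    then have "\<not> i + j \<le> n" by simp
    then show "coeff (coeff f j) i = coeff 0 i" using td unfolding total_degree_le_def by auto
  qed
  finally have "poly (homogenize n f - F) 1 = 0" by (simp add: f_def)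
  then have "homogenize n f - F = 0" using dehomogenized_eq_0 homogeneous_diff[OF h F] by blast
  then show ?thesis by (simp add: f_def)
qed

lemma coord_3_dvd:
  assumes F: "homogeneous (n + 1) F" and f: "total_degree_le n (poly F 1)"
  shows "coord $ 3 dvd F"
proof -
  have "coeff (coeff (coeff F 0) j) i = 0" for i j
  proof (cases "i + j = n + 1")
    case True
    then have "coeff (coeff (poly F 1) j) i = coeff (coeff (coeff F 0) j) i"
      using coeff_dehomogenized[OF F, of j i] by simp
    moreover have "\<not> i + j \<le> n" using True by simp
    then have "coeff (coeff (poly F 1) j) i = 0" using f unfolding total_degree_le_def by blast
    ultimately show ?thesis by simp
  next
    case False
    then show ?thesis using F unfolding homogeneous_def by (metis add_0_right)
  qed
  then have "coeff F 0 = 0" by (simp add: poly_eq_iff)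
  then have "poly F 0 = 0" by (simp add: poly_0_coeff_0)
  then show ?thesis unfolding coord_simps using poly_eq_0_iff_dvd[of F 0] by simp
qed

context pencil_foliation
begin

text \<open>
  Otherwise all coefficients are divisible by the form \<open>Z\<close>, hence also the irreducible curves of tangency.
\<close>

lemma not_smaller_degree:
  assumes "\<And>i. total_degree_le n (poly (\<omega> $ i) 1)" shows "d + 1 \<le> n"
proof (rule ccontr)
  assume "\<not> d + 1 \<le> n"
  then have "n \<le> d" by simp
  then have "total_degree_le d (poly (\<omega> $ i) 1)" for i
    using assms[of i] le_trans unfolding total_degree_le_def by blast
  then have "coord $ 3 dvd \<omega> $ i" for i using coord_3_dvd[OF homogeneous_\<omega>] by blast
  then have dvd: "coord $ 3 dvd polar s" for s unfolding polar_def by (intro dvd_sum dvd_mult)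
  obtain s where s: "dotp s (crossp a b) \<noteq> 0" "value_at H s \<noteq> 0" by (rule good_line_exists)
  obtain K where K: "polar s = coord $ 3 * K" using dvd[of s] ..
  have "\<not> is_unit (coord $ 3 :: cpoly3)"
  proof
    assume "is_unit (coord $ 3 :: cpoly3)"
    then have "homogeneous 0 (coord $ 3)" by (rule unit_homogeneous)
    moreover have "coord $ 3 \<noteq> 0" by (simp add: coord_simps)
    ultimately show False using homogeneous_unique[OF homogeneous_coord] by fastforce
  qed
  then have "homogeneous 0 K" using irreducibleD[OF polar_irreducible[OF s] K] unit_homogeneous by blast
  then have "homogeneous (1 + 0) (polar s)" unfolding K by (intro homogeneous_mult homogeneous_coord)
  moreover have "polar s \<noteq> 0" using polar_irreducible[OF s] by (simp add: irreducible_def)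
  ultimately show False using homogeneous_unique[OF homogeneous_polar] d2 by fastforce
qed

lemma gauss_map_eq:
  assumes Q: "Q = poly (\<omega> $ 1) 1" and P: "- P = poly (\<omega> $ 2) 1" and R: "varY * P - varX * Q = poly (\<omega> $ 3) 1"
  shows "gauss_map P Q = \<omega>"
proof -
  have td: "total_degree_le n (- P) \<longleftrightarrow> total_degree_le n P" for n by (simp add: total_degree_le_def)
  have "(LEAST n. total_degree_le n P \<and> total_degree_le n Q \<and> total_degree_le n (varY * P - varX * Q)) = d + 1"
  proof (rule Least_equality)
    show "total_degree_le (d + 1) P \<and> total_degree_le (d + 1) Q \<and> total_degree_le (d + 1) (varY * P - varX * Q)"
      unfolding R td[symmetric] P unfolding Q
      using total_degree_le_dehomogenized[OF homogeneous_\<omega>] by blast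
    fix n assume *: "total_degree_le n P \<and> total_degree_le n Q \<and> total_degree_le n (varY * P - varX * Q)"
    have "total_degree_le n (poly (\<omega> $ i) 1)" for i
      using * exhaust_3[of i] unfolding R td[symmetric] P unfolding Q by auto
    then show "d + 1 \<le> n" by (rule not_smaller_degree)
  qed
  then have "gauss_map P Q = vector [homogenize (d + 1) Q, homogenize (d + 1) (- P), homogenize (d + 1) (varY * P - varX * Q)]"
    by (simp only: gauss_map_def Let_def)
  also have "\<dots> = \<omega>"
    unfolding P R unfolding Q homogenize_dehomogenized[OF homogeneous_\<omega>] by (simp add: vec3_eq_iff)
  finally show ?thesis .
qed

end

lemma affine_linear_form:
  assumes "total_degree_le 1 u"
  obtains x where "u = poly (lin x) 1"
proof
  define x :: "complex ^ 3" where "x = vector [coeff (coeff u 0) 1, coeff (coeff u 1) 0, coeff (coeff u 0) 0]"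
  have z: "coeff (coeff u j) i = 0" if "1 < i + j" for i j
    using assms that unfolding total_degree_le_def by force
  show "u = poly (lin x) 1"
  proof (intro poly_eqI)
    fix j i :: nat
    have "j = 0 \<or> j = 1 \<or> 1 < j" by linarith
    moreover have "i = 0 \<or> i = 1 \<or> 1 < i" by linarith
    ultimately show "coeff (coeff u j) i = coeff (coeff (poly (lin x) 1) j) i"
      using z by (auto simp: lin_def sum_3 coord_simps x_def coeff_pCons split: nat.splits)
  qed
qed

lemma dehomogenize_lin_combination:
  "smult [:c:] (poly (lin x) 1) + smult [:e:] (poly (lin y) 1) = poly (lin (c *s x + e *s y)) 1"
proof -
  have "lin (c *s x + e *s y) = cst c * lin x + cst e * lin y"
    by (rule cpoly3_eqI) (simp only: value_simps value_lin dotp_add dotp_scale)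
  then show ?thesis by simp
qed

theorem proposition7p3:
  fixes d :: nat
    and \<alpha> \<beta> \<gamma> \<delta> \<kappa> \<mu> :: complex
    and u v P Q :: "complex poly poly"
  assumes d: "d \<ge> 2"
    and coeffs_indep: "\<And>a b. a *s vector [\<alpha>, \<gamma>, \<kappa>] + b *s vector [\<beta>, \<delta>, \<mu>] = (0 :: complex ^ 3)
                          \<Longrightarrow> a = 0 \<and> b = 0"
    and deg: "total_degree_le 1 u" "total_degree_le 1 v"
    and uv_indep: "\<And>a b. smult [:a:] u + smult [:b:] v = 0 \<Longrightarrow> a = 0 \<and> b = 0"
    and P: "P = smult [:\<alpha>:] (u ^ d) + smult [:\<beta>:] (v ^ d)
                + (smult [:\<kappa>:] (u ^ d) + smult [:\<mu>:] (v ^ d)) * varX"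
    and Q: "Q = smult [:\<gamma>:] (u ^ d) + smult [:\<delta>:] (v ^ d)
                + (smult [:\<kappa>:] (u ^ d) + smult [:\<mu>:] (v ^ d)) * varY"
    and saturated: "coprime P Q"
    and degree: "foliation_degree (gauss_map P Q) d"
  shows "galois_foliation (gauss_map P Q)
       \<and> weighted_branching_type (gauss_map P Q) (Poly_Mapping.single [d] 2)
       \<and> foliation_genus (gauss_map P Q) 0"
proof -
  obtain uh vh where uh: "u = poly (lin uh) 1" and vh: "v = poly (lin vh) 1"
    using affine_linear_form deg by metis
  \<comment> \<open>The radial field \<open>x \<partial>\<^sub>x + y \<partial>\<^sub>y\<close> is \<open>- Z \<partial>\<^sub>Z\<close> modulo the Euler field; hence the signs of \<open>\<kappa>\<close> and \<open>\<mu>\<close>.\<close>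
  define a b :: "complex ^ 3" where "a = vector [\<alpha>, \<gamma>, - \<kappa>]" and "b = vector [\<beta>, \<delta>, - \<mu>]"
  interpret pencil_foliation a b uh vh d
  proof
    show "d \<ge> 2" by (rule d)
    show "independent2 a b"
      unfolding independent2_iff
    proof (intro allI impI)
      fix x y assume "x *s a + y *s b = 0"
      then have "x *s vector [\<alpha>, \<gamma>, \<kappa>] + y *s vector [\<beta>, \<delta>, \<mu>] = (0 :: complex ^ 3)"
        by (simp add: a_def b_def vec3_simps) (simp add: algebra_simps neg_eq_iff_add_eq_0 flip: add_eq_0_iff2)
      then show "x = 0 \<and> y = 0" by (rule coeffs_indep)
    qed
    show "independent2 uh vh"
      unfolding independent2_iff
    proof (intro allI impI)
      fix x y assume "x *s uh + y *s vh = 0"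
      then have "smult [:x:] u + smult [:y:] v = 0"
        unfolding uh vh dehomogenize_lin_combination by (simp add: lin_def)
      then show "x = 0 \<and> y = 0" by (rule uv_indep)
    qed
  qed
  have W: "poly (W $ i) 1 = smult [:a $ i:] (u ^ d) + smult [:b $ i:] (v ^ d)" for i
    by (simp add: W_def uh vh)
  have c: "poly (coord $ 1) 1 = varX" "poly (coord $ 2) 1 = varY" "poly (coord $ 3) (1 :: cpoly2) = 1"
    by (simp_all add: coord_simps varX_def varY_def)
  have sm: "smult x p = [:x:] * p" for x :: "complex poly" and p by simp
  have n: "smult [:- x:] p = - smult [:x:] p" for x and p :: cpoly2
    by (metis minus_pCons minus_zero smult_minus_left)
  have G: "gauss_map P Q = \<omega>"
  proof (rule gauss_map_eq)
    show "Q = poly (\<omega> $ 1) 1" "- P = poly (\<omega> $ 2) 1" "varY * P - varX * Q = poly (\<omega> $ 3) 1"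
      unfolding P Q \<omega>_def crossp_nth poly_diff poly_mult W c
      by (simp_all only: a_def b_def vector_3 n) (simp_all only: sm, algebra+)
  qed
  interpret A: kummer_cover T a "- b" \<theta> d by (rule kummer)
  have "galois_foliation \<omega>" unfolding galois_foliation_def by (rule A.galois)
  moreover have "weighted_branching_type \<omega> (Poly_Mapping.single [d] 2)"
    unfolding weighted_branching_type_def using kummer_cover_branching[OF kummer] by blast
  ultimately show ?thesis unfolding G using genus by blast
qed

end
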